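(* Let $a>0$, $b>0$, $a\neq b$. Assume that $\alpha_1>0$, $\alpha_2>0$ and $L>0$. Then there exist constants $C_0,\mu_0>0$ such that, for any $(\eta_0,u_0)\in X_0:=[L^2(0,L)]^2$, the system $$\begin{cases}\eta_t+u_x-au_{xxx}+bu_{xxxxx}=0,&\text{in }(0,L)\times(0,\infty),\\ u_t+\eta_x-a\eta_{xxx}+b\eta_{xxxxx}=0,&\text{in }(0,L)\times(0,\infty),\\ \eta(0,t)=\eta(L,t)=\eta_x(0,t)=\eta_x(L,t)=0,&\text{in }(0,\infty),\\ u(0,t)=u(L,t)=u_x(0,t)=u_x(L,t)=0,&\text{in }(0,\infty),\\ u_{xx}(0,t)+\alpha_1\eta_{xx}(0,t)=0,\quad u_{xx}(L,t)-\alpha_2\eta_{xx}(L,t)=0,&\text{in }(0,\infty),\\ \eta(x,0)=\eta_0(x),\quad u(x,0)=u_0(x),&\text{in }(0,L),\end{cases}$$ admits a unique solution $(\eta,u)$, which belongs to $C^0([0,T];X_0)\cap L^2(0,T;[H^2(0,L)]^2)$ for every $T>0$ and satisfies $$\|(\eta(t),u(t))\|_{X_0}\le C_0e^{-\mu_0t}\|(\eta_0,u_0)\|_{X_0},\qquad\forall t\ge0.$$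
   Context: $X_0=[L^2(0,L)]^2$ carries its usual inner product. Solutions are mild solutions $(\eta(t),u(t))=S(t)(\eta_0,u_0)$, where $(S(t))_{t\ge0}$ is the $C_0$-semigroup of contractions on $X_0$ generated by $A(\eta,u)=(-u_x+au_{xxx}-bu_{xxxxx},\,-\eta_x+a\eta_{xxx}-b\eta_{xxxxx})$ with domain $D(A)=\{(\eta,u)\in[H^5(0,L)\cap H^2_0(0,L)]^2:u_{xx}(0)+\alpha_1\eta_{xx}(0)=0,\ u_{xx}(L)-\alpha_2\eta_{xx}(L)=0\}$. *)

theory Defs
  imports "HOL-Analysis.Analysis"
begin

text \<open>
  The \<open>L\<^sup>2\<close> and Sobolev spaces on \<open>(0,L)\<close> are sets of representatives: functions on the whole line,
  of which only the restriction to \<open>(0,L)\<close> matters, and two of which represent the same element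
  iff they agree almost everywhere on \<open>(0,L)\<close>. All functions are real-valued.
\<close>

subsection \<open>Square-integrable functions\<close>

definition L2_space :: "real \<Rightarrow> (real \<Rightarrow> real) set" where
  "L2_space L = {f. f \<in> borel_measurable (lebesgue_on {0<..<L}) \<and>
                    integrable (lebesgue_on {0<..<L}) (\<lambda>x. (f x)\<^sup>2)}"

definition L2_inner :: "real \<Rightarrow> (real \<Rightarrow> real) \<Rightarrow> (real \<Rightarrow> real) \<Rightarrow> real" where
  "L2_inner L f g = (LINT x|lebesgue_on {0<..<L}. f x * g x)"

definition L2_norm :: "real \<Rightarrow> (real \<Rightarrow> real) \<Rightarrow> real" where
  "L2_norm L f = sqrt (L2_inner L f f)"


subsection \<open>Weak derivatives, Sobolev spaces and traces\<close>

definition test_function :: "real \<Rightarrow> (real \<Rightarrow> real) \<Rightarrow> bool" where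
  "test_function L \<phi> \<longleftrightarrow>
     (\<forall>n x. ((deriv ^^ n) \<phi>) differentiable (at x)) \<and>
     (\<exists>K. compact K \<and> K \<subseteq> {0<..<L} \<and> (\<forall>x. x \<notin> K \<longrightarrow> \<phi> x = 0))"

definition has_weak_deriv :: "real \<Rightarrow> nat \<Rightarrow> (real \<Rightarrow> real) \<Rightarrow> (real \<Rightarrow> real) \<Rightarrow> bool" where
  "has_weak_deriv L k f g \<longleftrightarrow>
     (\<forall>\<phi>. test_function L \<phi> \<longrightarrow>
        (LINT x|lebesgue_on {0<..<L}. f x * (deriv ^^ k) \<phi> x) =
        (- 1) ^ k * (LINT x|lebesgue_on {0<..<L}. g x * \<phi> x))"

text \<open>The \<open>k\<close>-th weak derivative is determined only up to a null set; we fix some representative of it.\<close>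

definition weak_deriv :: "real \<Rightarrow> nat \<Rightarrow> (real \<Rightarrow> real) \<Rightarrow> real \<Rightarrow> real" where
  "weak_deriv L k f = (SOME g. g \<in> L2_space L \<and> has_weak_deriv L k f g)"

definition sobolev_space :: "nat \<Rightarrow> real \<Rightarrow> (real \<Rightarrow> real) set" where
  "sobolev_space m L =
     {f \<in> L2_space L. \<forall>k\<le>m. \<exists>g \<in> L2_space L. has_weak_deriv L k f g}"

definition sobolev_norm :: "nat \<Rightarrow> real \<Rightarrow> (real \<Rightarrow> real) \<Rightarrow> real" where
  "sobolev_norm m L f = sqrt (\<Sum>k\<le>m. (L2_norm L (weak_deriv L k f))\<^sup>2)"

text \<open>\<open>H\<^sup>m\<^sub>0(0,L)\<close>: the closure of the test functions in \<open>H\<^sup>m(0,L)\<close>.\<close>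

definition sobolev_space_0 :: "nat \<Rightarrow> real \<Rightarrow> (real \<Rightarrow> real) set" where
  "sobolev_space_0 m L =
     {f \<in> sobolev_space m L. \<forall>\<epsilon>>0. \<exists>\<phi>. test_function L \<phi> \<and> sobolev_norm m L (\<lambda>x. f x - \<phi> x) < \<epsilon>}"

text \<open>
  Boundary values are those of the representative that is continuous on \<open>[0,L]\<close>. It exists for
  elements of \<open>H\<^sup>1(0,L)\<close>, and its values on \<open>[0,L]\<close> are then uniquely determined.
\<close>

definition trace :: "real \<Rightarrow> (real \<Rightarrow> real) \<Rightarrow> real \<Rightarrow> real" where
  "trace L f = (SOME g. continuous_on {0..L} g \<and> (AE x in lebesgue_on {0<..<L}. f x = g x))"


subsection \<open>The state space \<open>X\<^sub>0 = [L\<^sup>2(0,L)]\<^sup>2\<close>\<close>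

text \<open>A state is the pair \<open>(\<eta>, u)\<close>.\<close>

type_synonym state = "(real \<Rightarrow> real) \<times> (real \<Rightarrow> real)"

definition X0 :: "real \<Rightarrow> state set" where
  "X0 L = L2_space L \<times> L2_space L"

definition X0_inner :: "real \<Rightarrow> state \<Rightarrow> state \<Rightarrow> real" where
  "X0_inner L z w = L2_inner L (fst z) (fst w) + L2_inner L (snd z) (snd w)"

definition X0_norm :: "real \<Rightarrow> state \<Rightarrow> real" where
  "X0_norm L z = sqrt (X0_inner L z z)"

definition X0_eq :: "real \<Rightarrow> state \<Rightarrow> state \<Rightarrow> bool" where
  "X0_eq L z w \<longleftrightarrow> (AE x in lebesgue_on {0<..<L}. fst z x = fst w x \<and> snd z x = snd w x)"

definition lincomb :: "real \<Rightarrow> state \<Rightarrow> real \<Rightarrow> state \<Rightarrow> state" where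
  "lincomb r z s w = ((\<lambda>x. r * fst z x + s * fst w x), (\<lambda>x. r * snd z x + s * snd w x))"

abbreviation state_diff :: "state \<Rightarrow> state \<Rightarrow> state" where
  "state_diff z w \<equiv> lincomb 1 z (- 1) w"


subsection \<open>Semigroups on \<open>X\<^sub>0\<close> and their generators\<close>

definition C0_contraction_semigroup :: "real \<Rightarrow> (real \<Rightarrow> state \<Rightarrow> state) \<Rightarrow> bool" where
  "C0_contraction_semigroup L S \<longleftrightarrow>
     (\<forall>t\<ge>0. \<forall>z \<in> X0 L. S t z \<in> X0 L) \<and>
     (\<forall>t\<ge>0. \<forall>z \<in> X0 L. \<forall>w \<in> X0 L. X0_eq L z w \<longrightarrow> X0_eq L (S t z) (S t w)) \<and>
     (\<forall>t\<ge>0. \<forall>z \<in> X0 L. \<forall>w \<in> X0 L. \<forall>r s.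
        X0_eq L (S t (lincomb r z s w)) (lincomb r (S t z) s (S t w))) \<and>
     (\<forall>t\<ge>0. \<forall>z \<in> X0 L. X0_norm L (S t z) \<le> X0_norm L z) \<and>
     (\<forall>z \<in> X0 L. X0_eq L (S 0 z) z) \<and>
     (\<forall>s\<ge>0. \<forall>t\<ge>0. \<forall>z \<in> X0 L. X0_eq L (S (s + t) z) (S s (S t z))) \<and>
     (\<forall>z \<in> X0 L. ((\<lambda>t. X0_norm L (state_diff (S t z) z)) \<longlongrightarrow> 0) (at_right 0))"

text \<open>
  The operator \<open>A\<close> with domain \<open>D\<close> is the infinitesimal generator of \<open>S\<close>: \<open>(S h z - z) / h\<close> has a
  limit \<open>y\<close> as \<open>h \<rightarrow> 0+\<close> exactly if \<open>z\<close> is in \<open>D\<close>, and then \<open>y = A z\<close>.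
\<close>

definition is_generator ::
  "real \<Rightarrow> state set \<Rightarrow> (state \<Rightarrow> state) \<Rightarrow> (real \<Rightarrow> state \<Rightarrow> state) \<Rightarrow> bool" where
  "is_generator L D A S \<longleftrightarrow>
     (\<forall>z \<in> X0 L. \<forall>y \<in> X0 L.
        ((\<lambda>h. X0_norm L (state_diff (lincomb (1 / h) (S h z) (- (1 / h)) z) y)) \<longlongrightarrow> 0) (at_right 0)
        \<longleftrightarrow> z \<in> D \<and> X0_eq L y (A z))"


subsection \<open>The operator of the system and mild solutions\<close>

definition op_A :: "real \<Rightarrow> real \<Rightarrow> real \<Rightarrow> state \<Rightarrow> state" where
  "op_A a b L = (\<lambda>(\<eta>, u).
     ((\<lambda>x. - weak_deriv L 1 u x + a * weak_deriv L 3 u x - b * weak_deriv L 5 u x),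
      (\<lambda>x. - weak_deriv L 1 \<eta> x + a * weak_deriv L 3 \<eta> x - b * weak_deriv L 5 \<eta> x)))"

definition dom_A :: "real \<Rightarrow> real \<Rightarrow> real \<Rightarrow> state set" where
  "dom_A \<alpha>\<^sub>1 \<alpha>\<^sub>2 L =
     {(\<eta>, u).
        \<eta> \<in> sobolev_space 5 L \<inter> sobolev_space_0 2 L \<and>
        u \<in> sobolev_space 5 L \<inter> sobolev_space_0 2 L \<and>
        trace L (weak_deriv L 2 u) 0 + \<alpha>\<^sub>1 * trace L (weak_deriv L 2 \<eta>) 0 = 0 \<and>
        trace L (weak_deriv L 2 u) L - \<alpha>\<^sub>2 * trace L (weak_deriv L 2 \<eta>) L = 0}"

text \<open>
  \<open>z\<close> is the mild solution with initial state \<open>z\<^sub>0\<close>, that is, \<open>z(t) = S(t) z\<^sub>0\<close> for \<open>t \<ge> 0\<close>, where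
  \<open>S\<close> is a contraction semigroup generated by the operator above.
\<close>

definition mild_solution ::
  "real \<Rightarrow> real \<Rightarrow> real \<Rightarrow> real \<Rightarrow> real \<Rightarrow> state \<Rightarrow> (real \<Rightarrow> state) \<Rightarrow> bool" where
  "mild_solution a b \<alpha>\<^sub>1 \<alpha>\<^sub>2 L z\<^sub>0 z \<longleftrightarrow>
     (\<exists>S. C0_contraction_semigroup L S \<and>
          is_generator L (dom_A \<alpha>\<^sub>1 \<alpha>\<^sub>2 L) (op_A a b L) S \<and>
          (\<forall>t\<ge>0. z t \<in> X0 L \<and> X0_eq L (z t) (S t z\<^sub>0)))"


subsection \<open>Spaces of functions of time\<close>

definition continuous_in_X0 :: "real \<Rightarrow> real \<Rightarrow> (real \<Rightarrow> state) \<Rightarrow> bool" where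
  "continuous_in_X0 T L z \<longleftrightarrow>
     (\<forall>t \<in> {0..T}. z t \<in> X0 L \<and>
        ((\<lambda>s. X0_norm L (state_diff (z s) (z t))) \<longlongrightarrow> 0) (at t within {0..T}))"

definition H2_pair :: "real \<Rightarrow> state set" where
  "H2_pair L = sobolev_space 2 L \<times> sobolev_space 2 L"

definition H2_pair_norm :: "real \<Rightarrow> state \<Rightarrow> real" where
  "H2_pair_norm L z = sqrt ((sobolev_norm 2 L (fst z))\<^sup>2 + (sobolev_norm 2 L (snd z))\<^sup>2)"

text \<open>
  The Bochner space \<open>L\<^sup>2(0,T;[H\<^sup>2(0,L)]\<^sup>2)\<close>. The second conjunct is strong measurability: \<open>z\<close> is
  almost everywhere the limit of simple functions with values in \<open>[H\<^sup>2(0,L)]\<^sup>2\<close>.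
\<close>

definition bochner_L2_H2 :: "real \<Rightarrow> real \<Rightarrow> (real \<Rightarrow> state) \<Rightarrow> bool" where
  "bochner_L2_H2 T L z \<longleftrightarrow>
     (AE t in lebesgue_on {0<..<T}. z t \<in> H2_pair L) \<and>
     (\<exists>s :: nat \<Rightarrow> real \<Rightarrow> state.
        (\<forall>n. simple_function (lebesgue_on {0<..<T}) (s n) \<and> (\<forall>t. s n t \<in> H2_pair L)) \<and>
        (AE t in lebesgue_on {0<..<T}.
           (\<lambda>n. H2_pair_norm L (state_diff (s n t) (z t))) \<longlonglongrightarrow> 0)) \<and>
     integrable (lebesgue_on {0<..<T}) (\<lambda>t. (H2_pair_norm L (z t))\<^sup>2)"

end

theory Submission
  imports Defs
begin

text \<open>
  The operator is dissipative, and every element of its domain satisfies the multiplier identity obtained from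
  \<open>x\<close>: with \<open>\<Lambda> = \<integral> x \<eta> u\<close>, the time derivative of \<open>\<Lambda>\<close> is \<open>1/2\<close> times the squared
  \<open>L\<^sup>2\<close> norm plus positive multiples of the squared norms of the first and second derivatives, minus
  a multiple of the squared second derivatives at \<open>x = L\<close>. The latter are controlled by the dissipation of the energy, so
  for small \<open>\<kappa>\<close> the functional \<open>1/2 \<parallel>(\<eta>, u)\<parallel>\<^sup>2 - \<kappa> \<Lambda>\<close> is equivalent to the energy and
  decays exponentially; integrating its decay rate also bounds the norm in \<open>L\<^sup>2(0,T;[H\<^sup>2]\<^sup>2)\<close>. No compactness or
  unique continuation is needed. The same identity makes the operator injective, with which the resolvent problem reduces to
  one coercive problem and a two-by-two linear system; the semigroup is then the limit of the Yosida approximations.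

  Integration by parts is the identity \<open>\<langle>V f, g\<rangle> + \<langle>f, V g\<rangle> = \<langle>f, 1\<rangle> \<langle>g, 1\<rangle>\<close>
  for the operator \<open>V\<close> of integration from the left end point, so that the boundary value problem becomes algebra in a
  Hilbert space.
\<close>

section \<open>Hilbert space tools\<close>

text \<open>The operator A is handled through its inverse, a bounded, injective, dissipative map B
  on the whole space: z lies in the domain with A z = y exactly when z = B y. The domain is then a
  range, and the Yosida approximation A (1 - eps A)^-1 is just (B - eps)^-1. Estimates are proved
  for data B y and extended by density. For the H^2 bound this is the delicate point: at a fixed
  time the second derivatives are controlled only by A z, but their time integral is controlled by
  the norm of the initial state itself, and only such a bound survives the passage to the limit. The
  multiplier x vanishes at the left end, so it produces a boundary term at x = L only, and
  \<open>\<kappa>\<close> is small relative to L, \<open>\<alpha>\<^sub>2\<close> and the norm of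
  multiplication by x. A type cannot depend on L, and the given spaces consist of functions, not of
  classes. Hence the Hilbert space is one type \<open>l2\<close> over (0,1); \<open>emb\<close>
  rescales a function on (0,L) and takes its class, \<open>rep\<close> goes back. Weak derivatives,
  the clamped conditions and traces are all reduced to one relation \<open>prim\<close>: a class
  equals a constant plus the integral of another.\<close>

lemma quadratic_nonneg_imp_linear_zero:
  fixes p q :: real
  assumes "\<And>t. 0 \<le> t * p + t\<^sup>2 * q"
  shows "p = 0"
proof (rule ccontr)
  assume "p \<noteq> 0"
  \<comment> \<open>At t = - s p the linear term is - s p^2, and s |q| < 1 keeps the quadratic term
    strictly below it in size.\<close>
  define s where "s = 1 / (\<bar>q\<bar> + 1)"
  have s: "s > 0" "s * \<bar>q\<bar> < 1" by (auto simp: s_def field_simps)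
  have "0 \<le> (- s * p) * p + (- s * p)\<^sup>2 * q" using assms[of "- s * p"] .
  also have "\<dots> = (s * p\<^sup>2) * (s * q - 1)" by (simp add: power2_eq_square algebra_simps)
  finally have "0 \<le> (s * p\<^sup>2) * (s * q - 1)" .
  moreover have "s * p\<^sup>2 > 0" using s \<open>p \<noteq> 0\<close> by simp
  moreover have "s * q \<le> s * \<bar>q\<bar>" using s by (simp add: mult_left_mono)
  ultimately show False using s(2) by (simp add: zero_le_mult_iff)
qed

text \<open>A minimising sequence for the distance to S is Cauchy by the parallelogram law. Its
  limit is a closest point, and minimality along every line through that point gives
  orthogonality.\<close>

lemma orthogonal_projection_exists:
  fixes S :: "'h::{real_inner,banach} set"
  assumes S: "subspace S" "closed S"
  shows "\<exists>y\<in>S. \<forall>s\<in>S. inner (x - y) s = 0"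
proof -
  have ne: "S \<noteq> {}" using S subspace_0 by auto
  define d where "d = infdist x S"
  have d0: "d \<ge> 0" by (simp add: d_def infdist_nonneg)
  have dle: "d \<le> norm (x - s)" if "s \<in> S" for s
    using infdist_le[OF that, of x] by (simp add: d_def dist_norm)
  have "\<exists>y\<in>S. norm (x - y) < d + 1 / (real n + 1)" for n :: nat
  proof (rule ccontr)
    assume "\<not> ?thesis"
    then have "\<And>y. y \<in> S \<Longrightarrow> d + 1 / (real n + 1) \<le> dist x y" by (force simp: dist_norm)
    then have "d + 1 / (real n + 1) \<le> infdist x S"
      unfolding infdist_notempty[OF ne] by (intro cINF_greatest ne)
    then show False by (simp add: d_def add_increasing divide_le_0_iff)
  qed
  then obtain y where yS: "\<And>n. y n \<in> S" and y: "\<And>n. norm (x - y n) < d + 1 / (real n + 1)"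
    by metis
  \<comment> \<open>The midpoint of \<open>y n\<close> and \<open>y m\<close> lies in S, hence at
    distance at least d from x; with the parallelogram law the gap is bounded by the two excesses p
    and q over d.\<close>
  have bound: "(norm (y n - y m))\<^sup>2 \<le> (4 * d + 2) * (1 / (real n + 1) + 1 / (real m + 1))" for n m
  proof -
    define p q where "p = 1 / (real n + 1)" and "q = 1 / (real m + 1)"
    have pq: "0 < p" "p \<le> 1" "0 < q" "q \<le> 1" by (auto simp: p_def q_def)
    have "(1/2) *\<^sub>R (y n + y m) \<in> S" using S yS by (simp add: subspace_add subspace_scale)
    then have "d \<le> norm (x - (1/2) *\<^sub>R (y n + y m))" by (rule dle)
    then have "d\<^sup>2 \<le> (norm (x - (1/2) *\<^sub>R (y n + y m)))\<^sup>2" using d0 by (simp add: power_mono)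
    moreover have "(norm (y n - y m))\<^sup>2 = 2 * (norm (x - y n))\<^sup>2 + 2 * (norm (x - y m))\<^sup>2
        - 4 * (norm (x - (1/2) *\<^sub>R (y n + y m)))\<^sup>2"
      unfolding power2_norm_eq_inner
      by (simp add: inner_simps inner_commute algebra_simps)
    moreover have "(norm (x - y n))\<^sup>2 \<le> (d + p)\<^sup>2" "(norm (x - y m))\<^sup>2 \<le> (d + q)\<^sup>2"
      using y[of n] y[of m] by (auto simp: p_def q_def intro!: power_mono)
    moreover have "p\<^sup>2 \<le> p" "q\<^sup>2 \<le> q" using pq by (auto simp: power2_eq_square mult_left_le)
    ultimately show ?thesis unfolding p_def[symmetric] q_def[symmetric]
      by (simp add: power2_sum algebra_simps)
  qed
  have "Cauchy y"
  proof (rule metric_CauchyI)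
    fix \<epsilon> :: real assume "\<epsilon> > 0"
    define k where "k = (4 * d + 2) * 2"
    have k: "k > 0" using d0 by (simp add: k_def)
    obtain N :: nat where N: "k / \<epsilon>\<^sup>2 < real N" using reals_Archimedean2 by blast
    show "\<exists>M. \<forall>m\<ge>M. \<forall>n\<ge>M. dist (y m) (y n) < \<epsilon>"
    proof (intro exI allI impI)
      fix m n assume "m \<ge> N" "n \<ge> N"
      then have "1 / (real m + 1) \<le> 1 / (real N + 1)" "1 / (real n + 1) \<le> 1 / (real N + 1)"
        by (auto intro!: divide_left_mono)
      then have "(4 * d + 2) * (1 / (real m + 1) + 1 / (real n + 1)) \<le> (4 * d + 2) * (2 * (1 / (real N + 1)))"
        using d0 by (intro mult_left_mono) auto
      then have "(norm (y m - y n))\<^sup>2 \<le> k / (real N + 1)"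
        using bound[of m n] by (simp add: k_def)
      also have "\<dots> < \<epsilon>\<^sup>2"
      proof -
        have "k < real N * \<epsilon>\<^sup>2" using N \<open>\<epsilon> > 0\<close> by (simp add: field_simps)
        also have "\<dots> < (real N + 1) * \<epsilon>\<^sup>2" using \<open>\<epsilon> > 0\<close> by simp
        finally show ?thesis by (simp add: field_simps)
      qed
      finally show "dist (y m) (y n) < \<epsilon>"
        using \<open>\<epsilon> > 0\<close> by (simp add: dist_norm power_less_imp_less_base)
    qed
  qed
  then obtain z where z: "y \<longlonglongrightarrow> z" using Cauchy_convergent_iff convergent_def by blast
  have zS: "z \<in> S" using closed_sequentially[OF S(2)] yS z by blast
  have "(\<lambda>n. d + 1 / (real n + 1)) \<longlonglongrightarrow> d + 0"
    by (intro tendsto_intros LIMSEQ_Suc[OF lim_const_over_n[of 1], simplified] ) (use LIMSEQ_inverse_real_of_nat in \<open>simp add: inverse_eq_divide add.commute\<close>)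
  then have "norm (x - z) \<le> d"
    by (intro LIMSEQ_le[of "\<lambda>n. norm (x - y n)" _ "\<lambda>n. d + 1 / (real n + 1)"])
       (auto intro!: tendsto_intros z less_imp_le[OF y])
  then have min: "norm (x - z) \<le> norm (x - s)" if "s \<in> S" for s using dle[OF that] by simp
  have "inner (x - z) s = 0" if "s \<in> S" for s
  proof -
    have "0 \<le> t * (- 2 * inner (x - z) s) + t\<^sup>2 * inner s s" for t
    proof -
      have "norm (x - z) \<le> norm (x - (z + t *\<^sub>R s))"
        using zS that S by (intro min) (simp add: subspace_add subspace_scale)
      then have "(norm (x - z))\<^sup>2 \<le> (norm (x - (z + t *\<^sub>R s)))\<^sup>2" by (simp add: power_mono)
      then show ?thesis unfolding power2_norm_eq_inner
        by (simp add: inner_simps inner_commute algebra_simps power2_eq_square)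
    qed
    from quadratic_nonneg_imp_linear_zero[OF this] show ?thesis by simp
  qed
  with zS show ?thesis by blast
qed

lemma subspace_closure_normed:
  fixes S :: "'h::real_normed_vector set"
  assumes "subspace S"
  shows "subspace (closure S)"
proof (rule subspaceI)
  show "0 \<in> closure S" using assms closure_subset subspace_0 by blast
  show "x + y \<in> closure S" if "x \<in> closure S" "y \<in> closure S" for x y
  proof -
    obtain f g where "\<And>n. f n \<in> S" "f \<longlonglongrightarrow> x" "\<And>n. g n \<in> S" "g \<longlonglongrightarrow> y"
      using \<open>x \<in> closure S\<close> \<open>y \<in> closure S\<close> unfolding closure_sequential by blast
    then show ?thesis unfolding closure_sequential
      by (intro exI[of _ "\<lambda>n. f n + g n"] conjI allI tendsto_add) (simp_all add: assms subspace_add)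
  qed
  show "c *\<^sub>R x \<in> closure S" if "x \<in> closure S" for c x
  proof -
    obtain f where "\<And>n. f n \<in> S" "f \<longlonglongrightarrow> x" using \<open>x \<in> closure S\<close> unfolding closure_sequential by blast
    then show ?thesis unfolding closure_sequential
      by (intro exI[of _ "\<lambda>n. c *\<^sub>R f n"] conjI allI tendsto_scaleR tendsto_const) (simp_all add: assms subspace_scale)
  qed
qed

lemma dense_if_orthogonal_trivial:
  fixes S :: "'h::{real_inner,banach} set"
  assumes S: "subspace S" and triv: "\<And>x. (\<And>s. s \<in> S \<Longrightarrow> inner x s = 0) \<Longrightarrow> x = 0"
  shows "closure S = UNIV"
proof -
  have "x \<in> closure S" for x
  proof -
    obtain y where y: "y \<in> closure S" "\<forall>s\<in>closure S. inner (x - y) s = 0"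
      using orthogonal_projection_exists[OF subspace_closure_normed[OF S] closed_closure, of x] by auto
    then have "x - y = 0" using closure_subset by (intro triv) blast
    then show ?thesis using y by simp
  qed
  then show ?thesis by blast
qed

text \<open>Lax-Milgram in operator form: for r = c / K^2, K an operator bound, the map x - r (T x -
  f) is a contraction, and its fixed point solves the equation.\<close>

lemma coercive_imp_surj:
  fixes T :: "'h::{real_inner,banach} \<Rightarrow> 'h"
  assumes T: "bounded_linear T" and c: "c > 0" "\<And>x. c * (norm x)\<^sup>2 \<le> inner (T x) x"
  shows "\<exists>x. T x = f"
proof -
  interpret T: bounded_linear T by fact
  obtain K0 where K0: "\<And>x. norm (T x) \<le> norm x * K0" using T.bounded by blast
  \<comment> \<open>The bound is enlarged beyond c, so that 1 - c^2 / K^2, the square of the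
    contraction factor, lies strictly between 0 and 1.\<close>
  define K where "K = max K0 (2 * c)"
  have K: "K > 0" "c < K" using c(1) by (auto simp: K_def)
  have Kb: "norm (T x) \<le> K * norm x" for x
  proof -
    have "norm x * K0 \<le> norm x * K" by (rule mult_left_mono) (auto simp: K_def)
    then show ?thesis using K0[of x] by (simp add: mult.commute)
  qed
  define r where "r = c / K\<^sup>2"
  define q where "q = sqrt (1 - c\<^sup>2 / K\<^sup>2)"
  have q01: "c\<^sup>2 / K\<^sup>2 < 1" "0 < c\<^sup>2 / K\<^sup>2" using K c by (auto simp: power_strict_mono)
  have lip: "norm (x - r *\<^sub>R T x) \<le> q * norm x" for x
  proof -
    have "(norm (x - r *\<^sub>R T x))\<^sup>2 = (norm x)\<^sup>2 - 2 * r * inner (T x) x + r\<^sup>2 * (norm (T x))\<^sup>2"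
      unfolding power2_norm_eq_inner
      by (simp add: inner_simps inner_commute algebra_simps power2_eq_square)
    also have "\<dots> \<le> (norm x)\<^sup>2 - 2 * r * (c * (norm x)\<^sup>2) + r\<^sup>2 * (K * norm x)\<^sup>2"
      using c K Kb by (intro add_mono diff_mono mult_left_mono power_mono) (auto simp: r_def)
    also have "\<dots> = (1 - c\<^sup>2 / K\<^sup>2) * (norm x)\<^sup>2"
      using K by (simp add: r_def field_simps power2_eq_square)
    also have "\<dots> = (q * norm x)\<^sup>2" using q01 by (simp add: q_def power_mult_distrib)
    finally show ?thesis by (rule power2_le_imp_le) (use q01 in \<open>simp add: q_def\<close>)
  qed
  have "\<exists>!x. x - r *\<^sub>R (T x - f) = x"
  proof (rule banach_fix_type[of q], goal_cases)
    case 1 then show ?case using q01 by (simp add: q_def)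
  next
    case 2 then show ?case using q01 by (simp add: q_def)
  next
    case 3
    show ?case using lip[of "x - y" for x y]
      by (auto simp: dist_norm T.diff algebra_simps)
  qed
  moreover have "r \<noteq> 0" using c K by (simp add: r_def)
  ultimately show ?thesis by (auto simp: ex1_implies_ex)
qed

section \<open>Exponentials of bounded operators\<close>

definition expop :: "('h::banach \<Rightarrow> 'h) \<Rightarrow> real \<Rightarrow> 'h \<Rightarrow> 'h" where
  "expop C t x = (\<Sum>n. (t ^ n / fact n) *\<^sub>R (C ^^ n) x)"

lemma funpow_norm_bound:
  fixes C :: "'h::real_normed_vector \<Rightarrow> 'h"
  assumes "K \<ge> 0" "\<And>x. norm (C x) \<le> K * norm x"
  shows "norm ((C ^^ n) x) \<le> K ^ n * norm x"
proof (induction n)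
  case (Suc n)
  have "norm ((C ^^ Suc n) x) \<le> K * norm ((C ^^ n) x)" using assms(2)[of "(C ^^ n) x"] by simp
  also have "\<dots> \<le> K * (K ^ n * norm x)" using Suc assms(1) by (rule mult_left_mono)
  finally show ?case by simp
qed simp

lemma expop_summable:
  assumes C: "bounded_linear (C::'h::banach \<Rightarrow> 'h)"
  shows "summable (\<lambda>n. (t ^ n / fact n) *\<^sub>R (C ^^ n) x)"
proof -
  obtain K where K: "K > 0" "\<And>x. norm (C x) \<le> norm x * K"
    using bounded_linear.pos_bounded[OF C] by blast
  have "summable (\<lambda>n. inverse (fact n) * (\<bar>t\<bar> * K) ^ n * norm x)"
    by (intro summable_mult2 summable_exp)
  then show ?thesis
  proof (rule summable_comparison_test'[where N = 0])
    fix n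
    have "norm ((C ^^ n) x) \<le> K ^ n * norm x"
      using K by (intro funpow_norm_bound) (auto simp: mult.commute)
    then have "(\<bar>t\<bar> ^ n / fact n) * norm ((C ^^ n) x) \<le> (\<bar>t\<bar> ^ n / fact n) * (K ^ n * norm x)"
      by (rule mult_left_mono) auto
    then show "norm ((t ^ n / fact n) *\<^sub>R (C ^^ n) x) \<le> inverse (fact n) * (\<bar>t\<bar> * K) ^ n * norm x"
      by (simp add: power_abs power_mult_distrib field_simps)
  qed
qed

lemma expop_0: "expop C 0 x = x"
proof -
  have "(\<lambda>n. (0 ^ n / fact n) *\<^sub>R (C ^^ n) x) sums ((0 ^ 0 / fact 0) *\<^sub>R (C ^^ 0) x)"
    using sums_single[of 0 "\<lambda>n. (0 ^ n / fact n) *\<^sub>R (C ^^ n) x"]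
    by (rule sums_cong[THEN iffD1, rotated]) auto
  then show ?thesis by (simp add: expop_def sums_iff)
qed

lemma expop_commute:
  assumes C: "bounded_linear C" and G: "bounded_linear G" and comm: "\<And>x. G (C x) = C (G x)"
  shows "G (expop C t x) = expop C t (G x)"
proof -
  interpret G: bounded_linear G by fact
  have "G ((C ^^ n) x) = (C ^^ n) (G x)" for n by (induction n) (auto simp: comm)
  then show ?thesis unfolding expop_def
    by (subst G.suminf[OF expop_summable[OF C]]) (simp add: G.scale)
qed

lemma expop_linear:
  assumes C: "bounded_linear C"
  shows "linear (expop C t)"
proof -
  have lin: "linear (C ^^ n)" for n
  proof (induction n)
    case 0 show ?case using linear_id by (simp add: id_def)
  next
    case (Suc n) then show ?case
      using linear_compose[OF Suc bounded_linear.linear[OF C]] by (simp add: o_def)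
  qed
  show ?thesis
  proof (rule linearI)
    show "expop C t (x + y) = expop C t x + expop C t y" for x y
      unfolding expop_def
      by (subst suminf_add[OF expop_summable[OF C] expop_summable[OF C]])
         (simp add: linear_add[OF lin] scaleR_add_right)
    show "expop C t (r *\<^sub>R x) = r *\<^sub>R expop C t x" for r x
      using bounded_linear.suminf[OF bounded_linear_scaleR_right expop_summable[OF C], of r t x]
      unfolding expop_def by (simp add: linear_scale[OF lin] mult.commute)
  qed
qed

text \<open>Term by term differentiation; the derived series converges uniformly on the bounded
  interval \<open>S\<close> around t.\<close>

lemma expop_deriv:
  assumes C: "bounded_linear (C::'h::banach \<Rightarrow> 'h)"
  shows "((\<lambda>t. expop C t x) has_vector_derivative expop C t (C x)) (at t)"
proof -
  interpret C: bounded_linear C by fact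
  obtain K where K: "K > 0" "\<And>x. norm (C x) \<le> norm x * K"
    using bounded_linear.pos_bounded[OF C] by blast
  define r where "r = \<bar>t\<bar> + 1"
  define S where "S = {-r<..<r}"
  define f where "f n s = (s ^ n / fact n) *\<^sub>R (C ^^ n) x" for n and s :: real
  define f' where "f' n s h = h *\<^sub>R ((real n * s ^ (n - 1) / fact n) *\<^sub>R (C ^^ n) x)" for n and s h :: real
  define g' where "g' s h = h *\<^sub>R expop C s (C x)" for s h :: real
  have tS: "t \<in> S" by (auto simp: S_def r_def)
  have f'_Suc: "f' (Suc n) s h = h *\<^sub>R ((s ^ n / fact n) *\<^sub>R (C ^^ n) (C x))" for n s h
  proof -
    have "real (Suc n) * s ^ n / fact (Suc n) = s ^ n / fact n" by (simp add: field_simps del: of_nat_Suc)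
    then show ?thesis unfolding f'_def by (simp only: diff_Suc_1 funpow_Suc_right o_apply)
  qed
  \<comment> \<open>The constant term drops out and each other factorial loses one factor: n + 1
    derived terms are the first n terms of the series at \<open>C x\<close>.\<close>
  have sum_f': "(\<Sum>i<Suc n. f' i s h) = h *\<^sub>R (\<Sum>i<n. (s ^ i / fact i) *\<^sub>R (C ^^ i) (C x))" for n s h
    unfolding sum.lessThan_Suc_shift f'_Suc by (simp add: f'_def scaleR_sum_right)
  have unif: "uniform_limit S (\<lambda>n s. \<Sum>i<n. (s ^ i / fact i) *\<^sub>R (C ^^ i) (C x)) (\<lambda>s. expop C s (C x)) sequentially"
    unfolding expop_def
  proof (rule Weierstrass_m_test)
    show "summable (\<lambda>n. inverse (fact n) * (r * K) ^ n * norm (C x))"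
      by (intro summable_mult2 summable_exp)
    fix n s assume "s \<in> S"
    then have s: "\<bar>s\<bar> \<le> r" by (auto simp: S_def)
    have "norm ((C ^^ n) (C x)) \<le> K ^ n * norm (C x)"
      using K by (intro funpow_norm_bound) (auto simp: mult.commute)
    then have "(\<bar>s\<bar> ^ n / fact n) * norm ((C ^^ n) (C x)) \<le> (r ^ n / fact n) * (K ^ n * norm (C x))"
      using s by (intro mult_mono divide_right_mono power_mono) auto
    then show "norm ((s ^ n / fact n) *\<^sub>R (C ^^ n) (C x)) \<le> inverse (fact n) * (r * K) ^ n * norm (C x)"
      by (simp add: power_abs power_mult_distrib field_simps)
  qed
  have "\<exists>g. \<forall>s\<in>S. (\<lambda>n. f n s) sums (g s) \<and> (g has_derivative g' s) (at s within S)"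
  proof (rule has_derivative_series[where f' = f' and x = t])
    show "convex S" by (simp add: S_def)
    show "(f n has_derivative f' n s) (at s within S)" for n s
      unfolding f_def f'_def
      by (auto intro!: derivative_eq_intros simp: scaleR_left.add mult.commute)
    show "\<forall>\<^sub>F n in sequentially. \<forall>s\<in>S. \<forall>h. norm ((\<Sum>i<n. f' i s h) - g' s h) \<le> \<epsilon> * norm h"
      if "\<epsilon> > 0" for \<epsilon>
    proof -
      have "\<forall>\<^sub>F n in sequentially. \<forall>s\<in>S. dist (\<Sum>i<n. (s ^ i / fact i) *\<^sub>R (C ^^ i) (C x)) (expop C s (C x)) < \<epsilon>"
        using uniform_limitD[OF unif that] .
      then have "\<forall>\<^sub>F n in sequentially. \<forall>s\<in>S. \<forall>h. norm ((\<Sum>i<Suc n. f' i s h) - g' s h) \<le> \<epsilon> * norm h"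
      proof eventually_elim
        case (elim n)
        show ?case
        proof (intro ballI allI)
          fix s h assume "s \<in> S"
          have "(\<Sum>i<Suc n. f' i s h) - g' s h = h *\<^sub>R ((\<Sum>i<n. (s ^ i / fact i) *\<^sub>R (C ^^ i) (C x)) - expop C s (C x))"
            unfolding sum_f' g'_def by (simp add: scaleR_diff_right)
          then have "norm ((\<Sum>i<Suc n. f' i s h) - g' s h) = \<bar>h\<bar> * dist (\<Sum>i<n. (s ^ i / fact i) *\<^sub>R (C ^^ i) (C x)) (expop C s (C x))"
            by (simp add: dist_norm)
          also have "\<dots> \<le> \<bar>h\<bar> * \<epsilon>" using elim \<open>s \<in> S\<close> by (intro mult_left_mono) (auto intro: less_imp_le)
          finally show "norm ((\<Sum>i<Suc n. f' i s h) - g' s h) \<le> \<epsilon> * norm h" by (simp add: mult.commute)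
        qed
      qed
      then show ?thesis
        unfolding eventually_sequentially by (metis Suc_le_D Suc_le_mono)
    qed
    show "t \<in> S" by fact
    show "(\<lambda>n. f n t) sums expop C t x"
      unfolding f_def expop_def by (rule summable_sums[OF expop_summable[OF C]])
  qed
  then obtain g where g: "\<And>s. s \<in> S \<Longrightarrow> (\<lambda>n. f n s) sums (g s)"
    "(g has_derivative g' t) (at t within S)" using tS by blast
  have eq: "g s = expop C s x" if "s \<in> S" for s
    using g(1)[OF that] by (simp add: sums_iff f_def expop_def)
  have "(g has_derivative g' t) (at t)"
    using g(2) tS by (simp add: S_def at_within_open[OF _ open_greaterThanLessThan])
  then have "((\<lambda>s. expop C s x) has_derivative g' t) (at t)"
    by (rule has_derivative_transform_within_open[of _ _ _ _ S]) (use tS eq in \<open>auto simp: S_def\<close>)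
  then show ?thesis unfolding has_vector_derivative_def g'_def .
qed

lemma has_real_derivative_norm_square:
  fixes f :: "real \<Rightarrow> 'h::real_inner"
  assumes "(f has_vector_derivative f') (at t within S)"
  shows "((\<lambda>t. (norm (f t))\<^sup>2) has_real_derivative 2 * inner (f t) f') (at t within S)"
proof -
  have "(f has_derivative (\<lambda>h. h *\<^sub>R f')) (at t within S)"
    using assms by (simp add: has_vector_derivative_def)
  from has_derivative_inner[OF this this] show ?thesis
    unfolding power2_norm_eq_inner has_field_derivative_def
    by (rule has_derivative_eq_rhs) (auto simp: fun_eq_iff inner_commute)
qed

lemma expop_deriv':
  assumes C: "bounded_linear C"
  shows "((\<lambda>t. expop C t x) has_vector_derivative C (expop C t x)) (at t)"
  using expop_deriv[OF C] expop_commute[OF C C] by metis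

section \<open>Estimates for dissipative linear differential equations\<close>

lemma norm_add_diff_le:
  "a = p + q - s \<Longrightarrow> norm p \<le> P \<Longrightarrow> norm q \<le> Q \<Longrightarrow> norm s \<le> R \<Longrightarrow> norm a \<le> P + Q + R"
  for a :: "'a::real_normed_vector"
  using norm_triangle_ineq4[of "p + q" s] norm_triangle_ineq[of p q] by simp

lemma norm_add_add_diff_le:
  "a = p + q + r - s \<Longrightarrow> norm p \<le> P \<Longrightarrow> norm q \<le> Q \<Longrightarrow> norm r \<le> M \<Longrightarrow> norm s \<le> R \<Longrightarrow> norm a \<le> P + Q + M + R"
  for a :: "'a::real_normed_vector"
  using norm_triangle_ineq4[of "p + q + r" s] norm_triangle_ineq[of "p + q" r] norm_triangle_ineq[of p q] by simp

text \<open>The derivative is taken within \<open>{0..}\<close> because a semigroup orbit is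
  differentiable only from the right at 0; the mean value theorem is applied inside the open
  interval.\<close>

lemma DERIV_nonpos_imp_le_0:
  fixes g :: "real \<Rightarrow> real"
  assumes d: "\<And>s. s \<ge> 0 \<Longrightarrow> (g has_real_derivative g' s) (at s within {0..})"
    and le: "\<And>s. s \<ge> 0 \<Longrightarrow> g' s \<le> 0" and t: "t \<ge> 0"
  shows "g t \<le> g 0"
proof (cases "t = 0")
  case False
  then have "t > 0" using t by simp
  have cont: "continuous_on {0..t} g"
    by (rule DERIV_continuous_on[of _ _ g'], rule DERIV_subset[OF d]) auto
  have deriv: "(g has_derivative (\<lambda>h. g' x * h)) (at x)" if "0 < x" "x < t" for x
  proof -
    have "(g has_real_derivative g' x) (at x within {0<..})"
      using that by (intro DERIV_subset[OF d[of x]]) auto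
    then have "(g has_real_derivative g' x) (at x)"
      using that at_within_open[of x "{0<..}"] by auto
    then show ?thesis by (simp add: has_field_derivative_def)
  qed
  obtain \<xi> where \<xi>: "\<xi> \<in> {0<..<t}" "g t - g 0 = g' \<xi> * t"
    using mvt[OF \<open>t > 0\<close> cont, of "\<lambda>x h. g' x * h"] deriv by auto
  moreover have "g' \<xi> * t \<le> 0" using le[of \<xi>] \<xi>(1) t by (intro mult_nonpos_nonneg) auto
  ultimately show ?thesis by simp
qed simp

text \<open>The derivative of the squared norm is twice the inner product of f and its derivative.
  Besides contractivity this gives uniqueness of orbits, when applied to a difference that starts at
  0.\<close>

lemma norm_le_if_dissipative_ode:
  fixes f :: "real \<Rightarrow> 'h::real_inner"
  assumes d: "\<And>s. s \<ge> 0 \<Longrightarrow> (f has_vector_derivative f' s) (at s within {0..})"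
    and le: "\<And>s. s \<ge> 0 \<Longrightarrow> inner (f s) (f' s) \<le> 0" and t: "t \<ge> 0"
  shows "norm (f t) \<le> norm (f 0)"
proof -
  have "(norm (f t))\<^sup>2 \<le> (norm (f 0))\<^sup>2"
    by (rule DERIV_nonpos_imp_le_0[where g' = "\<lambda>s. 2 * inner (f s) (f' s)"])
       (use d le t in \<open>auto intro: has_real_derivative_norm_square\<close>)
  then show ?thesis by (rule power2_le_imp_le) simp
qed

lemma expop_contraction:
  fixes C :: "'h::{real_inner,banach} \<Rightarrow> 'h"
  assumes C: "bounded_linear C" and diss: "\<And>x. inner (C x) x \<le> 0" and t: "t \<ge> 0"
  shows "norm (expop C t x) \<le> norm x"
  using norm_le_if_dissipative_ode[of "\<lambda>t. expop C t x" "\<lambda>t. C (expop C t x)" t]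
    expop_deriv'[OF C] diss t
  by (auto simp: expop_0 inner_commute intro: has_vector_derivative_at_within)

text \<open>As functions of s both sides solve the same dissipative equation with the same initial
  value, so their difference stays 0.\<close>

lemma expop_add:
  fixes C :: "'h::{real_inner,banach} \<Rightarrow> 'h"
  assumes C: "bounded_linear C" and diss: "\<And>x. inner (C x) x \<le> 0" and t: "s \<ge> 0" "t \<ge> 0"
  shows "expop C (s + t) x = expop C s (expop C t x)"
proof -
  interpret C: bounded_linear C by fact
  define w where "w r = expop C (r + t) x - expop C r (expop C t x)" for r
  have 1: "((\<lambda>r. expop C (r + t) x) has_vector_derivative C (expop C (r + t) x)) (at r)" for r
  proof -
    have "((\<lambda>r. expop C r x) \<circ> (\<lambda>r. r + t) has_vector_derivative 1 *\<^sub>R C (expop C (r + t) x)) (at r)"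
      by (rule vector_diff_chain_at) (auto intro!: derivative_eq_intros expop_deriv'[OF C])
    then show ?thesis by (simp add: o_def)
  qed
  have "(w has_vector_derivative C (w r)) (at r)" for r
    unfolding w_def C.diff by (intro has_vector_derivative_diff 1 expop_deriv'[OF C])
  then have "norm (w s) \<le> norm (w 0)"
    by (intro norm_le_if_dissipative_ode[where f' = "\<lambda>r. C (w r)"])
       (auto intro: has_vector_derivative_at_within t simp: inner_commute[of "w s" "C (w s)" for s] diss)
  then show ?thesis by (simp add: w_def expop_0)
qed

text \<open>The difference w of the two orbits starts at 0 and solves w' = C w + exp(s C') (C x - C'
  x); commutation moves the defect inside the exponential. The term C w can only decrease the norm,
  so the error grows at most linearly in time.\<close>

lemma expop_diff_bound:
  fixes C C' :: "'h::{real_inner,banach} \<Rightarrow> 'h"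
  assumes C: "bounded_linear C" and diss: "\<And>x. inner (C x) x \<le> 0"
    and C': "bounded_linear C'" and diss': "\<And>x. inner (C' x) x \<le> 0"
    and comm: "\<And>x. C (C' x) = C' (C x)" and t: "t \<ge> 0"
  shows "norm (expop C t x - expop C' t x) \<le> 2 * t * norm (C x - C' x)"
proof -
  interpret C: bounded_linear C by fact
  interpret C': bounded_linear C' by fact
  define w where "w s = expop C s x - expop C' s x" for s
  define \<delta> where "\<delta> = norm (C x - C' x)"
  define w' where "w' s = C (w s) + expop C' s (C x - C' x)" for s
  have w': "(w has_vector_derivative w' s) (at s)" for s
  proof -
    have "(w has_vector_derivative (C (expop C s x) - C' (expop C' s x))) (at s)"
      unfolding w_def by (intro has_vector_derivative_diff expop_deriv' C C')
    moreover have "C (expop C s x) - C' (expop C' s x) = w' s"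
      using expop_commute[OF C' C, of s x] comm expop_commute[OF C' C', of s x]
      by (simp add: w'_def w_def C.diff linear_diff[OF expop_linear[OF C']])
    ultimately show ?thesis by simp
  qed
  have cont: "continuous_on {0..t} (\<lambda>s. norm (w s))"
    by (intro continuous_on_norm continuous_at_imp_continuous_on ballI has_vector_derivative_continuous[OF w'])
  \<comment> \<open>Instead of integrating, the point of largest deviation m is taken: the mean
    value theorem for the squared norm on [0,s] gives
    \<open>m\<^sup>2 \<le> 2 * t * m * \<delta>\<close>, where one factor m cancels.\<close>
  obtain s where s: "s \<in> {0..t}" "\<And>r. r \<in> {0..t} \<Longrightarrow> norm (w r) \<le> norm (w s)"
    using continuous_attains_sup[OF compact_Icc _ cont] t by auto
  define m where "m = norm (w s)"
  have "m\<^sup>2 \<le> 2 * t * m * \<delta>"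
  proof (cases "s = 0")
    case True
    then show ?thesis using t by (simp add: m_def w_def expop_0 \<delta>_def)
  next
    case False
    then have "0 < s" using s by simp
    have "\<exists>z. 0 < z \<and> z < s \<and> (norm (w s))\<^sup>2 - (norm (w 0))\<^sup>2 = (s - 0) * (2 * inner (w z) (w' z))"
      by (rule MVT2[OF \<open>0 < s\<close>]) (rule has_real_derivative_norm_square[OF w'])
    then obtain z where z: "0 < z" "z < s" "m\<^sup>2 = s * (2 * inner (w z) (w' z))"
      by (auto simp: w_def expop_0 m_def)
    have "inner (w z) (w' z) \<le> inner (w z) (expop C' z (C x - C' x))"
      using diss[of "w z"] by (simp add: w'_def inner_add_right inner_commute)
    also have "\<dots> \<le> norm (w z) * norm (expop C' z (C x - C' x))" by (rule norm_cauchy_schwarz)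
    also have "\<dots> \<le> m * \<delta>"
      using s z expop_contraction[OF C' diss', of z "C x - C' x"]
      by (intro mult_mono) (auto simp: m_def \<delta>_def)
    finally have "m\<^sup>2 \<le> s * (2 * (m * \<delta>))" using z by simp
    also have "\<dots> \<le> t * (2 * (m * \<delta>))" using s by (intro mult_right_mono) (auto simp: m_def \<delta>_def)
    finally show ?thesis by (simp add: algebra_simps)
  qed
  then have "m \<le> 2 * t * \<delta>"
    by (cases "m = 0") (use t in \<open>auto simp: power2_eq_square m_def \<delta>_def\<close>)
  moreover have "norm (w t) \<le> m" using s(2)[of t] t by (simp add: m_def)
  ultimately show ?thesis by (simp add: w_def \<delta>_def)
qed

section \<open>Contraction semigroups generated by the inverse of a bounded operator\<close>

definition contraction_semigroup :: "(real \<Rightarrow> 'h::real_normed_vector \<Rightarrow> 'h) \<Rightarrow> bool" where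
  "contraction_semigroup S \<longleftrightarrow>
     (\<forall>t\<ge>0. linear (S t) \<and> (\<forall>x. norm (S t x) \<le> norm x)) \<and>
     (\<forall>x. S 0 x = x) \<and> (\<forall>s\<ge>0. \<forall>t\<ge>0. \<forall>x. S (s + t) x = S s (S t x)) \<and>
     (\<forall>x. ((\<lambda>h. S h x) \<longlongrightarrow> x) (at_right 0))"

text \<open>The generator is the inverse of B: the difference quotients at x tend to y exactly for x
  = B y. So the domain is the range of B, and no unbounded operator has to be represented.\<close>

definition generated_by_inverse :: "('h::real_normed_vector \<Rightarrow> 'h) \<Rightarrow> (real \<Rightarrow> 'h \<Rightarrow> 'h) \<Rightarrow> bool" where
  "generated_by_inverse B S \<longleftrightarrow>
     (\<forall>x y. ((\<lambda>h. (1 / h) *\<^sub>R (S h x - x)) \<longlongrightarrow> y) (at_right 0) \<longleftrightarrow> x = B y)"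

text \<open>B stands for the inverse of the generator A; with z = B x the last assumption reads <z,
  A z> <= 0.\<close>

locale dissipative_inverse =
  fixes B :: "'h::{real_inner,banach} \<Rightarrow> 'h"
  assumes bl: "bounded_linear B"
    and inj: "\<And>x. B x = 0 \<Longrightarrow> x = 0"
    and diss: "\<And>x. inner (B x) x \<le> 0"
begin

sublocale B: bounded_linear B by (rule bl)

text \<open>If y is orthogonal to the range, dissipativity at y + t x leaves a linear and a
  quadratic term in t. The linear coefficient <B y, x> must vanish for every x, so B y = 0, and
  injectivity gives y = 0.\<close>

lemma range_dense: "closure (range B) = UNIV"
proof (rule dense_if_orthogonal_trivial)
  show "subspace (range B)" using B.linear_axioms linear_subspace_image subspace_UNIV by blast
  fix y assume y: "\<And>s. s \<in> range B \<Longrightarrow> inner y s = 0"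
  have "inner (B y) x = 0" for x
  proof -
    have "0 \<le> t * (- inner (B y) x) + t\<^sup>2 * (- inner (B x) x)" for t
      using diss[of "y + t *\<^sub>R x"] y
      by (simp add: B.add B.scale inner_simps inner_commute power2_eq_square algebra_simps)
    then show ?thesis using quadratic_nonneg_imp_linear_zero by fastforce
  qed
  then have "B y = 0" by (metis inner_eq_zero_iff)
  then show "y = 0" by (rule inj)
qed

text \<open>With A the inverse of B, the inverse of B - \<epsilon> is A (1 - \<epsilon> A)^-1: this
  is the Yosida approximation of A.\<close>

definition Y :: "real \<Rightarrow> 'h \<Rightarrow> 'h" where
  "Y \<epsilon> x = (SOME g. B g - \<epsilon> *\<^sub>R g = x)"

context
  fixes \<epsilon> :: real assumes \<epsilon>: "\<epsilon> > 0"
begin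

text \<open>Dissipativity makes \<epsilon> - B coercive with constant \<epsilon>; hence the change
  of sign before the surjectivity result is used.\<close>

lemma Y_eq: "B (Y \<epsilon> x) - \<epsilon> *\<^sub>R Y \<epsilon> x = x"
proof -
  have "\<exists>g. \<epsilon> *\<^sub>R g - B g = - x"
  proof (rule coercive_imp_surj[OF _ \<epsilon>])
    show "bounded_linear (\<lambda>g. \<epsilon> *\<^sub>R g - B g)"
      by (intro bounded_linear_sub bounded_linear_scaleR_right bl)
    show "\<epsilon> * (norm g)\<^sup>2 \<le> inner (\<epsilon> *\<^sub>R g - B g) g" for g
      using diss[of g] by (simp add: inner_diff_left power2_norm_eq_inner)
  qed
  then have "\<exists>g. B g - \<epsilon> *\<^sub>R g = x" by (metis minus_diff_eq minus_minus)
  then show ?thesis unfolding Y_def by (rule someI_ex)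
qed

lemma B_shift_inj: "B g - \<epsilon> *\<^sub>R g = B g' - \<epsilon> *\<^sub>R g' \<Longrightarrow> g = g'"
proof -
  assume "B g - \<epsilon> *\<^sub>R g = B g' - \<epsilon> *\<^sub>R g'"
  then have "B (g - g') = \<epsilon> *\<^sub>R (g - g')" by (simp add: B.diff algebra_simps)
  then have "\<epsilon> * inner (g - g') (g - g') \<le> 0" using diss[of "g - g'"] by simp
  then have "inner (g - g') (g - g') \<le> 0" using \<epsilon> by (simp add: mult_le_0_iff)
  then show ?thesis by (simp add: power2_norm_eq_inner[symmetric])
qed

lemma Y_unique: "B g - \<epsilon> *\<^sub>R g = x \<Longrightarrow> Y \<epsilon> x = g"
  using B_shift_inj Y_eq by metis

lemma Y_linear: "linear (Y \<epsilon>)"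
proof (rule linearI)
  show "Y \<epsilon> (x + y) = Y \<epsilon> x + Y \<epsilon> y" for x y
    using Y_eq[of x] Y_eq[of y] by (intro Y_unique) (simp add: B.add algebra_simps)
  show "Y \<epsilon> (r *\<^sub>R x) = r *\<^sub>R Y \<epsilon> x" for r x
    using arg_cong[OF Y_eq[of x], of "scaleR r"]
    by (intro Y_unique) (simp add: B.scale algebra_simps)
qed

lemma Y_diss: "inner (Y \<epsilon> x) x \<le> - \<epsilon> * (norm (Y \<epsilon> x))\<^sup>2"
proof -
  have "inner (Y \<epsilon> x) x = inner (Y \<epsilon> x) (B (Y \<epsilon> x) - \<epsilon> *\<^sub>R Y \<epsilon> x)" by (simp add: Y_eq)
  also have "\<dots> \<le> - \<epsilon> * (norm (Y \<epsilon> x))\<^sup>2"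
    using diss[of "Y \<epsilon> x"] by (simp add: inner_diff_right inner_commute power2_norm_eq_inner)
  finally show ?thesis .
qed

lemma Y_norm: "\<epsilon> * norm (Y \<epsilon> x) \<le> norm x"
proof (cases "Y \<epsilon> x = 0")
  case False
  have "\<epsilon> * (norm (Y \<epsilon> x))\<^sup>2 \<le> - inner (Y \<epsilon> x) x" using Y_diss[of x] by simp
  also have "\<dots> \<le> norm (Y \<epsilon> x) * norm x" using Cauchy_Schwarz_ineq2[of "Y \<epsilon> x" x] by simp
  finally have "norm (Y \<epsilon> x) * (\<epsilon> * norm (Y \<epsilon> x)) \<le> norm (Y \<epsilon> x) * norm x"
    by (simp add: power2_eq_square algebra_simps)
  then show ?thesis using False by simp
qed simp

lemma Y_bounded_linear: "bounded_linear (Y \<epsilon>)"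
proof -
  have "norm (Y \<epsilon> x) \<le> norm x * (1 / \<epsilon>)" for x
    using Y_norm[of x] \<epsilon> by (simp add: field_simps)
  then show ?thesis using Y_linear
    unfolding bounded_linear_def bounded_linear_axioms_def by blast
qed

lemma Y_diss0: "inner (Y \<epsilon> x) x \<le> 0"
  using Y_diss[of x] \<epsilon> by (smt (verit) mult_minus_left mult_nonneg_nonneg zero_le_power2)

lemma Y_B: "Y \<epsilon> (B x) = B (Y \<epsilon> x)"
proof (rule Y_unique)
  have "B x = B (B (Y \<epsilon> x) - \<epsilon> *\<^sub>R Y \<epsilon> x)" by (simp only: Y_eq)
  then show "B (B (Y \<epsilon> x)) - \<epsilon> *\<^sub>R B (Y \<epsilon> x) = B x" by (simp only: B.diff B.scale)
qed

text \<open>On the domain the approximation differs from A (B x) = x by \<epsilon> Y x, so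
  convergence there reduces to \<open>eps_Y_tendsto\<close>.\<close>

lemma Y_B': "Y \<epsilon> (B x) = x + \<epsilon> *\<^sub>R Y \<epsilon> x"
  using Y_B[of x] Y_eq[of x] by (simp add: algebra_simps)

end

lemma Y_commute: "\<epsilon> > 0 \<Longrightarrow> \<delta> > 0 \<Longrightarrow> Y \<epsilon> (Y \<delta> x) = Y \<delta> (Y \<epsilon> x)"
proof -
  assume e: "\<epsilon> > 0" "\<delta> > 0"
  have "Y \<epsilon> x = Y \<epsilon> (B (Y \<delta> x) - \<delta> *\<^sub>R Y \<delta> x)" by (simp only: Y_eq[OF e(2)])
  also have "\<dots> = B (Y \<epsilon> (Y \<delta> x)) - \<delta> *\<^sub>R Y \<epsilon> (Y \<delta> x)"
    by (simp add: linear_diff[OF Y_linear[OF e(1)]] linear_scale[OF Y_linear[OF e(1)]] Y_B e)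
  finally show ?thesis by (intro Y_unique[OF e(2), symmetric]) simp
qed

section \<open>Convergence of the Yosida approximations and of their exponentials\<close>

definition eps :: "nat \<Rightarrow> real" where "eps n = 1 / (real n + 1)"

lemma eps_pos: "eps n > 0" by (simp add: eps_def)

lemma eps_tendsto: "eps \<longlonglongrightarrow> 0"
  unfolding eps_def using LIMSEQ_inverse_real_of_nat by (simp add: inverse_eq_divide add.commute)

lemma approx_range: "r > 0 \<Longrightarrow> \<exists>y. norm (x - B y) < r"
  using range_dense closure_approachable[of x "range B"] by (auto simp: dist_norm norm_minus_commute)

lemma Y_B_norm: "norm (Y (eps n) (B w)) \<le> 2 * norm w"
  using norm_triangle_ineq[of w "eps n *\<^sub>R Y (eps n) w"] Y_norm[OF eps_pos, of n w] eps_pos[of n]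
  by (simp add: Y_B'[OF eps_pos])

text \<open>The maps \<epsilon> Y are contractions by \<open>Y_norm\<close>, and on the dense range
  \<open>\<epsilon> Y (B z)\<close> is of order \<epsilon> by \<open>Y_B_norm\<close>.\<close>

lemma eps_Y_tendsto: "(\<lambda>n. eps n *\<^sub>R Y (eps n) x) \<longlonglongrightarrow> 0"
proof (rule LIMSEQ_I)
  fix r :: real assume r: "r > 0"
  then obtain z where z: "norm (x - B z) < r / 2" using approx_range[of "r / 2" x] by auto
  have "(\<lambda>n. eps n * (2 * norm z)) \<longlonglongrightarrow> 0 * (2 * norm z)" by (intro tendsto_intros eps_tendsto)
  from LIMSEQ_D[OF this, of "r / 2"] r
  obtain N where N: "\<forall>n\<ge>N. norm (eps n * (2 * norm z) - 0 * (2 * norm z)) < r / 2" by (meson half_gt_zero)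
  show "\<exists>no. \<forall>n\<ge>no. norm (eps n *\<^sub>R Y (eps n) x - 0) < r"
  proof (intro exI allI impI)
    fix n assume n: "n \<ge> N"
    have "Y (eps n) x = Y (eps n) (x - B z) + Y (eps n) (B z)"
      by (simp add: linear_diff[OF Y_linear[OF eps_pos]])
    then have "norm (eps n *\<^sub>R Y (eps n) x) \<le> norm (eps n *\<^sub>R Y (eps n) (x - B z)) + norm (eps n *\<^sub>R Y (eps n) (B z))"
      using norm_triangle_ineq by (simp only: scaleR_add_right)
    also have "\<dots> = eps n * norm (Y (eps n) (x - B z)) + eps n * norm (Y (eps n) (B z))"
      using eps_pos[of n] by simp
    also have "\<dots> \<le> norm (x - B z) + eps n * (2 * norm z)"
      using Y_norm[OF eps_pos] Y_B_norm eps_pos[of n] by (intro add_mono mult_left_mono) auto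
    also have "\<dots> < r" using z N n by fastforce
    finally show "norm (eps n *\<^sub>R Y (eps n) x - 0) < r" by simp
  qed
qed

lemma Y_B_tendsto: "(\<lambda>n. Y (eps n) (B y)) \<longlonglongrightarrow> y"
  using tendsto_add[OF tendsto_const eps_Y_tendsto, of y y] by (simp add: Y_B'[OF eps_pos])

abbreviation "U n \<equiv> expop (Y (eps n))"

lemmas U_simps = expop_contraction[OF Y_bounded_linear[OF eps_pos] Y_diss0[OF eps_pos]]
  expop_linear[OF Y_bounded_linear[OF eps_pos]]

lemma U_norm_diff: "t \<ge> 0 \<Longrightarrow> norm (U n t x - U n t y) \<le> norm (x - y)"
  using U_simps(1)[of t n "x - y"] by (simp add: linear_diff[OF U_simps(2)])

text \<open>On the range of B, \<open>expop_diff_bound\<close> reduces the claim to the convergence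
  of \<open>Y (eps n) (B y)\<close>; contractivity carries it to every x.\<close>

lemma U_Cauchy:
  assumes t: "t \<ge> 0"
  shows "Cauchy (\<lambda>n. U n t x)"
proof (rule metric_CauchyI)
  fix r :: real assume r: "r > 0"
  then obtain y where y: "norm (x - B y) < r / 4" using approx_range[of "r / 4" x] by auto
  have "Cauchy (\<lambda>n. Y (eps n) (B y))" using Y_B_tendsto by (rule LIMSEQ_imp_Cauchy)
  then obtain N where N: "\<And>m n. m \<ge> N \<Longrightarrow> n \<ge> N \<Longrightarrow> norm (Y (eps m) (B y) - Y (eps n) (B y)) < r / (4 * (t + 1))"
    unfolding Cauchy_iff using r t by (metis divide_pos_pos add_nonneg_pos mult_pos_pos zero_less_numeral zero_less_one)
  have "dist (U m t x) (U n t x) < r" if mn: "m \<ge> N" "n \<ge> N" for m n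
  proof -
    have "norm (U m t (B y) - U n t (B y)) \<le> 2 * t * norm (Y (eps m) (B y) - Y (eps n) (B y))"
      using t by (intro expop_diff_bound Y_bounded_linear Y_diss0 Y_commute eps_pos)
    also have "\<dots> \<le> 2 * t * (r / (4 * (t + 1)))"
      using N[OF mn] t by (intro mult_left_mono) auto
    also have "\<dots> \<le> r / 2" using t r by (simp add: field_simps)
    finally have "norm (U m t (B y) - U n t (B y)) \<le> r / 2" .
    then have "norm (U m t x - U n t x) \<le> norm (x - B y) + r / 2 + norm (x - B y)"
      by (intro norm_add_diff_le[where p = "U m t x - U m t (B y)" and q = "U m t (B y) - U n t (B y)"
            and s = "U n t x - U n t (B y)"] U_norm_diff t) auto
    then show ?thesis using y by (simp add: dist_norm)
  qed
  then show "\<exists>M. \<forall>m\<ge>M. \<forall>n\<ge>M. dist (U m t x) (U n t x) < r" by blast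
qed

definition semigroup :: "real \<Rightarrow> 'h \<Rightarrow> 'h" where "semigroup t x = lim (\<lambda>n. U n t x)"

lemma U_tendsto: "t \<ge> 0 \<Longrightarrow> (\<lambda>n. U n t x) \<longlonglongrightarrow> semigroup t x"
  unfolding semigroup_def using U_Cauchy Cauchy_convergent convergent_LIMSEQ_iff by blast

lemma norm_diff_le_derivative_bound:
  fixes f :: "real \<Rightarrow> 'a::real_normed_vector"
  assumes d: "\<And>s. (f has_vector_derivative f' s) (at s)"
    and le: "\<And>s. 0 \<le> s \<Longrightarrow> s \<le> h \<Longrightarrow> norm (f' s) \<le> M" and h: "h \<ge> 0"
  shows "norm (f h - f 0) \<le> M * h"
proof -
  have "norm (f h - f 0) \<le> M * norm (h - 0)"
  proof (rule differentiable_bound[where S = "{0..h}" and f' = "\<lambda>s k. k *\<^sub>R f' s"])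
    show "(f has_derivative (\<lambda>k. k *\<^sub>R f' x)) (at x within {0..h})" for x
      using d[of x] by (simp add: has_vector_derivative_def has_derivative_at_withinI)
    show "onorm (\<lambda>k. k *\<^sub>R f' x) \<le> M" if "x \<in> {0..h}" for x
      using le[of x] that by (intro onorm_le) (auto simp: mult.commute[of M] mult_left_mono)
  qed (use h in auto)
  then show ?thesis using h by simp
qed

lemma U_lipschitz: "t \<ge> 0 \<Longrightarrow> norm (U n t (B w) - B w) \<le> 2 * norm w * t"
  using norm_diff_le_derivative_bound[OF expop_deriv[OF Y_bounded_linear[OF eps_pos, of n], of "B w"], of t "2 * norm w"]
    U_simps(1)[of _ n "Y (eps n) (B w)"] Y_B_norm[of n w]
  by (force simp: expop_0 intro: order_trans)

text \<open>The derivative of \<open>U n t (B y)\<close> is compared with y by way of y and B z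
  under \<open>U n t\<close>. The detour through B z is made because only on the range is the orbit
  Lipschitz in t uniformly in n. In the bound the first error vanishes as n grows, the second by the
  choice of z, the third with h, in this order.\<close>

lemma U_taylor:
  assumes h: "h \<ge> 0"
  shows "norm (U n h (B y) - B y - h *\<^sub>R y)
    \<le> (norm (Y (eps n) (B y) - y) + 2 * norm (y - B z) + 2 * norm z * h) * h"
proof -
  define f where "f t = U n t (B y) - t *\<^sub>R y" for t
  have d: "(f has_vector_derivative U n t (Y (eps n) (B y)) - y) (at t)" for t
    unfolding f_def
    by (auto intro!: derivative_eq_intros expop_deriv Y_bounded_linear eps_pos)
  have "norm (U n t (Y (eps n) (B y)) - y) \<le> norm (Y (eps n) (B y) - y) + 2 * norm (y - B z) + 2 * norm z * h"
    if t: "0 \<le> t" "t \<le> h" for t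
  proof -
    have "norm (U n t (Y (eps n) (B y)) - U n t y) \<le> norm (Y (eps n) (B y) - y)"
      "norm (U n t y - U n t (B z)) \<le> norm (y - B z)"
      using t by (intro U_norm_diff; simp)+
    moreover have "norm (U n t (B z) - B z) \<le> 2 * norm z * h"
      using U_lipschitz[OF t(1), of n z] t by (smt (verit) mult_left_mono norm_ge_zero)
    ultimately have "norm (U n t (Y (eps n) (B y)) - y) \<le> norm (Y (eps n) (B y) - y) + norm (y - B z) + 2 * norm z * h + norm (y - B z)"
      by (intro norm_add_add_diff_le[where p = "U n t (Y (eps n) (B y)) - U n t y" and q = "U n t y - U n t (B z)"
            and r = "U n t (B z) - B z" and s = "y - B z"]) auto
    then show ?thesis by simp
  qed
  from norm_diff_le_derivative_bound[OF d this h] show ?thesis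
    by (simp add: f_def expop_0 algebra_simps)
qed

section \<open>The limit semigroup and its generator\<close>

lemma semigroup_norm: "t \<ge> 0 \<Longrightarrow> norm (semigroup t x) \<le> norm x"
  by (rule LIMSEQ_le_const2[OF tendsto_norm[OF U_tendsto]]) (auto simp: U_simps)

lemma semigroup_linear: "t \<ge> 0 \<Longrightarrow> linear (semigroup t)"
proof (rule linearI)
  assume t: "t \<ge> 0"
  show "semigroup t (x + y) = semigroup t x + semigroup t y" for x y
    using tendsto_add[OF U_tendsto U_tendsto, OF t t, of x y] U_tendsto[OF t, of "x + y"]
    by (simp add: linear_add[OF U_simps(2)] LIMSEQ_unique)
  show "semigroup t (r *\<^sub>R x) = r *\<^sub>R semigroup t x" for r x
    using tendsto_scaleR[OF tendsto_const U_tendsto, OF t, of r x] U_tendsto[OF t, of "r *\<^sub>R x"]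
    by (simp add: linear_scale[OF U_simps(2)] LIMSEQ_unique)
qed

lemma semigroup_0: "semigroup 0 x = x"
  using U_tendsto[of 0 x] by (simp add: expop_0 LIMSEQ_const_iff)

lemma semigroup_B: "t \<ge> 0 \<Longrightarrow> semigroup t (B x) = B (semigroup t x)"
proof -
  assume t: "t \<ge> 0"
  have "B (U n t x) = U n t (B x)" for n
    by (intro expop_commute Y_bounded_linear bl eps_pos Y_B[symmetric])
  then have "(\<lambda>n. U n t (B x)) \<longlonglongrightarrow> B (semigroup t x)"
    using B.tendsto[OF U_tendsto[OF t, of x]] by simp
  then show ?thesis using U_tendsto[OF t, of "B x"] LIMSEQ_unique by blast
qed

lemma semigroup_add:
  assumes st: "s \<ge> 0" "t \<ge> 0"
  shows "semigroup (s + t) x = semigroup s (semigroup t x)"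
proof -
  have "(\<lambda>n. U n s (U n t x) - U n s (semigroup t x)) \<longlonglongrightarrow> 0"
  proof (rule Lim_null_comparison[OF always_eventually])
    show "\<forall>n. norm (U n s (U n t x) - U n s (semigroup t x)) \<le> norm (U n t x - semigroup t x)"
      using U_norm_diff[OF st(1)] by blast
    show "(\<lambda>n. norm (U n t x - semigroup t x)) \<longlonglongrightarrow> 0"
      using U_tendsto[OF st(2)] LIM_zero tendsto_norm_zero by blast
  qed
  from tendsto_add[OF this U_tendsto[OF st(1), of "semigroup t x"]]
  have "(\<lambda>n. U n (s + t) x) \<longlonglongrightarrow> semigroup s (semigroup t x)"
    using st by (simp add: expop_add[OF Y_bounded_linear[OF eps_pos] Y_diss0[OF eps_pos]])
  then show ?thesis using U_tendsto[of "s + t" x] st LIMSEQ_unique by fastforce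
qed

lemma semigroup_taylor:
  assumes h: "h \<ge> 0"
  shows "norm (semigroup h (B y) - B y - h *\<^sub>R y) \<le> (2 * norm (y - B z) + 2 * norm z * h) * h"
proof (rule LIMSEQ_le)
  show "(\<lambda>n. norm (U n h (B y) - B y - h *\<^sub>R y)) \<longlonglongrightarrow> norm (semigroup h (B y) - B y - h *\<^sub>R y)"
    by (intro tendsto_intros U_tendsto h)
  have "(\<lambda>n. (norm (Y (eps n) (B y) - y) + 2 * norm (y - B z) + 2 * norm z * h) * h)
    \<longlonglongrightarrow> (norm (y - y) + 2 * norm (y - B z) + 2 * norm z * h) * h"
    by (intro tendsto_intros Y_B_tendsto)
  then show "(\<lambda>n. (norm (Y (eps n) (B y) - y) + 2 * norm (y - B z) + 2 * norm z * h) * h)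
    \<longlonglongrightarrow> (2 * norm (y - B z) + 2 * norm z * h) * h" by simp
qed (use U_taylor[OF h] in blast)

text \<open>In the Taylor bound z is fixed first, which makes y - B z small, and only then is h
  taken small relative to the norm of z.\<close>

lemma semigroup_deriv_0: "((\<lambda>h. (1 / h) *\<^sub>R (semigroup h (B y) - B y)) \<longlongrightarrow> y) (at_right 0)"
proof (rule tendstoI)
  fix r :: real assume r: "r > 0"
  then obtain z where z: "norm (y - B z) < r / 4" using approx_range[of "r / 4" y] by auto
  define \<delta> where "\<delta> = r / (4 * (norm z + 1))"
  have \<delta>: "\<delta> > 0" using r by (simp add: \<delta>_def add_nonneg_pos)
  have "dist ((1 / h) *\<^sub>R (semigroup h (B y) - B y)) y < r" if h: "0 < h" "h < \<delta>" for h
  proof -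
    have "2 * norm z * h \<le> 2 * norm z * \<delta>" using h by (intro mult_left_mono) auto
    also have "\<dots> \<le> r / 2"
    proof -
      have "norm z + 1 \<noteq> 0" using norm_ge_zero[of z] by linarith
      then have "\<delta> * (4 * (norm z + 1)) = r" by (simp add: \<delta>_def)
      then show ?thesis using \<delta> by (simp add: algebra_simps)
    qed
    finally have *: "2 * norm (y - B z) + 2 * norm z * h < r" using z by simp
    have "norm ((1 / h) *\<^sub>R (semigroup h (B y) - B y) - y) = (1 / h) * norm (semigroup h (B y) - B y - h *\<^sub>R y)"
    proof -
      have "(1 / h) *\<^sub>R (semigroup h (B y) - B y) - y = (1 / h) *\<^sub>R (semigroup h (B y) - B y - h *\<^sub>R y)"
        using h by (simp add: scaleR_diff_right)
      then show ?thesis using h by simp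
    qed
    also have "\<dots> \<le> (1 / h) * ((2 * norm (y - B z) + 2 * norm z * h) * h)"
      using semigroup_taylor[of h y z] h by (intro mult_left_mono) auto
    also have "\<dots> = 2 * norm (y - B z) + 2 * norm z * h" using h by simp
    finally show ?thesis using * by (simp add: dist_norm)
  qed
  then show "\<forall>\<^sub>F h in at_right 0. dist ((1 / h) *\<^sub>R (semigroup h (B y) - B y)) y < r"
    using \<delta> by (auto simp: eventually_at_right_field)
qed

lemma semigroup_strongly_continuous: "((\<lambda>h. semigroup h x) \<longlongrightarrow> x) (at_right 0)"
proof (rule tendstoI)
  fix r :: real assume r: "r > 0"
  then obtain y where y: "norm (x - B y) < r / 4" using approx_range[of "r / 4" x] by auto
  define \<delta> where "\<delta> = r / (4 * (norm y + 1))"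
  have \<delta>: "\<delta> > 0" using r by (simp add: \<delta>_def add_nonneg_pos)
  have "dist (semigroup h x) x < r" if h: "0 < h" "h < \<delta>" for h
  proof -
    have "2 * norm y * h \<le> 2 * norm y * \<delta>" using h by (intro mult_left_mono) auto
    also have "\<dots> \<le> r / 2"
    proof -
      have "norm y + 1 \<noteq> 0" using norm_ge_zero[of y] by linarith
      then have "\<delta> * (4 * (norm y + 1)) = r" by (simp add: \<delta>_def)
      then show ?thesis using \<delta> by (simp add: algebra_simps)
    qed
    finally have 1: "2 * norm y * h \<le> r / 2" .
    have "norm (semigroup h (B y) - B y) \<le> 2 * norm y * h"
      using h by (intro LIMSEQ_le_const2[OF tendsto_norm[OF tendsto_diff[OF U_tendsto tendsto_const]]])
        (use h U_lipschitz[of h _ y] in auto)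
    moreover have "norm (semigroup h (x - B y)) \<le> norm (x - B y)" using h by (intro semigroup_norm) auto
    ultimately have "norm (semigroup h x - x) \<le> norm (x - B y) + 2 * norm y * h + norm (x - B y)"
      using h by (intro norm_add_diff_le[where p = "semigroup h (x - B y)" and q = "semigroup h (B y) - B y"
            and s = "x - B y"]) (auto simp: linear_diff[OF semigroup_linear])
    then show ?thesis using 1 y by (simp add: dist_norm)
  qed
  then show "\<forall>\<^sub>F h in at_right 0. dist (semigroup h x) x < r"
    using \<delta> by (auto simp: eventually_at_right_field)
qed

lemma contraction_semigroup_semigroup: "contraction_semigroup semigroup"
  unfolding contraction_semigroup_def
  using semigroup_linear semigroup_norm semigroup_0 semigroup_add semigroup_strongly_continuous by blast

text \<open>That the domain is no larger than the range of B: B commutes with the semigroup, so B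
  applied to the quotients at x gives the quotients at B x, and these tend to x. Comparing limits
  yields x = B y.\<close>

lemma generated_semigroup: "generated_by_inverse B semigroup"
  unfolding generated_by_inverse_def
proof (intro allI iffI)
  fix x y
  assume lim: "((\<lambda>h. (1 / h) *\<^sub>R (semigroup h x - x)) \<longlongrightarrow> y) (at_right 0)"
  have "((\<lambda>h. B ((1 / h) *\<^sub>R (semigroup h x - x))) \<longlongrightarrow> B y) (at_right 0)"
    by (rule B.tendsto[OF lim])
  moreover have "\<forall>\<^sub>F h in at_right 0. B ((1 / h) *\<^sub>R (semigroup h x - x)) = (1 / h) *\<^sub>R (semigroup h (B x) - B x)"
    using eventually_at_right_less[of "0::real"] by eventually_elim (simp add: B.scale B.diff semigroup_B)
  ultimately have "((\<lambda>h. (1 / h) *\<^sub>R (semigroup h (B x) - B x)) \<longlongrightarrow> B y) (at_right 0)"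
    by (simp add: tendsto_cong)
  then show "x = B y" using semigroup_deriv_0[of x] tendsto_unique trivial_limit_at_right_real by blast
next
  fix x y assume "x = B y"
  then show "((\<lambda>h. (1 / h) *\<^sub>R (semigroup h x - x)) \<longlongrightarrow> y) (at_right 0)"
    using semigroup_deriv_0 by simp
qed

end

text \<open>An arbitrary semigroup with the given generator, not only the one just constructed;
  uniqueness compares two of them.\<close>

locale inverse_generated_semigroup = dissipative_inverse +
  fixes S :: "real \<Rightarrow> 'a \<Rightarrow> 'a"
  assumes csg: "contraction_semigroup S" and gen: "generated_by_inverse B S"
begin

lemma S_linear: "t \<ge> 0 \<Longrightarrow> linear (S t)"
  and S_norm: "t \<ge> 0 \<Longrightarrow> norm (S t x) \<le> norm x"
  and S_0: "S 0 x = x"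
  and S_add: "s \<ge> 0 \<Longrightarrow> t \<ge> 0 \<Longrightarrow> S (s + t) x = S s (S t x)"
  and S_lim: "((\<lambda>h. S h x) \<longlongrightarrow> x) (at_right 0)"
  using csg unfolding contraction_semigroup_def by blast+

lemma S_deriv_0: "((\<lambda>h. (1 / h) *\<^sub>R (S h (B y) - B y)) \<longlongrightarrow> y) (at_right 0)"
  using gen unfolding generated_by_inverse_def by blast

lemma S_bounded_linear: "t \<ge> 0 \<Longrightarrow> bounded_linear (S t)"
  using S_linear S_norm unfolding bounded_linear_def bounded_linear_axioms_def
  by (metis mult.right_neutral)

text \<open>S t maps the difference quotients at B x to those at S t (B x). They tend to S t x, and
  the generator relation then says that S t (B x) is B of this limit.\<close>

lemma S_B: "t \<ge> 0 \<Longrightarrow> S t (B x) = B (S t x)"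
proof -
  assume t: "t \<ge> 0"
  have "((\<lambda>h. S t ((1 / h) *\<^sub>R (S h (B x) - B x))) \<longlongrightarrow> S t x) (at_right 0)"
    by (rule bounded_linear.tendsto[OF S_bounded_linear[OF t] S_deriv_0])
  moreover have "\<forall>\<^sub>F h in at_right 0. S t ((1 / h) *\<^sub>R (S h (B x) - B x)) = (1 / h) *\<^sub>R (S h (S t (B x)) - S t (B x))"
    using eventually_at_right_less[of "0::real"]
  proof eventually_elim
    case (elim h)
    then have "S t (S h (B x)) = S h (S t (B x))"
      using S_add[of t h] S_add[of h t] t by (simp add: add.commute)
    then show ?case by (simp add: linear_scale[OF S_linear[OF t]] linear_diff[OF S_linear[OF t]])
  qed
  ultimately have "((\<lambda>h. (1 / h) *\<^sub>R (S h (S t (B x)) - S t (B x))) \<longlongrightarrow> S t x) (at_right 0)"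
    by (simp add: tendsto_cong)
  then show ?thesis using gen unfolding generated_by_inverse_def by blast
qed

lemma S_norm_diff:
  assumes "0 \<le> s" "0 \<le> t"
  shows "norm (S s x - S t x) \<le> norm (S \<bar>s - t\<bar> x - x)"
proof -
  have *: "norm (S (u + h) x - S u x) \<le> norm (S h x - x)" if "u \<ge> 0" "h \<ge> 0" for u h
    using S_norm[OF that(1), of "S h x - x"] that by (simp add: S_add linear_diff[OF S_linear])
  show ?thesis
    using *[of t "s - t"] *[of s "t - s"] assms
    by (cases "s \<ge> t") (auto simp: norm_minus_commute)
qed

lemma S_near_0: "r > 0 \<Longrightarrow> \<exists>\<delta>>0. \<forall>h\<ge>0. h < \<delta> \<longrightarrow> norm (S h x - x) < r"
proof -
  assume r: "r > 0"
  then have "\<forall>\<^sub>F h in at_right 0. dist (S h x) x < r" using S_lim[of x] tendstoD by blast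
  then obtain \<delta> where "\<delta> > 0" "\<And>h. 0 < h \<Longrightarrow> h < \<delta> \<Longrightarrow> dist (S h x) x < r"
    by (auto simp: eventually_at_right_field)
  then show ?thesis using r by (intro exI[of _ \<delta>]) (auto simp: dist_norm S_0 le_less)
qed

lemma S_continuous: "continuous_on {0..} (\<lambda>t. S t x)"
  unfolding continuous_on_iff
proof (intro ballI allI impI)
  fix t r :: real assume "t \<in> {0..}" "r > 0"
  then obtain \<delta> where \<delta>: "\<delta> > 0" "\<And>h. h \<ge> 0 \<Longrightarrow> h < \<delta> \<Longrightarrow> norm (S h x - x) < r"
    using S_near_0[of r x] by blast
  show "\<exists>d>0. \<forall>s\<in>{0..}. dist s t < d \<longrightarrow> dist (S s x) (S t x) < r"
  proof (intro exI[of _ \<delta>] conjI ballI impI)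
    fix s :: real assume "s \<in> {0..}" "dist s t < \<delta>"
    then show "dist (S s x) (S t x) < r"
      using S_norm_diff[of s t x] \<delta>(2)[of "\<bar>s - t\<bar>"] \<open>t \<in> {0..}\<close> by (simp add: dist_norm)
  qed (rule \<delta>)
qed

text \<open>From the right, the remainder at t is S t applied to the remainder at 0. From the left,
  with t = s + h, it is S s that is factored out, and the strong continuity of the semigroup at y
  absorbs the difference between S s y and S t y.\<close>

lemma S_deriv:
  assumes t: "t \<ge> 0"
  shows "((\<lambda>t. S t (B y)) has_vector_derivative S t y) (at t within {0..})"
  unfolding has_vector_derivative_def has_derivative_within_alt
proof (intro conjI allI impI)
  show "bounded_linear (\<lambda>h. h *\<^sub>R S t y)" by (rule bounded_linear_scaleR_left)
  fix r :: real assume r: "r > 0"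
  have "\<forall>\<^sub>F h in at_right 0. dist ((1 / h) *\<^sub>R (S h (B y) - B y)) y < r / 2"
    using S_deriv_0[of y] r tendstoD half_gt_zero by blast
  then obtain \<delta>1 where \<delta>1: "\<delta>1 > 0" "\<And>h. 0 < h \<Longrightarrow> h < \<delta>1 \<Longrightarrow> dist ((1 / h) *\<^sub>R (S h (B y) - B y)) y < r / 2"
    by (auto simp: eventually_at_right_field)
  have d1: "norm (S h (B y) - B y - h *\<^sub>R y) \<le> r / 2 * h" if "0 < h" "h < \<delta>1" for h
  proof -
    have "S h (B y) - B y - h *\<^sub>R y = h *\<^sub>R ((1 / h) *\<^sub>R (S h (B y) - B y) - y)"
      using that by (simp add: scaleR_diff_right)
    then have "norm (S h (B y) - B y - h *\<^sub>R y) = h * dist ((1 / h) *\<^sub>R (S h (B y) - B y)) y"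
      using that by (simp add: dist_norm)
    also have "\<dots> \<le> h * (r / 2)" using \<delta>1(2)[OF that] that by (intro mult_left_mono) auto
    finally show ?thesis by (simp add: mult.commute)
  qed
  obtain \<delta>2 where \<delta>2: "\<delta>2 > 0" "\<And>h. h \<ge> 0 \<Longrightarrow> h < \<delta>2 \<Longrightarrow> norm (S h y - y) < r / 2"
    using S_near_0[of "r / 2" y] r by (metis half_gt_zero)
  show "\<exists>d>0. \<forall>s\<in>{0..}. norm (s - t) < d \<longrightarrow> norm (S s (B y) - S t (B y) - (s - t) *\<^sub>R S t y) \<le> r * norm (s - t)"
  proof (intro exI[of _ "min \<delta>1 \<delta>2"] conjI ballI impI)
    fix s :: real assume s: "s \<in> {0..}" "norm (s - t) < min \<delta>1 \<delta>2"
    consider "s = t" | "s > t" | "s < t" by linarith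
    then show "norm (S s (B y) - S t (B y) - (s - t) *\<^sub>R S t y) \<le> r * norm (s - t)"
    proof cases
      case 2
      define h where "h = s - t"
      have h: "0 < h" "h < \<delta>1" "s = t + h" using 2 s by (auto simp: h_def)
      have "S s (B y) - S t (B y) - (s - t) *\<^sub>R S t y = S t (S h (B y) - B y - h *\<^sub>R y)"
        using h t S_add[of t h "B y"] by (simp add: linear_diff[OF S_linear] linear_scale[OF S_linear])
      then have "norm (S s (B y) - S t (B y) - (s - t) *\<^sub>R S t y) \<le> norm (S h (B y) - B y - h *\<^sub>R y)"
        using S_norm[OF t] by simp
      also have "\<dots> \<le> r / 2 * h" using d1 h by simp
      also have "\<dots> \<le> r * norm (s - t)" using h r by simp
      finally show ?thesis .
    next
      case 3
      define h where "h = t - s"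
      have h: "0 < h" "h < \<delta>1" "h < \<delta>2" "t = s + h" using 3 s by (auto simp: h_def)
      have s0: "s \<ge> 0" using s by simp
      have "S s (B y) - S t (B y) - (s - t) *\<^sub>R S t y = S s (h *\<^sub>R (S h y - y) - (S h (B y) - B y - h *\<^sub>R y))"
        using h s0 S_add[of s h "B y"] S_add[of s h y]
        by (simp add: linear_diff[OF S_linear] linear_add[OF S_linear] linear_scale[OF S_linear] algebra_simps)
      then have "norm (S s (B y) - S t (B y) - (s - t) *\<^sub>R S t y) \<le> norm (h *\<^sub>R (S h y - y) - (S h (B y) - B y - h *\<^sub>R y))"
        using S_norm[OF s0] by simp
      also have "\<dots> \<le> norm (h *\<^sub>R (S h y - y)) + norm (S h (B y) - B y - h *\<^sub>R y)" by (rule norm_triangle_ineq4)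
      also have "\<dots> \<le> h * (r / 2) + r / 2 * h"
        using d1[of h] h \<delta>2(2)[of h] by (intro add_mono) (auto intro: mult_left_mono)
      also have "\<dots> = r * norm (s - t)" using h by simp
      finally show ?thesis .
    qed simp
  qed (use \<delta>1 \<delta>2 in auto)
qed

end

text \<open>For data in the range of B the difference w of the orbits satisfies w = B w', so <w, w'>
  <= 0 because B is dissipative, and w stays 0. Density of the range does the rest.\<close>

lemma inverse_generated_semigroup_unique:
  assumes "inverse_generated_semigroup B S" "inverse_generated_semigroup B S'" and t: "t \<ge> 0"
  shows "S t x = S' t x"
proof -
  interpret S: inverse_generated_semigroup B S by fact
  interpret S': inverse_generated_semigroup B S' by fact
  have eq: "S t (B y) = S' t (B y)" for y
  proof -
    define w where "w t = S t (B y) - S' t (B y)" for t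
    have "norm (w t) \<le> norm (w 0)"
    proof (rule norm_le_if_dissipative_ode[where f' = "\<lambda>t. S t y - S' t y", OF _ _ t])
      fix s :: real assume s: "s \<ge> 0"
      show "(w has_vector_derivative S s y - S' s y) (at s within {0..})"
        unfolding w_def by (intro has_vector_derivative_diff S.S_deriv S'.S_deriv s)
      have "w s = B (S s y - S' s y)" using s by (simp add: w_def S.S_B S'.S_B S.B.diff)
      then show "inner (w s) (S s y - S' s y) \<le> 0" using S.diss by simp
    qed
    then show ?thesis by (simp add: w_def S.S_0 S'.S_0)
  qed
  have "(\<lambda>x. S t x - S' t x) ` closure (range B) \<subseteq> {0}"
  proof (rule image_closure_subset)
    show "continuous_on (closure (range B)) (\<lambda>x. S t x - S' t x)"
      using S.S_bounded_linear[OF t] S'.S_bounded_linear[OF t]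
      by (intro continuous_on_diff) (auto intro: linear_continuous_on)
  qed (use eq in auto)
  then have "S t x - S' t x \<in> {0}" using S.range_dense by blast
  then show ?thesis by simp
qed

section \<open>The boundary value problem in Hilbert space form\<close>

text \<open>
  \<open>V\<close> abstracts integration from the left end point, \<open>X\<close> multiplication with the independent variable and \<open>e\<close>
  the constant function 1.
\<close>

locale interval_space =
  fixes V X :: "'k::{real_inner,banach} \<Rightarrow> 'k" and e :: 'k and L :: real
  assumes V_bl: "bounded_linear V" and X_bl: "bounded_linear X"
    and V_ibp: "inner (V f) g + inner f (V g) = inner f e * inner g e"
    and X_sym: "inner (X f) g = inner f (X g)"
    and VX: "V (X f) = X (V f) - V (V f)"
    and Xe: "X e = V e"
    and ee: "inner e e = L"
    and L_pos: "L > 0"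
    and V_inj: "l *\<^sub>R e + V g = 0 \<Longrightarrow> l = 0 \<and> g = 0"
begin

sublocale V: bounded_linear V by (rule V_bl)
sublocale X: bounded_linear X by (rule X_bl)

text \<open>\<open>f\<close> has the derivative \<open>g\<close> and the boundary values \<open>l\<close> and \<open>r\<close>.\<close>

definition prim :: "'k \<Rightarrow> 'k \<Rightarrow> real \<Rightarrow> real \<Rightarrow> bool" where
  "prim f g l r \<longleftrightarrow> f = l *\<^sub>R e + V g \<and> r = l + inner g e"

lemma prim_ibp:
  assumes "prim f g l r" "prim f' g' l' r'"
  shows "inner f g' + inner g f' = r * r' - l * l'"
  using assms V_ibp[of g g'] unfolding prim_def
  by (auto simp: inner_simps algebra_simps inner_commute)

text \<open>The product rule for x f. The left boundary value is lost, which is why the multiplier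
  identity sees the right end only.\<close>

lemma prim_X: "prim f g l r \<Longrightarrow> prim (X f) (f + X g) 0 (L * r)"
proof -
  assume p: "prim f g l r"
  have f: "f = l *\<^sub>R e + V g" and r: "r = l + inner g e" using p by (auto simp: prim_def)
  have "X f = V (f + X g)" by (simp add: f X.add X.scale V.add V.scale VX Xe algebra_simps)
  moreover have "L * r = inner (f + X g) e"
    using V_ibp[of g e] by (simp add: f r inner_simps X_sym Xe ee algebra_simps)
  ultimately show ?thesis by (simp add: prim_def)
qed

lemma prim_lin: "prim f g l r \<Longrightarrow> prim f' g' l' r' \<Longrightarrow>
    prim (s *\<^sub>R f + t *\<^sub>R f') (s *\<^sub>R g + t *\<^sub>R g') (s * l + t * l') (s * r + t * r')"
  unfolding prim_def by (simp add: V.add V.scale inner_simps algebra_simps)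

lemma prim_unique:
  assumes "prim f g l r" "prim f g' l' r'"
  shows "g = g' \<and> l = l' \<and> r = r'"
proof -
  have "(l - l') *\<^sub>R e + V (g - g') = 0"
    using assms by (simp add: prim_def V.diff algebra_simps)
  from V_inj[OF this] show ?thesis using assms by (auto simp: prim_def)
qed

section \<open>Orthogonality to affine functions and the clamped fourth-order problem\<close>

lemma e_ne0: "e \<noteq> 0" using ee L_pos by auto

text \<open>The function x minus its mean; together with 1 it is an orthogonal basis of the affine
  functions.\<close>

definition q where "q = V e - (inner (V e) e / L) *\<^sub>R e"

text \<open>The orthogonal projection onto the complement of the affine functions.\<close>

definition P where "P x = x - (inner x e / L) *\<^sub>R e - (inner x q / inner q q) *\<^sub>R q"

lemma q_ne0: "inner q q \<noteq> 0"
proof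
  assume "inner q q = 0"
  then have "(- (inner (V e) e / L)) *\<^sub>R e + V e = 0" by (simp add: q_def)
  then show False using V_inj e_ne0 by blast
qed

lemma e_orth_q: "inner q e = 0" "inner e q = 0"
  using ee L_pos by (auto simp: q_def inner_simps inner_commute)

lemma P_orth: "inner (P x) e = 0" "inner (P x) (V e) = 0"
proof -
  show 1: "inner (P x) e = 0" using ee L_pos by (simp add: P_def inner_simps e_orth_q)
  have "inner (P x) q = 0" using q_ne0 by (simp add: P_def inner_simps e_orth_q)
  then show "inner (P x) (V e) = 0" using 1 by (simp add: q_def inner_simps)
qed

lemma P_bl: "bounded_linear P"
  unfolding P_def
  by (intro bounded_linear_sub bounded_linear_ident bounded_linear_compose[OF bounded_linear_scaleR_left]
      bounded_linear_compose[OF bounded_linear_divide] bounded_linear_inner_left)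

lemma P_sym: "inner (P x) y = inner x (P y)"
  by (simp add: P_def inner_simps inner_commute mult.commute)

lemma P_fix: "inner m e = 0 \<Longrightarrow> inner m (V e) = 0 \<Longrightarrow> P m = m"
  by (simp add: P_def q_def inner_simps)

lemma P_cokernel: "\<exists>s t. x - P x = s *\<^sub>R e + t *\<^sub>R V e"
proof -
  define t where "t = inner x q / inner q q"
  have "x - P x = (inner x e / L) *\<^sub>R e + t *\<^sub>R q" by (simp add: P_def t_def)
  also have "\<dots> = (inner x e / L - t * (inner (V e) e / L)) *\<^sub>R e + t *\<^sub>R V e"
    unfolding q_def by (simp add: algebra_simps)
  finally have "x - P x = \<dots>" .
  then show ?thesis by blast
qed

text \<open>The moments of w against 1 and x are what the right end values of \<open>V w\<close> and
  \<open>V (V w)\<close> depend on. So the complement of the affine functions consists of the second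
  derivatives of clamped functions.\<close>

lemma ortho_prim:
  assumes "inner w e = 0" "inner w (V e) = 0"
  shows "prim (V w) w 0 0" "prim (V (V w)) (V w) 0 0"
proof -
  show 1: "prim (V w) w 0 0" using assms by (simp add: prim_def)
  have "inner (V w) e = 0" using V_ibp[of w e] assms by simp
  then show "prim (V (V w)) (V w) 0 0" by (simp add: prim_def)
qed

text \<open>For u = V (V w) this is the clamped problem b u'''' - a u'' + u = F after two
  integrations, s and t being the integration constants. The projection P removes the affine part,
  and what remains is b plus a nonnegative operator.\<close>

lemma clamped_solution_exists:
  assumes a: "a \<ge> 0" and b: "b > 0"
  shows "\<exists>w s t. inner w e = 0 \<and> inner w (V e) = 0 \<and>
    b *\<^sub>R w = a *\<^sub>R V (V w) - V (V (V (V w))) + V (V F) + s *\<^sub>R e + t *\<^sub>R V e"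
proof -
  interpret P: bounded_linear P by (rule P_bl)
  define K where "K x = V (V (V (V x))) - a *\<^sub>R V (V x)" for x
  have K_bl: "bounded_linear K"
    unfolding K_def
    by (intro bounded_linear_sub bounded_linear_compose[OF bounded_linear_scaleR_right]
      bounded_linear_compose[OF V_bl] bounded_linear_ident)
  \<comment> \<open>By parts, <K m, m> = |V V m|^2 + a |V m|^2; there are no boundary terms since V
    m and V V m vanish at both ends.\<close>
  have K_pos: "0 \<le> inner (K m) m" if m: "inner m e = 0" "inner m (V e) = 0" for m
  proof -
    note p = ortho_prim[OF m]
    have p2: "prim (V (V (V (V m)))) (V (V (V m))) 0 (inner (V (V (V m))) e)"
      "prim (V (V (V m))) (V (V m)) 0 (inner (V (V m)) e)" by (auto simp: prim_def)
    have "inner (V (V m)) m = - inner (V m) (V m)" using prim_ibp[OF p(2) p(1)] by simp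
    moreover have "inner (V (V (V (V m)))) m = - inner (V (V (V m))) (V m)"
      using prim_ibp[OF p2(1) p(1)] by simp
    moreover have "inner (V (V (V m))) (V m) = - inner (V (V m)) (V (V m))"
      using prim_ibp[OF p2(2) p(2)] by simp
    ultimately show ?thesis using a by (simp add: K_def inner_diff_left)
  qed
  have "\<exists>x. b *\<^sub>R x + P (K (P x)) = P (V (V F))"
  proof (rule coercive_imp_surj[OF _ b])
    show "bounded_linear (\<lambda>x. b *\<^sub>R x + P (K (P x)))"
      by (intro bounded_linear_add bounded_linear_scaleR_right
          bounded_linear_compose[OF P_bl] bounded_linear_compose[OF K_bl] bounded_linear_ident)
    show "b * (norm x)\<^sup>2 \<le> inner (b *\<^sub>R x + P (K (P x))) x" for x
      using K_pos[OF P_orth] by (simp add: inner_add_left P_sym power2_norm_eq_inner)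
  qed
  then obtain x where x: "b *\<^sub>R x + P (K (P x)) = P (V (V F))" by blast
  \<comment> \<open>The equation was solved in the whole space, but its form puts x into the range
    of P, so that P x = x.\<close>
  have bx: "b *\<^sub>R x = P (V (V F) - K (P x))" using x by (simp add: P.diff algebra_simps)
  have "b * inner x e = 0" "b * inner x (V e) = 0"
    using arg_cong[OF bx, of "\<lambda>x. inner x e"] arg_cong[OF bx, of "\<lambda>x. inner x (V e)"] P_orth by auto
  then have xo: "inner x e = 0" "inner x (V e) = 0" using b by auto
  obtain s t where "V (V F) - K x - P (V (V F) - K x) = s *\<^sub>R e + t *\<^sub>R V e"
    using P_cokernel by blast
  then have "b *\<^sub>R x = V (V F) - K x - s *\<^sub>R e - t *\<^sub>R V e"
    using bx P_fix[OF xo] by (simp add: algebra_simps)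
  then have "b *\<^sub>R x = a *\<^sub>R V (V x) - V (V (V (V x))) + V (V F) + (- s) *\<^sub>R e + (- t) *\<^sub>R V e"
    by (simp add: K_def algebra_simps)
  then show ?thesis using xo by blast
qed

end

locale boundary_problem = interval_space +
  fixes a b \<alpha>\<^sub>1 \<alpha>\<^sub>2 :: real
  assumes ab: "a > 0" "b > 0" and \<alpha>: "\<alpha>\<^sub>1 > 0" "\<alpha>\<^sub>2 > 0"
begin

text \<open>
  \<open>u\<close> vanishes to first order at both end points, \<open>w\<close> is its second derivative, with the boundary
  values \<open>l\<close> and \<open>r\<close>, and \<open>f\<close> is the value of \<open>- D + a D^3 - b D^5\<close> at \<open>u\<close>.
\<close>

definition jet :: "'a \<Rightarrow> 'a \<Rightarrow> 'a \<Rightarrow> real \<Rightarrow> real \<Rightarrow> bool" where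
  "jet u w f l r \<longleftrightarrow> (\<exists>u\<^sub>1 u\<^sub>3 u\<^sub>4 u\<^sub>5 p p' q q'. prim u u\<^sub>1 0 0 \<and> prim u\<^sub>1 w 0 0 \<and> prim w u\<^sub>3 l r \<and>
     prim u\<^sub>3 u\<^sub>4 p q \<and> prim u\<^sub>4 u\<^sub>5 p' q' \<and> f = - u\<^sub>1 + a *\<^sub>R u\<^sub>3 - b *\<^sub>R u\<^sub>5)"

lemma jet_VV: "jet u w f l r \<Longrightarrow> u = V (V w)"
  by (auto simp: jet_def prim_def)

lemma jet_lin: 
  assumes "jet u w f l r" "jet u' w' f' l' r'"
  shows "jet (s *\<^sub>R u + t *\<^sub>R u') (s *\<^sub>R w + t *\<^sub>R w') (s *\<^sub>R f + t *\<^sub>R f') (s * l + t * l') (s * r + t * r')"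
proof -
  from assms(1) obtain u\<^sub>1 u\<^sub>3 u\<^sub>4 u\<^sub>5 p p' q q' where 1: "prim u u\<^sub>1 0 0" "prim u\<^sub>1 w 0 0" "prim w u\<^sub>3 l r"
     "prim u\<^sub>3 u\<^sub>4 p q" "prim u\<^sub>4 u\<^sub>5 p' q'" "f = - u\<^sub>1 + a *\<^sub>R u\<^sub>3 - b *\<^sub>R u\<^sub>5" unfolding jet_def by blast
  from assms(2) obtain v\<^sub>1 v\<^sub>3 v\<^sub>4 v\<^sub>5 m m' n n' where 2: "prim u' v\<^sub>1 0 0" "prim v\<^sub>1 w' 0 0" "prim w' v\<^sub>3 l' r'"
     "prim v\<^sub>3 v\<^sub>4 m n" "prim v\<^sub>4 v\<^sub>5 m' n'" "f' = - v\<^sub>1 + a *\<^sub>R v\<^sub>3 - b *\<^sub>R v\<^sub>5" unfolding jet_def by blast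
  show ?thesis unfolding jet_def
    apply (rule exI[of _ "s *\<^sub>R u\<^sub>1 + t *\<^sub>R v\<^sub>1"], rule exI[of _ "s *\<^sub>R u\<^sub>3 + t *\<^sub>R v\<^sub>3"],
        rule exI[of _ "s *\<^sub>R u\<^sub>4 + t *\<^sub>R v\<^sub>4"], rule exI[of _ "s *\<^sub>R u\<^sub>5 + t *\<^sub>R v\<^sub>5"])
    using prim_lin[OF 1(1) 2(1), of s t] prim_lin[OF 1(2) 2(2), of s t] prim_lin[OF 1(3) 2(3), of s t]
      prim_lin[OF 1(4) 2(4), of s t] prim_lin[OF 1(5) 2(5), of s t]
    by (auto simp: 1(6) 2(6) algebra_simps)
qed

lemma jet_unique:
  assumes "jet u w f l r" "jet u w' f' l' r'"
  shows "w = w'" "f = f'" "l = l'" "r = r'"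
  using assms unfolding jet_def by (metis prim_unique)+

text \<open>An operator of odd order is skew up to boundary terms. As the functions and their first
  derivatives vanish at both ends, only the fifth-order term leaves one, a product of second
  derivatives. Paired for the two components of a state it is the dissipation of the energy.\<close>

lemma jet_pairing:
  assumes "jet u w f l r" "jet u' w' f' l' r'"
  shows "inner f u' + inner f' u = - b * (r * r' - l * l')"
proof -
  from assms(1) obtain u\<^sub>1 u\<^sub>3 u\<^sub>4 u\<^sub>5 p p' q q' where 1: "prim u u\<^sub>1 0 0" "prim u\<^sub>1 w 0 0" "prim w u\<^sub>3 l r"
     "prim u\<^sub>3 u\<^sub>4 p q" "prim u\<^sub>4 u\<^sub>5 p' q'" "f = - u\<^sub>1 + a *\<^sub>R u\<^sub>3 - b *\<^sub>R u\<^sub>5" unfolding jet_def by blast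
  from assms(2) obtain v\<^sub>1 v\<^sub>3 v\<^sub>4 v\<^sub>5 m m' n n' where 2: "prim u' v\<^sub>1 0 0" "prim v\<^sub>1 w' 0 0" "prim w' v\<^sub>3 l' r'"
     "prim v\<^sub>3 v\<^sub>4 m n" "prim v\<^sub>4 v\<^sub>5 m' n'" "f' = - v\<^sub>1 + a *\<^sub>R v\<^sub>3 - b *\<^sub>R v\<^sub>5" unfolding jet_def by blast
  have "inner u\<^sub>1 u' + inner v\<^sub>1 u = 0" using prim_ibp[OF 1(1) 2(1)] by (simp add: inner_commute)
  moreover have "inner u\<^sub>3 u' + inner v\<^sub>3 u = 0"
    using prim_ibp[OF 1(3) 2(1)] prim_ibp[OF 2(3) 1(1)] prim_ibp[OF 1(2) 2(2)] by (simp add: inner_commute)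
  moreover have "inner u\<^sub>5 u' = inner u\<^sub>3 w'"
    using prim_ibp[OF 1(5) 2(1)] prim_ibp[OF 1(4) 2(2)] by (simp add: inner_commute)
  moreover have "inner v\<^sub>5 u = inner v\<^sub>3 w"
    using prim_ibp[OF 2(5) 1(1)] prim_ibp[OF 2(4) 1(2)] by (simp add: inner_commute)
  moreover have "inner u\<^sub>3 w' + inner v\<^sub>3 w = r * r' - l * l'"
    using prim_ibp[OF 1(3) 2(3)] by (simp add: inner_commute)
  moreover have "inner f u' + inner f' u = - (inner u\<^sub>1 u' + inner v\<^sub>1 u) + a * (inner u\<^sub>3 u' + inner v\<^sub>3 u)
      - b * (inner u\<^sub>5 u' + inner v\<^sub>5 u)"
    by (simp add: 1(6) 2(6) inner_simps algebra_simps)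
  ultimately show ?thesis by simp
qed

text \<open>Paired with x u, the derivatives of order 1, 3, 5 give, with alternating signs, 1/2,
  3/2, 5/2 times the squared norm of u, u', u''; the signs of the operator make all three
  contributions positive. Of the boundary terms only the second derivative at the right end
  survives.\<close>

lemma jet_multiplier:
  assumes "jet u w f l r"
  shows "inner f (X u) = (norm u)\<^sup>2 / 2 + 3 * a / 2 * (norm (V w))\<^sup>2 + 5 * b / 2 * (norm w)\<^sup>2 - b * L / 2 * r\<^sup>2"
proof -
  from assms(1) obtain u\<^sub>1 u\<^sub>3 u\<^sub>4 u\<^sub>5 p p' q q' where 1: "prim u u\<^sub>1 0 0" "prim u\<^sub>1 w 0 0" "prim w u\<^sub>3 l r"
     "prim u\<^sub>3 u\<^sub>4 p q" "prim u\<^sub>4 u\<^sub>5 p' q'" "f = - u\<^sub>1 + a *\<^sub>R u\<^sub>3 - b *\<^sub>R u\<^sub>5" unfolding jet_def by blast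
  have u1: "u\<^sub>1 = V w" using 1(2) by (simp add: prim_def)
  note x = prim_X[OF 1(1), simplified] prim_X[OF 1(2), simplified] prim_X[OF 1(3)]
  have A: "2 * inner u\<^sub>1 (X u) = - inner u u"
    using prim_ibp[OF 1(1) x(1)] X_sym[of u u\<^sub>1] by (simp add: inner_add_right inner_commute)
  have B: "2 * inner w (X u\<^sub>1) = - inner u\<^sub>1 u\<^sub>1"
    using prim_ibp[OF 1(2) x(2)] X_sym[of u\<^sub>1 w] by (simp add: inner_add_right inner_commute)
  have C: "2 * inner u\<^sub>3 (X w) = L * r\<^sup>2 - inner w w"
    using prim_ibp[OF 1(3) x(3)] X_sym[of w u\<^sub>3] by (simp add: inner_add_right inner_commute power2_eq_square algebra_simps)
  have D: "inner w u = - inner u\<^sub>1 u\<^sub>1" using prim_ibp[OF 1(1) 1(2)] by (simp add: inner_commute)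
  have E: "inner u\<^sub>3 (X u) = 3 / 2 * inner u\<^sub>1 u\<^sub>1"
    using prim_ibp[OF 1(3) x(1)] B D by (simp add: inner_add_right)
  have F: "inner u\<^sub>4 u = inner w w"
    using prim_ibp[OF 1(4) 1(1)] prim_ibp[OF 1(3) 1(2)] by simp
  have G: "inner u\<^sub>3 u\<^sub>1 = - inner w w" using prim_ibp[OF 1(3) 1(2)] by simp
  have H: "inner u\<^sub>4 (X u\<^sub>1) = 3 / 2 * inner w w - L * r\<^sup>2 / 2"
    using prim_ibp[OF 1(4) x(2)] C G by (simp add: inner_add_right)
  have I: "inner u\<^sub>5 (X u) = - (5 / 2 * inner w w) + L * r\<^sup>2 / 2"
    using prim_ibp[OF 1(5) x(1)] F H by (simp add: inner_add_right)
  have "inner f (X u) = - inner u\<^sub>1 (X u) + a * inner u\<^sub>3 (X u) - b * inner u\<^sub>5 (X u)"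
    by (simp add: 1(6) inner_simps)
  also have "\<dots> = inner u u / 2 + a * (3 / 2 * inner u\<^sub>1 u\<^sub>1) - b * (- (5 / 2 * inner w w) + L * r\<^sup>2 / 2)"
    using A unfolding E I by simp
  finally show ?thesis unfolding power2_norm_eq_inner u1[symmetric] by (simp add: algebra_simps)
qed

text \<open>One integration of the fifth-order equation gives b u'''' = a u'' - u + c - V f, a
  clamped problem for each integration constant c. The fourth derivative x is kept in the statement
  so that the effect of c remains visible when f = 0.\<close>

lemma jet_solution:
  "\<exists>u w l r. jet u w f l r \<and> (\<exists>x. b *\<^sub>R x = a *\<^sub>R w - V (V w) + c *\<^sub>R e - V f \<and> (\<exists>u\<^sub>3 p q. prim w u\<^sub>3 l r \<and> prim u\<^sub>3 x p q))"
proof -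
  define F where "F = c *\<^sub>R e - V f"
  obtain w s t where w: "inner w e = 0" "inner w (V e) = 0"
    "b *\<^sub>R w = a *\<^sub>R V (V w) - V (V (V (V w))) + V (V F) + s *\<^sub>R e + t *\<^sub>R V e"
    using clamped_solution_exists[of a b F] ab by auto
  note p = ortho_prim[OF w(1,2)]
  define k where "k = 1 / b"
  have kb: "k * b = 1" "b * k = 1" using ab by (auto simp: k_def)
  define u\<^sub>3 where "u\<^sub>3 = k *\<^sub>R (t *\<^sub>R e + a *\<^sub>R V w - V (V (V w)) + V F)"
  define u\<^sub>4 where "u\<^sub>4 = k *\<^sub>R (a *\<^sub>R w - V (V w) + F)"
  define u\<^sub>5 where "u\<^sub>5 = k *\<^sub>R (a *\<^sub>R u\<^sub>3 - V w - f)"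
  have w': "w = (k * s) *\<^sub>R e + V u\<^sub>3"
  proof -
    have "w = k *\<^sub>R (b *\<^sub>R w)" by (simp add: kb)
    also have "\<dots> = (k * s) *\<^sub>R e + V u\<^sub>3"
      unfolding w(3) by (simp add: u\<^sub>3_def V.add V.diff V.scale algebra_simps)
    finally show ?thesis .
  qed
  have u3': "u\<^sub>3 = (k * t) *\<^sub>R e + V u\<^sub>4"
    by (simp add: u\<^sub>3_def u\<^sub>4_def V.add V.diff V.scale algebra_simps)
  have u4': "u\<^sub>4 = (k * (a * (k * s) + c)) *\<^sub>R e + V u\<^sub>5"
  proof -
    have aw: "a *\<^sub>R w = (a * (k * s)) *\<^sub>R e + a *\<^sub>R V u\<^sub>3" by (subst w') (simp add: scaleR_add_right)
    show ?thesis unfolding u\<^sub>4_def u\<^sub>5_def aw F_def by (simp add: V.add V.diff V.scale algebra_simps)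
  qed
  have f: "f = - V w + a *\<^sub>R u\<^sub>3 - b *\<^sub>R u\<^sub>5" by (simp add: u\<^sub>5_def kb)
  have pr: "prim w u\<^sub>3 (k * s) (k * s + inner u\<^sub>3 e)" "prim u\<^sub>3 u\<^sub>4 (k * t) (k * t + inner u\<^sub>4 e)"
    "prim u\<^sub>4 u\<^sub>5 (k * (a * (k * s) + c)) (k * (a * (k * s) + c) + inner u\<^sub>5 e)"
    using w' u3' u4' by (auto simp: prim_def)
  then have "jet (V (V w)) w f (k * s) (k * s + inner u\<^sub>3 e)"
    unfolding jet_def using p f by blast
  moreover have "b *\<^sub>R u\<^sub>4 = a *\<^sub>R w - V (V w) + c *\<^sub>R e - V f" by (simp add: u\<^sub>4_def kb F_def)
  ultimately show ?thesis using pr(1,2) by blast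
qed

text \<open>The homogeneous solution with integration constant 1. If r were 0, the multiplier
  identity would give w = 0, hence a vanishing fourth derivative, and the integrated equation would
  read 0 = 1. Pairing the solution with itself gives l^2 = r^2, so l is nonzero as well.\<close>

lemma jet_kernel: "\<exists>u w l r. jet u w 0 l r \<and> l \<noteq> 0 \<and> r \<noteq> 0"
proof -
  obtain u w l r x u\<^sub>3 p q where j: "jet u w 0 l r"
    and x: "b *\<^sub>R x = a *\<^sub>R w - V (V w) + 1 *\<^sub>R e - V 0" "prim w u\<^sub>3 l r" "prim u\<^sub>3 x p q"
    using jet_solution[of 0 1] by blast
  have "r \<noteq> 0"
  proof
    assume "r = 0"
    then have "0 = (norm u)\<^sup>2 / 2 + 3 * a / 2 * (norm (V w))\<^sup>2 + 5 * b / 2 * (norm w)\<^sup>2"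
      using jet_multiplier[OF j] by simp
    moreover have "0 \<le> (norm u)\<^sup>2 / 2" "0 \<le> 3 * a / 2 * (norm (V w))\<^sup>2" "0 \<le> 5 * b / 2 * (norm w)\<^sup>2" using ab by auto
    ultimately have "5 * b / 2 * (norm w)\<^sup>2 = 0" by linarith
    then have "w = 0" using ab by simp
    then have "u\<^sub>3 = 0" using x(2) V_inj by (auto simp: prim_def)
    then have "x = 0" using x(3) V_inj by (auto simp: prim_def)
    then show False using x(1) \<open>w = 0\<close> e_ne0 by (simp add: V.zero)
  qed
  moreover have "r * r - l * l = 0" using jet_pairing[OF j j] ab by simp
  ultimately have "l \<noteq> 0" by auto
  with j \<open>r \<noteq> 0\<close> show ?thesis by blast
qed

text \<open>\<open>y = A z\<close>, and \<open>v\<close> is the pair of second derivatives of \<open>z\<close>.\<close>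

definition graph :: "'a \<times> 'a \<Rightarrow> 'a \<times> 'a \<Rightarrow> 'a \<times> 'a \<Rightarrow> bool" where
  "graph z v y \<longleftrightarrow> (\<exists>l r l' r'. jet (snd z) (snd v) (fst y) l r \<and> jet (fst z) (fst v) (snd y) l' r' \<and>
     l + \<alpha>\<^sub>1 * l' = 0 \<and> r - \<alpha>\<^sub>2 * r' = 0)"

lemma graph_lin:
  assumes "graph z v y" "graph z' v' y'"
  shows "graph (s *\<^sub>R z + t *\<^sub>R z') (s *\<^sub>R v + t *\<^sub>R v') (s *\<^sub>R y + t *\<^sub>R y')"
proof -
  from assms obtain l r l' r' m n m' n' where
    1: "jet (snd z) (snd v) (fst y) l r" "jet (fst z) (fst v) (snd y) l' r'" "l + \<alpha>\<^sub>1 * l' = 0" "r - \<alpha>\<^sub>2 * r' = 0" and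
    2: "jet (snd z') (snd v') (fst y') m n" "jet (fst z') (fst v') (snd y') m' n'" "m + \<alpha>\<^sub>1 * m' = 0" "n - \<alpha>\<^sub>2 * n' = 0"
    unfolding graph_def by blast
  have "(s * l + t * m) + \<alpha>\<^sub>1 * (s * l' + t * m') = s * (l + \<alpha>\<^sub>1 * l') + t * (m + \<alpha>\<^sub>1 * m')" by (simp add: algebra_simps)
  moreover have "(s * r + t * n) - \<alpha>\<^sub>2 * (s * r' + t * n') = s * (r - \<alpha>\<^sub>2 * r') + t * (n - \<alpha>\<^sub>2 * n')" by (simp add: algebra_simps)
  ultimately show ?thesis
    using jet_lin[OF 1(1) 2(1), of s t] jet_lin[OF 1(2) 2(2), of s t] 1(3,4) 2(3,4)
    unfolding graph_def by fastforce
qed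

text \<open>To particular solutions of the two components, multiples \<open>c\<^sub>1\<close> and
  \<open>c\<^sub>2\<close> of the homogeneous solution are added. After division by l and r the
  boundary conditions read \<open>c\<^sub>1 + \<alpha>\<^sub>1 * c\<^sub>2 = - R1\<close> and
  \<open>c\<^sub>1 - \<alpha>\<^sub>2 * c\<^sub>2 = - R2\<close>, a system with determinant
  \<open>- (\<alpha>\<^sub>1 + \<alpha>\<^sub>2)\<close>.\<close>

lemma graph_exists: "\<exists>z v. graph z v y"
proof -
  obtain E W l r where E: "jet E W 0 l r" "l \<noteq> 0" "r \<noteq> 0" using jet_kernel by blast
  obtain u w l\<^sub>1 r\<^sub>1 where u: "jet u w (fst y) l\<^sub>1 r\<^sub>1" using jet_solution by blast
  obtain h k l\<^sub>2 r\<^sub>2 where h: "jet h k (snd y) l\<^sub>2 r\<^sub>2" using jet_solution by blast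
  define R1 R2 where "R1 = (l\<^sub>1 + \<alpha>\<^sub>1 * l\<^sub>2) / l" and "R2 = (r\<^sub>1 - \<alpha>\<^sub>2 * r\<^sub>2) / r"
  define c\<^sub>2 where "c\<^sub>2 = (R2 - R1) / (\<alpha>\<^sub>1 + \<alpha>\<^sub>2)"
  define c\<^sub>1 where "c\<^sub>1 = - R1 - \<alpha>\<^sub>1 * c\<^sub>2"
  have c: "c\<^sub>2 * (\<alpha>\<^sub>1 + \<alpha>\<^sub>2) = R2 - R1" using \<alpha> by (simp add: c\<^sub>2_def)
  have "l\<^sub>1 + c\<^sub>1 * l + \<alpha>\<^sub>1 * (l\<^sub>2 + c\<^sub>2 * l) = l * (R1 + c\<^sub>1 + \<alpha>\<^sub>1 * c\<^sub>2)"
    using E(2) by (simp add: R1_def field_simps)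
  moreover have "r\<^sub>1 + c\<^sub>1 * r - \<alpha>\<^sub>2 * (r\<^sub>2 + c\<^sub>2 * r) = r * (R2 + c\<^sub>1 - \<alpha>\<^sub>2 * c\<^sub>2)"
    using E(3) by (simp add: R2_def field_simps)
  moreover have "R1 + c\<^sub>1 + \<alpha>\<^sub>1 * c\<^sub>2 = 0" by (simp add: c\<^sub>1_def)
  moreover have "R2 + c\<^sub>1 - \<alpha>\<^sub>2 * c\<^sub>2 = 0" using c by (simp add: c\<^sub>1_def algebra_simps)
  ultimately have bc: "l\<^sub>1 + c\<^sub>1 * l + \<alpha>\<^sub>1 * (l\<^sub>2 + c\<^sub>2 * l) = 0" "r\<^sub>1 + c\<^sub>1 * r - \<alpha>\<^sub>2 * (r\<^sub>2 + c\<^sub>2 * r) = 0" by auto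
  have "jet (u + c\<^sub>1 *\<^sub>R E) (w + c\<^sub>1 *\<^sub>R W) (fst y) (l\<^sub>1 + c\<^sub>1 * l) (r\<^sub>1 + c\<^sub>1 * r)"
    using jet_lin[OF u E(1), of 1 c\<^sub>1] by simp
  moreover have "jet (h + c\<^sub>2 *\<^sub>R E) (k + c\<^sub>2 *\<^sub>R W) (snd y) (l\<^sub>2 + c\<^sub>2 * l) (r\<^sub>2 + c\<^sub>2 * r)"
    using jet_lin[OF h E(1), of 1 c\<^sub>2] by simp
  ultimately have "graph (h + c\<^sub>2 *\<^sub>R E, u + c\<^sub>1 *\<^sub>R E) (k + c\<^sub>2 *\<^sub>R W, w + c\<^sub>1 *\<^sub>R W) y"
    using bc unfolding graph_def by auto
  then show ?thesis by blast
qed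

lemma graph_unique: "graph z v y \<Longrightarrow> graph z v' y' \<Longrightarrow> v = v' \<and> y = y'"
  unfolding graph_def by (metis jet_unique(1,2) prod.expand)

lemma graph_dissipative: "graph z v y \<Longrightarrow> inner z y \<le> 0"
proof -
  assume "graph z v y"
  then obtain l r l' r' where 1: "jet (snd z) (snd v) (fst y) l r" "jet (fst z) (fst v) (snd y) l' r'"
    "l = - \<alpha>\<^sub>1 * l'" "r = \<alpha>\<^sub>2 * r'" unfolding graph_def by (smt (verit) mult_minus_left)
  have "inner z y = - b * (r * r' - l * l')"
    using jet_pairing[OF 1(1,2)] by (simp add: inner_prod_def inner_commute)
  also have "\<dots> = - (b * (\<alpha>\<^sub>2 * r'\<^sup>2 + \<alpha>\<^sub>1 * l'\<^sup>2))" by (simp add: 1(3,4) power2_eq_square algebra_simps)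
  also have "\<dots> \<le> 0" using ab \<alpha> by simp
  finally show ?thesis .
qed

section \<open>The Lyapunov inequality and its constant\<close>

definition mult_form :: "'a \<times> 'a \<Rightarrow> 'a \<times> 'a \<Rightarrow> real" where
  "mult_form z y = inner (fst z) (X (snd y))"

definition X_bound :: real where "X_bound = (SOME N. N > 0 \<and> (\<forall>x. norm (X x) \<le> norm x * N))"

lemma X_bound: "X_bound > 0" "norm (X x) \<le> norm x * X_bound"
  using someI_ex[OF bounded_linear.pos_bounded[OF X_bl]] unfolding X_bound_def by auto

text \<open>The first bound lets the dissipation absorb the boundary term of the multiplier: with
  \<open>r = \<alpha>\<^sub>2 * r'\<close> that term is
  \<open>b * L / 2 * (1 + \<alpha>\<^sub>2\<^sup>2) * r'\<^sup>2\<close>, against a dissipation of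
  \<open>b * \<alpha>\<^sub>2 * r'\<^sup>2\<close>. The second bound makes the perturbation of the
  energy at most half of the energy.\<close>

definition \<kappa> :: real where "\<kappa> = min (2 * \<alpha>\<^sub>2 / (L * (1 + \<alpha>\<^sub>2\<^sup>2))) (1 / (4 * X_bound))"

lemma \<kappa>: "\<kappa> > 0" "\<kappa> * (L * (1 + \<alpha>\<^sub>2\<^sup>2)) \<le> 2 * \<alpha>\<^sub>2" "\<kappa> * X_bound \<le> 1 / 4"
proof -
  have p: "L * (1 + \<alpha>\<^sub>2\<^sup>2) > 0" using L_pos by (simp add: add_pos_nonneg)
  show "\<kappa> > 0" using p \<alpha> X_bound(1) unfolding \<kappa>_def by simp
  have "\<kappa> \<le> 2 * \<alpha>\<^sub>2 / (L * (1 + \<alpha>\<^sub>2\<^sup>2))" by (simp add: \<kappa>_def)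
  then show "\<kappa> * (L * (1 + \<alpha>\<^sub>2\<^sup>2)) \<le> 2 * \<alpha>\<^sub>2" using p by (simp add: pos_le_divide_eq)
  have "\<kappa> \<le> 1 / (4 * X_bound)" by (simp add: \<kappa>_def)
  then show "\<kappa> * X_bound \<le> 1 / 4" using X_bound(1) by (simp add: field_simps)
qed

lemma norm_pair_square: "(norm z)\<^sup>2 = (norm (fst z))\<^sup>2 + (norm (snd z))\<^sup>2" for z :: "'x::real_normed_vector \<times> 'y::real_normed_vector"
  by (simp add: norm_prod_def)

lemma mult_form_bound: "\<kappa> * \<bar>mult_form z y\<bar> \<le> norm z * norm y / 4"
proof -
  have "\<bar>mult_form z y\<bar> \<le> norm (fst z) * norm (X (snd y))" unfolding mult_form_def by (rule Cauchy_Schwarz_ineq2)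
  also have "\<dots> \<le> norm z * (norm y * X_bound)"
    using X_bound order_trans[OF X_bound(2), of "snd y" "norm y * X_bound"] norm_snd_le[of "snd y" "fst y"] norm_fst_le[of "fst z" "snd z"]
    by (intro mult_mono) (auto intro: mult_right_mono)
  finally have "\<kappa> * \<bar>mult_form z y\<bar> \<le> \<kappa> * (norm z * (norm y * X_bound))" using \<kappa>(1) by simp
  also have "\<dots> = (\<kappa> * X_bound) * (norm z * norm y)" by simp
  also have "\<dots> \<le> (1 / 4) * (norm z * norm y)" using \<kappa>(3) by (intro mult_right_mono) auto
  finally show ?thesis by simp
qed

text \<open>For y = A z the left side is the derivative of the Lyapunov functional along an orbit,
  since \<open>mult_form\<close> is the bilinear form whose diagonal is \<Lambda>. The positive
  terms in the first derivatives are discarded; the terms in v are kept for the smoothing.\<close>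

lemma graph_lyapunov:
  assumes "graph z v y"
  shows "inner z y - \<kappa> * (mult_form y z + mult_form z y) \<le> - (\<kappa> / 2) * (norm z)\<^sup>2 - (5 * b * \<kappa> / 2) * (norm v)\<^sup>2"
proof -
  from assms obtain l r l' r' where 1: "jet (snd z) (snd v) (fst y) l r" "jet (fst z) (fst v) (snd y) l' r'"
    "l = - \<alpha>\<^sub>1 * l'" "r = \<alpha>\<^sub>2 * r'" unfolding graph_def by (smt (verit) mult_minus_left)
  have A: "inner z y = - b * (r * r' - l * l')"
    using jet_pairing[OF 1(1,2)] by (simp add: inner_prod_def inner_commute)
  have A': "inner z y \<le> - (b * \<alpha>\<^sub>2 * r'\<^sup>2)"
    using ab \<alpha> by (simp add: A 1(3,4) power2_eq_square algebra_simps)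
  have "mult_form y z + mult_form z y = inner (fst y) (X (snd z)) + inner (snd y) (X (fst z))"
    using X_sym[of "fst z" "snd y"] by (simp add: mult_form_def inner_commute)
  also have "\<dots> \<ge> ((norm z)\<^sup>2 / 2 + 5 * b / 2 * (norm v)\<^sup>2) - b * L / 2 * (r\<^sup>2 + r'\<^sup>2)"
  proof -
    have "0 \<le> 3 * a / 2 * (norm (V (snd v)))\<^sup>2" "0 \<le> 3 * a / 2 * (norm (V (fst v)))\<^sup>2" using ab by auto
    then show ?thesis
      unfolding jet_multiplier[OF 1(1)] jet_multiplier[OF 1(2)] norm_pair_square[of z] norm_pair_square[of v]
      by (simp add: algebra_simps)
  qed
  finally have "\<kappa> * (((norm z)\<^sup>2 / 2 + 5 * b / 2 * (norm v)\<^sup>2) - b * L / 2 * (r\<^sup>2 + r'\<^sup>2)) \<le> \<kappa> * (mult_form y z + mult_form z y)"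
    using \<kappa>(1) by simp
  moreover have "\<kappa> * (b * L / 2 * (r\<^sup>2 + r'\<^sup>2)) \<le> b * \<alpha>\<^sub>2 * r'\<^sup>2"
  proof -
    have "\<kappa> * (b * L / 2 * (r\<^sup>2 + r'\<^sup>2)) = (b / 2 * r'\<^sup>2) * (\<kappa> * (L * (1 + \<alpha>\<^sub>2\<^sup>2)))"
      by (simp add: 1(4) power2_eq_square algebra_simps)
    also have "\<dots> \<le> (b / 2 * r'\<^sup>2) * (2 * \<alpha>\<^sub>2)" using \<kappa>(2) ab by (intro mult_left_mono) auto
    finally show ?thesis by (simp add: algebra_simps)
  qed
  ultimately show ?thesis using A' by (simp add: algebra_simps)
qed

text \<open>The left side of \<open>graph_lyapunov\<close> is at least -2 |z| |y|, so the same
  inequality that gives decay also bounds z and its second derivatives by y = A z. Injectivity of A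
  and boundedness of its inverse both follow.\<close>

lemma graph_norm_bound:
  assumes "graph z v y"
  shows "norm z \<le> 4 / \<kappa> * norm y" "(norm v)\<^sup>2 \<le> 16 / (5 * b * \<kappa>\<^sup>2) * (norm y)\<^sup>2"
proof -
  have "- inner z y \<le> norm z * norm y" using Cauchy_Schwarz_ineq2[of z y] by simp
  moreover have "\<kappa> * (mult_form y z + mult_form z y) \<le> norm z * norm y"
  proof -
    have "\<kappa> * mult_form y z \<le> \<kappa> * \<bar>mult_form y z\<bar>" "\<kappa> * mult_form z y \<le> \<kappa> * \<bar>mult_form z y\<bar>"
      using \<kappa>(1) by (auto intro: mult_left_mono)
    moreover have "0 \<le> norm z * norm y" by simp
    ultimately show ?thesis
      using mult_form_bound[of z y] mult_form_bound[of y z] unfolding distrib_left mult.commute[of "norm y"]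
      by linarith
  qed
  ultimately have *: "(\<kappa> / 2) * (norm z)\<^sup>2 + (5 * b * \<kappa> / 2) * (norm v)\<^sup>2 \<le> 2 * (norm z * norm y)"
    using graph_lyapunov[OF assms] by simp
  moreover have "0 \<le> (5 * b * \<kappa> / 2) * (norm v)\<^sup>2" using \<kappa> ab by simp
  ultimately have "norm z * (\<kappa> * norm z) \<le> norm z * (4 * norm y)" by (simp add: power2_eq_square algebra_simps)
  then show 1: "norm z \<le> 4 / \<kappa> * norm y" using \<kappa>(1) by (cases "norm z = 0") (auto simp: field_simps)
  have "0 \<le> (\<kappa> / 2) * (norm z)\<^sup>2" using \<kappa> by simp
  then have "(5 * b * \<kappa> / 2) * (norm v)\<^sup>2 \<le> 2 * (norm z * norm y)" using * by simp
  also have "\<dots> \<le> 2 * ((4 / \<kappa> * norm y) * norm y)" using 1 by (intro mult_left_mono mult_right_mono) auto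
  finally have "(5 * b * \<kappa> / 2) * (norm v)\<^sup>2 \<le> 8 / \<kappa> * (norm y)\<^sup>2" by (simp add: power2_eq_square)
  then have "(2 / (5 * b * \<kappa>)) * ((5 * b * \<kappa> / 2) * (norm v)\<^sup>2) \<le> (2 / (5 * b * \<kappa>)) * (8 / \<kappa> * (norm y)\<^sup>2)"
    using \<kappa> ab by (intro mult_left_mono) auto
  then show "(norm v)\<^sup>2 \<le> 16 / (5 * b * \<kappa>\<^sup>2) * (norm y)\<^sup>2" using \<kappa> ab by (simp add: power2_eq_square)
qed

section \<open>The bounded inverse of the operator\<close>

definition Binv :: "'a \<times> 'a \<Rightarrow> 'a \<times> 'a" where "Binv y = (SOME z. \<exists>v. graph z v y)"
text \<open>The second derivatives of the solution z of A z = y, as a function of y.\<close>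

definition W :: "'a \<times> 'a \<Rightarrow> 'a \<times> 'a" where "W y = (SOME v. graph (Binv y) v y)"

lemma graph_Binv: "graph (Binv y) (W y) y"
  unfolding W_def Binv_def using graph_exists[of y] by (metis (mono_tags, lifting) someI_ex)

lemma graph_y_unique: "graph z v y \<Longrightarrow> graph z' v' y \<Longrightarrow> z = z' \<and> v = v'"
proof -
  assume "graph z v y" "graph z' v' y"
  then have "graph (1 *\<^sub>R z + (- 1) *\<^sub>R z') (1 *\<^sub>R v + (- 1) *\<^sub>R v') (1 *\<^sub>R y + (- 1) *\<^sub>R y)" by (rule graph_lin)
  from graph_norm_bound[OF this] show ?thesis by simp
qed

lemma graph_iff: "(\<exists>v. graph z v y) \<longleftrightarrow> z = Binv y"
  using graph_Binv graph_y_unique by blast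

lemma Binv_W_bounded_linear: "bounded_linear Binv" "bounded_linear W"
proof -
  have lin: "Binv (s *\<^sub>R x + t *\<^sub>R y) = s *\<^sub>R Binv x + t *\<^sub>R Binv y \<and> W (s *\<^sub>R x + t *\<^sub>R y) = s *\<^sub>R W x + t *\<^sub>R W y" for s t x y
    using graph_lin[OF graph_Binv graph_Binv, of s x t y] graph_Binv graph_y_unique by blast
  have add: "Binv (x + y) = Binv x + Binv y \<and> W (x + y) = W x + W y" for x y using lin[of 1 x 1 y] by simp
  have sc: "Binv (s *\<^sub>R x) = s *\<^sub>R Binv x \<and> W (s *\<^sub>R x) = s *\<^sub>R W x" for s x using lin[of s x 0 x] by simp
  show "bounded_linear Binv"
    using graph_norm_bound(1)[OF graph_Binv] add sc
    by (intro bounded_linear_intro[where K = "4 / \<kappa>"]) (auto simp: mult.commute)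
  define C where "C = sqrt (16 / (5 * b * \<kappa>\<^sup>2))"
  have "norm (W y) \<le> norm y * C" for y
  proof (rule power2_le_imp_le)
    have "C\<^sup>2 = 16 / (5 * b * \<kappa>\<^sup>2)" unfolding C_def using ab by (intro real_sqrt_pow2) simp
    then show "(norm (W y))\<^sup>2 \<le> (norm y * C)\<^sup>2"
      using graph_norm_bound(2)[OF graph_Binv, of y] by (simp add: power_mult_distrib mult.commute)
    show "0 \<le> norm y * C" using ab by (simp add: C_def)
  qed
  then show "bounded_linear W" using add sc by (intro bounded_linear_intro[where K = C]) auto
qed

sublocale dissipative_inverse Binv
proof (rule dissipative_inverse.intro)
  show "bounded_linear Binv" by (rule Binv_W_bounded_linear)
  show "inner (Binv x) x \<le> 0" for x using graph_dissipative[OF graph_Binv] .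
  show "x = 0" if "Binv x = 0" for x
  proof -
    have "Binv 0 = 0" using Binv_W_bounded_linear(1) linear_simps(3) by blast
    then show ?thesis using that graph_Binv[of x] graph_Binv[of 0] graph_unique by metis
  qed
qed

end

section \<open>Exponential decay and smoothing\<close>

lemma integrable_subset_lebesgue_on:
  fixes h :: "real \<Rightarrow> real"
  assumes "integrable (lebesgue_on A) h" "B \<subseteq> A" "A \<in> sets lebesgue" "B \<in> sets lebesgue"
  shows "integrable (lebesgue_on B) h"
proof -
  have "set_integrable lebesgue A h" using assms by (simp add: integrable_restrict_space set_integrable_def)
  then have "set_integrable lebesgue B h" by (rule set_integrable_subset) (use assms in auto)
  then show ?thesis using assms by (simp add: integrable_restrict_space set_integrable_def)
qed

text \<open>This is the completeness of Lebesgue measure. It transfers measurability to limits and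
  norms that are identified only almost everywhere.\<close>

lemma borel_measurable_lebesgue_on_cong_AE:
  fixes f g :: "real \<Rightarrow> real"
  assumes S: "S \<in> sets lebesgue" and f: "f \<in> borel_measurable (lebesgue_on S)"
    and ae: "AE x in lebesgue_on S. f x = g x"
  shows "g \<in> borel_measurable (lebesgue_on S)"
proof -
  have "(\<lambda>x. indicator S x *\<^sub>R f x) \<in> borel_measurable lebesgue"
    using S f by (subst borel_measurable_restrict_space_iff[symmetric]) auto
  moreover have "AE x in lebesgue. indicator S x *\<^sub>R f x = indicator S x *\<^sub>R g x"
    using ae S by (auto simp: AE_restrict_space_iff indicator_def)
  ultimately have "(\<lambda>x. indicator S x *\<^sub>R g x) \<in> borel_measurable lebesgue" by (rule borel_measurable_AE)
  then show ?thesis using S by (subst borel_measurable_restrict_space_iff) auto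
qed

text \<open>By monotone convergence the sum of the functions has a finite integral, so it is finite
  almost everywhere.\<close>

lemma AE_summable_if_summable_nn_integral:
  fixes h :: "nat \<Rightarrow> 'a \<Rightarrow> real"
  assumes h: "\<And>n. h n \<in> borel_measurable M" "\<And>n x. h n x \<ge> 0"
    and le: "\<And>n. (\<integral>\<^sup>+x. ennreal (h n x) \<partial>M) \<le> ennreal (c n)"
    and c: "summable c" "\<And>n. c n \<ge> 0"
  shows "AE x in M. summable (\<lambda>n. h n x)"
proof -
  have "(\<integral>\<^sup>+x. (\<Sum>n. ennreal (h n x)) \<partial>M) = (\<Sum>n. \<integral>\<^sup>+x. ennreal (h n x) \<partial>M)"
    by (rule nn_integral_suminf) (intro measurable_compose[OF h(1) measurable_ennreal])
  also have "\<dots> \<le> (\<Sum>n. ennreal (c n))" by (intro suminf_le le) auto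
  also have "\<dots> = ennreal (\<Sum>n. c n)" by (intro suminf_ennreal2 c)
  also have "\<dots> < \<infinity>" by simp
  finally have "(\<integral>\<^sup>+x. (\<Sum>n. ennreal (h n x)) \<partial>M) < \<infinity>" .
  then have "AE x in M. (\<Sum>n. ennreal (h n x)) \<noteq> \<infinity>"
    by (intro nn_integral_PInf_AE borel_measurable_suminf_order measurable_compose[OF h(1) measurable_ennreal]) auto
  then show ?thesis
    by eventually_elim (auto intro!: summable_suminf_not_top h(2) simp: top_ennreal_def infinity_ennreal_def)
qed

text \<open>Fatou's lemma, with the limit known only almost everywhere.\<close>

lemma integrable_limit_lebesgue_on:
  fixes f :: "nat \<Rightarrow> real \<Rightarrow> real"
  assumes S: "S \<in> sets lebesgue" and f: "\<And>n. f n \<in> borel_measurable (lebesgue_on S)"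
    and lim: "AE x in lebesgue_on S. (\<lambda>n. f n x) \<longlonglongrightarrow> g x" and nn: "\<And>n x. f n x \<ge> 0" "\<And>x. g x \<ge> 0"
    and bound: "\<And>n. (\<integral>\<^sup>+x. ennreal (f n x) \<partial>lebesgue_on S) \<le> ennreal C"
  shows "integrable (lebesgue_on S) g" "C \<ge> 0 \<Longrightarrow> (LINT x|lebesgue_on S. g x) \<le> C"
proof -
  have g: "g \<in> borel_measurable (lebesgue_on S)"
  proof (rule borel_measurable_lebesgue_on_cong_AE[OF S])
    show "(\<lambda>x. lim (\<lambda>n. f n x)) \<in> borel_measurable (lebesgue_on S)"
      by (rule borel_measurable_lim_metric) (rule f)
    show "AE x in lebesgue_on S. lim (\<lambda>n. f n x) = g x" using lim by eventually_elim (rule limI)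
  qed
  have "(\<integral>\<^sup>+x. ennreal (g x) \<partial>lebesgue_on S) = (\<integral>\<^sup>+x. liminf (\<lambda>n. ennreal (f n x)) \<partial>lebesgue_on S)"
  proof (rule nn_integral_cong_AE)
    show "AE x in lebesgue_on S. ennreal (g x) = liminf (\<lambda>n. ennreal (f n x))"
      using lim
    proof eventually_elim
      case (elim x)
      then have "(\<lambda>n. ennreal (f n x)) \<longlonglongrightarrow> ennreal (g x)" by (rule tendsto_ennrealI)
      then show ?case using lim_imp_Liminf[of sequentially] by fastforce
    qed
  qed
  also have "\<dots> \<le> liminf (\<lambda>n. \<integral>\<^sup>+x. ennreal (f n x) \<partial>lebesgue_on S)"
    by (rule nn_integral_liminf) (use f in measurable)
  also have "\<dots> \<le> ennreal C" by (rule Liminf_le) (use bound in auto)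
  finally have le: "(\<integral>\<^sup>+x. ennreal (g x) \<partial>lebesgue_on S) \<le> ennreal C" .
  then have "(\<integral>\<^sup>+x. ennreal (g x) \<partial>lebesgue_on S) < \<infinity>" by (simp add: order_le_less_trans)
  then show i: "integrable (lebesgue_on S) g" using g nn by (intro integrableI_nonneg) auto
  show "(LINT x|lebesgue_on S. g x) \<le> C" if "C \<ge> 0"
    using le that nn by (simp add: nn_integral_eq_integral[OF i])
qed

text \<open>Plays the role of Cauchy-Schwarz on a bounded interval: if the integral of x^2 is of
  order d^2, that of |x| is of order d. It serves both the convergence in time and the completeness
  of \<open>l2\<close>.\<close>

lemma abs_le_add_square_div: "\<bar>x\<bar> \<le> d + x\<^sup>2 / d" if "d > 0" for x d :: real
proof -
  have "0 \<le> (\<bar>x\<bar> - d)\<^sup>2 + \<bar>x\<bar> * d" using that by simp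
  then have "\<bar>x\<bar> * d \<le> d * d + x\<^sup>2" by (simp add: power2_eq_square algebra_simps)
  then show ?thesis using that by (simp add: field_simps power2_eq_square)
qed

locale boundary_semigroup = boundary_problem +
  fixes S :: "real \<Rightarrow> 'a \<times> 'a \<Rightarrow> 'a \<times> 'a"
  assumes S: "contraction_semigroup S" "generated_by_inverse Binv S"
begin

sublocale inverse_generated_semigroup Binv S
  using S by (intro inverse_generated_semigroup.intro dissipative_inverse_axioms inverse_generated_semigroup_axioms.intro)

lemma mult_form_bilinear: "bounded_bilinear mult_form"
proof -
  have "bounded_bilinear (\<lambda>z y. inner (fst z) (X (snd y)))"
    by (rule bounded_bilinear.comp[OF bounded_bilinear_inner bounded_linear_fst
          bounded_linear_compose[OF X_bl bounded_linear_snd]])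
  then show ?thesis by (simp add: mult_form_def[abs_def])
qed

definition lyap :: "'a \<times> 'a \<Rightarrow> real" where "lyap z = (norm z)\<^sup>2 / 2 - \<kappa> * mult_form z z"

lemma lyap_bounds: "(norm z)\<^sup>2 \<le> 4 * lyap z" "4 * lyap z \<le> 3 * (norm z)\<^sup>2"
proof -
  have "\<bar>\<kappa> * mult_form z z\<bar> \<le> (norm z)\<^sup>2 / 4"
    using mult_form_bound[of z z] \<kappa>(1) by (simp add: abs_mult power2_eq_square)
  then show "(norm z)\<^sup>2 \<le> 4 * lyap z" "4 * lyap z \<le> 3 * (norm z)\<^sup>2" by (auto simp: lyap_def)
qed

text \<open>The derivative of \<open>lyap\<close> along the orbit of \<open>Binv y\<close>. That
  orbit is \<open>Binv (S t y)\<close> and its velocity is \<open>S t y\<close>.\<close>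

definition lyap' :: "'a \<times> 'a \<Rightarrow> real \<Rightarrow> real" where
  "lyap' y t = inner (Binv (S t y)) (S t y) - \<kappa> * (mult_form (S t y) (Binv (S t y)) + mult_form (Binv (S t y)) (S t y))"

lemma lyap_deriv:
  assumes t: "t \<ge> 0"
  shows "((\<lambda>t. lyap (S t (Binv y))) has_real_derivative lyap' y t) (at t within {0..})"
proof -
  note d = S_deriv[OF t, of y]
  have 1: "((\<lambda>t. (norm (S t (Binv y)))\<^sup>2) has_real_derivative 2 * inner (S t (Binv y)) (S t y)) (at t within {0..})"
    by (rule has_real_derivative_norm_square[OF d])
  have 2: "((\<lambda>t. mult_form (S t (Binv y)) (S t (Binv y))) has_real_derivative
      (mult_form (S t (Binv y)) (S t y) + mult_form (S t y) (S t (Binv y)))) (at t within {0..})"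
    unfolding has_real_derivative_iff_has_vector_derivative
    by (rule bounded_bilinear.has_vector_derivative[OF mult_form_bilinear d d])
  show ?thesis
    unfolding lyap_def lyap'_def
    by (rule derivative_eq_intros 1 2 refl | simp add: S_B t algebra_simps)+
qed

lemma lyap'_le: "lyap' y t \<le> - (\<kappa> / 2) * (norm (Binv (S t y)))\<^sup>2 - (5 * b * \<kappa> / 2) * (norm (W (S t y)))\<^sup>2"
  unfolding lyap'_def by (rule graph_lyapunov[OF graph_Binv])

lemma decay_on_domain:
  assumes t: "t \<ge> 0"
  shows "norm (S t (Binv y)) \<le> 2 * exp (- (\<kappa> / 3) * t) * norm (Binv y)"
proof -
  \<comment> \<open>Chosen so that \<mu> times the upper constant 3/4 of \<open>lyap_bounds\<close>
    equals the \<kappa> / 2 of the Lyapunov inequality; passing from squared norms to norms halves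
    the rate to \<kappa> / 3.\<close>
  define \<mu> where "\<mu> = 2 * \<kappa> / 3"
  define g where "g t = exp (\<mu> * t) * lyap (S t (Binv y))" for t
  have "g t \<le> g 0"
  proof (rule DERIV_nonpos_imp_le_0[OF _ _ t])
    fix s :: real assume s: "s \<ge> 0"
    show "(g has_real_derivative exp (\<mu> * s) * (\<mu> * lyap (S s (Binv y)) + lyap' y s)) (at s within {0..})"
      unfolding g_def
      by (rule derivative_eq_intros lyap_deriv[OF s] refl | simp add: algebra_simps)+
    have "\<mu> * lyap (S s (Binv y)) \<le> \<mu> * (3 / 4 * (norm (S s (Binv y)))\<^sup>2)"
      using lyap_bounds(2)[of "S s (Binv y)"] \<kappa>(1) by (intro mult_left_mono) (auto simp: \<mu>_def)
    moreover have "lyap' y s \<le> - (\<kappa> / 2) * (norm (Binv (S s y)))\<^sup>2"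
    proof -
      have "0 \<le> (5 * b * \<kappa> / 2) * (norm (W (S s y)))\<^sup>2" using ab \<kappa>(1) by simp
      then show ?thesis using lyap'_le[of y s] by linarith
    qed
    ultimately have "\<mu> * lyap (S s (Binv y)) + lyap' y s \<le> 0" by (simp add: \<mu>_def S_B s)
    then show "exp (\<mu> * s) * (\<mu> * lyap (S s (Binv y)) + lyap' y s) \<le> 0" by (simp add: mult_nonneg_nonpos)
  qed
  then have "4 * (exp (\<mu> * t) * lyap (S t (Binv y))) \<le> 4 * lyap (Binv y)" by (simp add: g_def S_0)
  moreover have "exp (\<mu> * t) * (norm (S t (Binv y)))\<^sup>2 \<le> exp (\<mu> * t) * (4 * lyap (S t (Binv y)))"
    using lyap_bounds(1)[of "S t (Binv y)"] by (intro mult_left_mono) auto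
  ultimately have "exp (\<mu> * t) * (norm (S t (Binv y)))\<^sup>2 \<le> 4 * lyap (Binv y)" by linarith
  also have "\<dots> \<le> 4 * (norm (Binv y))\<^sup>2"
    using lyap_bounds(2)[of "Binv y"] by (smt (verit) zero_le_power2)
  finally have "exp (\<mu> * t) * (norm (S t (Binv y)))\<^sup>2 \<le> 4 * (norm (Binv y))\<^sup>2" .
  then have "exp (- \<mu> * t) * (exp (\<mu> * t) * (norm (S t (Binv y)))\<^sup>2) \<le> exp (- \<mu> * t) * (4 * (norm (Binv y))\<^sup>2)"
    by (intro mult_left_mono) auto
  also have "exp (- \<mu> * t) * (exp (\<mu> * t) * (norm (S t (Binv y)))\<^sup>2) = (norm (S t (Binv y)))\<^sup>2"
    by (simp add: mult.assoc[symmetric] exp_add[symmetric])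
  also have "exp (- \<mu> * t) * (4 * (norm (Binv y))\<^sup>2) = (2 * exp (- (\<kappa> / 3) * t) * norm (Binv y))\<^sup>2"
  proof -
    have "exp (- \<mu> * t) = (exp (- (\<kappa> / 3) * t))\<^sup>2"
      by (simp add: power2_eq_square exp_add[symmetric] \<mu>_def)
    then show ?thesis by (simp add: power_mult_distrib)
  qed
  finally show ?thesis by (rule power2_le_imp_le) simp
qed

lemma exponential_decay:
  assumes t: "t \<ge> 0"
  shows "norm (S t z) \<le> 2 * exp (- (\<kappa> / 3) * t) * norm z"
proof -
  have "\<forall>n. \<exists>y. norm (z - Binv y) < 1 / (real n + 1)"
    by (intro allI approx_range) simp
  then obtain y where y: "\<And>n. norm (z - Binv (y n)) < 1 / (real n + 1)" by metis
  have "(\<lambda>n. Binv (y n)) \<longlonglongrightarrow> z"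
  proof (rule LIM_zero_cancel, rule Lim_null_comparison[OF always_eventually])
    show "\<forall>n. norm (Binv (y n) - z) \<le> 1 / (real n + 1)" using y by (simp add: norm_minus_commute less_imp_le)
    show "(\<lambda>n. 1 / (real n + 1)) \<longlonglongrightarrow> 0" using eps_tendsto by (simp add: eps_def[abs_def])
  qed
  then show ?thesis
    by (intro LIMSEQ_le[of "\<lambda>n. norm (S t (Binv (y n)))" _ "\<lambda>n. 2 * exp (- (\<kappa> / 3) * t) * norm (Binv (y n))"])
       (use decay_on_domain[OF t] in \<open>auto intro!: tendsto_intros bounded_linear.tendsto[OF S_bounded_linear[OF t]]\<close>)
qed

lemma W_continuous: "continuous_on {0..} (\<lambda>t. W (S t y))"
  by (rule bounded_linear.continuous_on[OF Binv_W_bounded_linear(2) S_continuous])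

text \<open>The second-derivative term of the Lyapunov inequality, integrated in time. The bound
  involves the norm of the initial state \<open>Binv y\<close> and not that of y, so it is stable
  under approximation of arbitrary data.\<close>

lemma smoothing_on_domain:
  assumes T: "T \<ge> 0"
  shows "integral {0..T} (\<lambda>t. (norm (W (S t y)))\<^sup>2) \<le> 2 / (5 * b * \<kappa>) * (norm (Binv y))\<^sup>2"
proof -
  define h where "h t = (norm (W (S t y)))\<^sup>2" for t
  define c where "c = 5 * b * \<kappa> / 2"
  have c: "c > 0" using ab \<kappa>(1) by (simp add: c_def)
  have hc: "continuous_on {0..} h" unfolding h_def by (intro continuous_intros W_continuous)
  have I: "((\<lambda>t. integral {0..t} h) has_real_derivative h t) (at t within {0..})" if t: "t \<ge> 0" for t
  proof -
    have "((\<lambda>t. integral {0..t} h) has_real_derivative h t) (at t within {0..t + 1})"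
      using t by (intro integral_has_real_derivative continuous_on_subset[OF hc]) auto
    moreover have "at t within {0..t + 1} = at t within {0..}"
      by (rule at_within_nhd[of _ "{t - 1<..<t + 1}"]) (use t in auto)
    ultimately show ?thesis by simp
  qed
  define g where "g t = lyap (S t (Binv y)) + c * integral {0..t} h" for t
  have "g T \<le> g 0"
  proof (rule DERIV_nonpos_imp_le_0[OF _ _ T])
    fix s :: real assume s: "s \<ge> 0"
    show "(g has_real_derivative lyap' y s + c * h s) (at s within {0..})"
      unfolding g_def by (intro DERIV_add DERIV_cmult lyap_deriv s I)
    have "0 \<le> (\<kappa> / 2) * (norm (Binv (S s y)))\<^sup>2" using \<kappa>(1) by simp
    then show "lyap' y s + c * h s \<le> 0" using lyap'_le[of y s] by (simp add: c_def h_def)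
  qed
  then have "c * integral {0..T} h \<le> lyap (Binv y) - lyap (S T (Binv y))" by (simp add: g_def S_0)
  also have "\<dots> \<le> (norm (Binv y))\<^sup>2"
    using lyap_bounds(2)[of "Binv y"] lyap_bounds(1)[of "S T (Binv y)"] by (smt (verit) zero_le_power2)
  finally have "(1 / c) * (c * integral {0..T} h) \<le> (1 / c) * (norm (Binv y))\<^sup>2"
    using c by (intro mult_left_mono) auto
  then have "integral {0..T} h \<le> (1 / c) * (norm (Binv y))\<^sup>2" using c by simp
  moreover have "1 / c = 2 / (5 * b * \<kappa>)" by (simp add: c_def)
  ultimately show ?thesis by (simp add: h_def[abs_def])
qed

lemma nn_integral_lebesgue_on_eq_integral:
  fixes h :: "real \<Rightarrow> real"
  assumes h: "continuous_on {0..} h" "\<And>t. h t \<ge> 0"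
  shows "(\<integral>\<^sup>+t. ennreal (h t) \<partial>lebesgue_on {0<..<T}) = ennreal (integral {0..T} h)"
proof -
  have i: "integrable (lebesgue_on {0..T}) h"
    by (rule continuous_imp_integrable_real) (rule continuous_on_subset[OF h(1)], auto)
  then have i': "integrable (lebesgue_on {0<..<T}) h"
    by (rule integrable_subset_lebesgue_on) auto
  have "(\<integral>\<^sup>+t. ennreal (h t) \<partial>lebesgue_on {0<..<T}) = ennreal (LINT t|lebesgue_on {0<..<T}. h t)"
    by (rule nn_integral_eq_integral[OF i']) (simp add: h)
  also have "(LINT t|lebesgue_on {0<..<T}. h t) = integral {0<..<T} h"
    by (rule lebesgue_integral_eq_integral[OF i']) simp
  also have "\<dots> = integral {0..T} h" by (simp add: integral_open_interval_real)
  finally show ?thesis .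
qed

definition VV :: "'a \<times> 'a \<Rightarrow> 'a \<times> 'a" where "VV w = (V (V (fst w)), V (V (snd w)))"

lemma VV_bounded_linear: "bounded_linear VV"
  unfolding VV_def
  by (intro bounded_linear_Pair bounded_linear_compose[OF V_bl] bounded_linear_fst bounded_linear_snd)

lemma VV_W: "VV (W y) = Binv y"
  using graph_Binv[of y] jet_VV unfolding graph_def VV_def by (metis prod.collapse)

text \<open>For arbitrary z the second derivatives w t are obtained only for almost every t, as
  limits along data \<open>Binv (y n)\<close> that approach z at a geometric rate: the increments
  are then summable in L^1(0,T). Integrability follows by Fatou from the uniform bound of
  \<open>smoothing_on_domain\<close>. N is left general and later becomes the squared H^2 norm; the
  sequence y is part of the conclusion because strong measurability is read off from it.\<close>

lemma smoothing:
  fixes N :: "'a \<times> 'a \<Rightarrow> real"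
  assumes N: "continuous_on UNIV N" "\<And>w. N w \<ge> 0" "\<And>w. N w \<le> c * (norm w)\<^sup>2" "c \<ge> 0"
  shows "\<exists>y w. (AE t in lebesgue_on {0<..<T}. (\<lambda>n. W (S t (y n))) \<longlonglongrightarrow> w t \<and> VV (w t) = S t z) \<and>
    integrable (lebesgue_on {0<..<T}) (\<lambda>t. N (w t))"
proof (cases "T > 0")
  case False
  then have "{0<..<T} = {}" by auto
  then show ?thesis by (intro exI) (auto simp: integrable_restrict_space AE_restrict_space_iff)
next
  case T: True
  define K where "K = 2 / (5 * b * \<kappa>)"
  have K: "K > 0" using ab \<kappa> by (simp add: K_def)
  let ?M = "lebesgue_on {0<..<T}"
  have "\<forall>n. \<exists>y. norm (z - Binv y) < (1 / 4) ^ n" by (intro allI approx_range) simp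
  then obtain y where y: "\<And>n. norm (z - Binv (y n)) < (1 / 4) ^ n" by metis
  define w\<^sub>n where "w\<^sub>n n t = W (S t (y n))" for n t
  have cont: "continuous_on {0..} (w\<^sub>n n)" for n unfolding w\<^sub>n_def by (rule W_continuous)
  have meas: "(\<lambda>t. f t) \<in> borel_measurable ?M" if "continuous_on {0..} f" for f :: "real \<Rightarrow> real"
    by (rule continuous_imp_measurable_on_sets_lebesgue[OF continuous_on_subset[OF that]]) auto
  have diff: "(\<integral>\<^sup>+t. ennreal (norm (w\<^sub>n (Suc n) t - w\<^sub>n n t)) \<partial>?M) \<le> ennreal ((T + 4 * K) * (1 / 4) ^ n)" for n
  proof -
    \<comment> \<open>The size of the approximation error at stage n, which balances the two terms
      of \<open>abs_le_add_square_div\<close>.\<close>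
    define d where "d = (1 / 4 :: real) ^ n"
    have d: "d > 0" by (simp add: d_def)
    define u where "u t = norm (w\<^sub>n (Suc n) t - w\<^sub>n n t)" for t
    have uc: "continuous_on {0..} u" unfolding u_def by (intro continuous_intros cont)
    have u2: "integral {0..T} (\<lambda>t. (u t)\<^sup>2) \<le> K * (2 * d)\<^sup>2"
    proof -
      have eq: "u t = norm (W (S t (y (Suc n) - y n)))" if "t \<in> {0..T}" for t
        using that unfolding u_def w\<^sub>n_def
        by (simp add: linear_diff[OF S_linear] linear_simps(2)[OF Binv_W_bounded_linear(2)])
      have "integral {0..T} (\<lambda>t. (u t)\<^sup>2) = integral {0..T} (\<lambda>t. (norm (W (S t (y (Suc n) - y n))))\<^sup>2)"
        by (rule integral_cong) (simp add: eq)
      also have "\<dots> \<le> K * (norm (Binv (y (Suc n) - y n)))\<^sup>2"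
        unfolding K_def using T by (intro smoothing_on_domain) simp
      also have "\<dots> \<le> K * (2 * d)\<^sup>2"
      proof -
        have "Binv (y (Suc n) - y n) = (z - Binv (y n)) - (z - Binv (y (Suc n)))" by (simp add: B.diff)
        then have "norm (Binv (y (Suc n) - y n)) \<le> norm (z - Binv (y n)) + norm (z - Binv (y (Suc n)))"
          by (simp only: norm_triangle_ineq4)
        also have "\<dots> \<le> d + d"
        proof -
          have "(1 / 4 :: real) ^ Suc n \<le> (1 / 4) ^ n" by (rule power_decreasing) auto
          then show ?thesis using y[of n] y[of "Suc n"] unfolding d_def by linarith
        qed
        finally show ?thesis using K by (intro mult_left_mono power_mono) auto
      qed
      finally show ?thesis .
    qed
    have "u t \<le> d + (u t)\<^sup>2 / d" for t
      using abs_le_add_square_div[OF d, of "u t"] by linarith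
    then have "integral {0..T} u \<le> integral {0..T} (\<lambda>t. d + (u t)\<^sup>2 / d)"
      using d by (intro integral_le integrable_continuous_real continuous_intros continuous_on_subset[OF uc]) auto
    also have "\<dots> = T * d + integral {0..T} (\<lambda>t. (u t)\<^sup>2) / d"
      using T d by (subst integral_add) (auto intro!: integrable_continuous_real continuous_intros continuous_on_subset[OF uc])
    also have "\<dots> \<le> T * d + K * (2 * d)\<^sup>2 / d" using u2 d by (intro add_left_mono divide_right_mono) auto
    also have "\<dots> = (T + 4 * K) * d" using d by (simp add: power2_eq_square algebra_simps)
    finally have "integral {0..T} u \<le> (T + 4 * K) * d" .
    then show ?thesis
      using nn_integral_lebesgue_on_eq_integral[OF uc, of T] by (simp add: u_def d_def ennreal_leI)
  qed
  have "AE t in ?M. summable (\<lambda>n. norm (w\<^sub>n (Suc n) t - w\<^sub>n n t))"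
  proof (rule AE_summable_if_summable_nn_integral[OF _ _ diff])
    show "(\<lambda>t. norm (w\<^sub>n (Suc n) t - w\<^sub>n n t)) \<in> borel_measurable ?M" for n
      by (intro meas continuous_intros cont)
  qed (use T K in \<open>auto intro!: summable_mult summable_geometric\<close>)
  then have conv: "AE t in ?M. convergent (\<lambda>n. w\<^sub>n n t)"
  proof eventually_elim
    case (elim t)
    then have "summable (\<lambda>n. w\<^sub>n (Suc n) t - w\<^sub>n n t)" by (rule summable_norm_cancel)
    then have "convergent (\<lambda>n. \<Sum>i<n. w\<^sub>n (Suc i) t - w\<^sub>n i t)" by (simp add: summable_iff_convergent)
    then have "convergent (\<lambda>n. w\<^sub>n n t - w\<^sub>n 0 t)" using sum_lessThan_telescope[of "\<lambda>n. w\<^sub>n n t"] by simp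
    then have "convergent (\<lambda>n. (w\<^sub>n n t - w\<^sub>n 0 t) + w\<^sub>n 0 t)"
      by (intro convergent_add convergent_const)
    then show ?case by simp
  qed
  define w where "w t = lim (\<lambda>n. w\<^sub>n n t)" for t
  have lim: "AE t in ?M. (\<lambda>n. w\<^sub>n n t) \<longlonglongrightarrow> w t"
    using conv by eventually_elim (simp add: w_def convergent_LIMSEQ_iff)
  have Binv_lim: "(\<lambda>n. Binv (y n)) \<longlonglongrightarrow> z"
  proof (rule LIM_zero_cancel, rule Lim_null_comparison[OF always_eventually])
    show "\<forall>n. norm (Binv (y n) - z) \<le> (1 / 4) ^ n" using y by (simp add: norm_minus_commute less_imp_le)
    show "(\<lambda>n. (1 / 4 :: real) ^ n) \<longlonglongrightarrow> 0" by (intro LIMSEQ_realpow_zero) auto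
  qed
  have VV: "AE t in ?M. VV (w t) = S t z"
    using lim AE_space
  proof eventually_elim
    case (elim t)
    then have t: "t \<ge> 0" by (simp add: space_restrict_space)
    have "(\<lambda>n. VV (w\<^sub>n n t)) \<longlonglongrightarrow> VV (w t)" using elim by (intro bounded_linear.tendsto[OF VV_bounded_linear]) auto
    moreover have "VV (w\<^sub>n n t) = S t (Binv (y n))" for n by (simp add: w\<^sub>n_def VV_W S_B t)
    moreover have "(\<lambda>n. S t (Binv (y n))) \<longlonglongrightarrow> S t z"
      by (rule bounded_linear.tendsto[OF S_bounded_linear[OF t] Binv_lim])
    ultimately show ?case using LIMSEQ_unique by auto
  qed
  have Ncont: "continuous_on {0..} (\<lambda>t. N (w\<^sub>n n t))" for n
    using continuous_on_compose[OF cont[of n], of N] continuous_on_subset[OF N(1)] by (simp add: o_def)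
  have Nlim: "AE t in ?M. (\<lambda>n. N (w\<^sub>n n t)) \<longlonglongrightarrow> N (w t)"
    using lim
  proof eventually_elim
    case (elim t)
    then show ?case using N(1) by (intro isCont_tendsto_compose[of _ N]) (simp_all add: continuous_on_eq_continuous_at del: split_paired_All)
  qed
  have bound: "(\<integral>\<^sup>+t. ennreal (N (w\<^sub>n n t)) \<partial>?M) \<le> ennreal (c * (K * (norm z + 1)\<^sup>2))" for n
  proof -
    have Wc: "continuous_on {0..} (\<lambda>t. (norm (W (S t (y n))))\<^sup>2)" by (intro continuous_intros W_continuous)
    have "integral {0..T} (\<lambda>t. N (w\<^sub>n n t)) \<le> integral {0..T} (\<lambda>t. c * (norm (W (S t (y n))))\<^sup>2)"
      unfolding w\<^sub>n_def using Ncont[of n] unfolding w\<^sub>n_def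
      by (intro integral_le integrable_continuous_real continuous_on_mult_left N(3))
         (auto intro: continuous_on_subset[OF Wc] continuous_on_subset)
    also have "\<dots> = c * integral {0..T} (\<lambda>t. (norm (W (S t (y n))))\<^sup>2)" by simp
    also have "\<dots> \<le> c * (K * (norm (Binv (y n)))\<^sup>2)"
      unfolding K_def using T N(4) by (intro mult_left_mono smoothing_on_domain) auto
    also have "\<dots> \<le> c * (K * (norm z + 1)\<^sup>2)"
    proof -
      have "norm (Binv (y n)) \<le> norm z + norm (z - Binv (y n))"
        using norm_triangle_ineq4[of z "z - Binv (y n)"] by simp
      also have "\<dots> \<le> norm z + 1"
        using y[of n] power_le_one[of "1 / 4 :: real" n] by simp
      finally show ?thesis using K N(4) by (intro mult_left_mono power_mono) auto
    qed
    finally show ?thesis by (simp add: nn_integral_lebesgue_on_eq_integral[OF Ncont N(2)] ennreal_leI)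
  qed
  have "integrable ?M (\<lambda>t. N (w t))"
    by (rule integrable_limit_lebesgue_on(1)[OF _ meas[OF Ncont] Nlim N(2) N(2) bound]) simp
  moreover have "AE t in ?M. (\<lambda>n. W (S t (y n))) \<longlonglongrightarrow> w t \<and> VV (w t) = S t z"
    using lim VV by eventually_elim (simp add: w\<^sub>n_def)
  ultimately show ?thesis by blast
qed

end

section \<open>The Hilbert space of square-integrable functions\<close>

abbreviation "intv L \<equiv> lebesgue_on {0<..<L::real}"

lemma L2_measurable: "f \<in> L2_space L \<Longrightarrow> f \<in> borel_measurable (intv L)"
  and L2_integrable_square: "f \<in> L2_space L \<Longrightarrow> integrable (intv L) (\<lambda>x. (f x)\<^sup>2)"
  by (auto simp: L2_space_def)

lemma finite_measure_intv: "finite_measure (intv L)"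
  by (rule finite_measure_lebesgue_on) simp

lemma power2_le_if_abs_le: "\<bar>x\<bar> \<le> B \<Longrightarrow> x\<^sup>2 \<le> B\<^sup>2" for x B :: real
  using power_mono[of "\<bar>x\<bar>" B 2] by simp

lemma L2_bounded:
  assumes "f \<in> borel_measurable (intv L)" "\<And>x. x \<in> {0<..<L} \<Longrightarrow> \<bar>f x\<bar> \<le> B"
  shows "f \<in> L2_space L"
proof -
  interpret finite_measure "intv L" by (rule finite_measure_intv)
  have "integrable (intv L) (\<lambda>x. (f x)\<^sup>2)"
  proof (rule integrable_const_bound[of _ "B\<^sup>2"])
    show "AE x in intv L. norm ((f x)\<^sup>2) \<le> B\<^sup>2"
      using assms(2) by (intro AE_I2) (auto simp: space_restrict_space intro!: power2_le_if_abs_le)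
  qed (use assms in auto)
  then show ?thesis using assms by (simp add: L2_space_def)
qed

lemma L2_const: "(\<lambda>x. c) \<in> L2_space L"
  by (rule L2_bounded[of _ _ "\<bar>c\<bar>"]) auto

lemma L2_mult_integrable:
  assumes "f \<in> L2_space L" "g \<in> L2_space L"
  shows "integrable (intv L) (\<lambda>x. f x * g x)"
proof (rule Bochner_Integration.integrable_bound[where f = "\<lambda>x. (f x)\<^sup>2 + (g x)\<^sup>2"])
  show "integrable (intv L) (\<lambda>x. (f x)\<^sup>2 + (g x)\<^sup>2)" using assms by (simp add: L2_integrable_square)
  show "(\<lambda>x. f x * g x) \<in> borel_measurable (intv L)"
    using assms by (intro borel_measurable_times L2_measurable)
  have "\<bar>a * b\<bar> \<le> a\<^sup>2 + b\<^sup>2" for a b :: real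
  proof -
    have "2 * \<bar>a\<bar> * \<bar>b\<bar> \<le> a\<^sup>2 + b\<^sup>2" using sum_squares_bound[of "\<bar>a\<bar>" "\<bar>b\<bar>"] by simp
    moreover have "0 \<le> \<bar>a\<bar> * \<bar>b\<bar>" by simp
    ultimately show ?thesis unfolding abs_mult by linarith
  qed
  then show "AE x in intv L. norm (f x * g x) \<le> norm ((f x)\<^sup>2 + (g x)\<^sup>2)" by (intro AE_I2) simp
qed

lemma L2_integrable: "f \<in> L2_space L \<Longrightarrow> integrable (intv L) f"
  using L2_mult_integrable[of f L "\<lambda>x. 1"] L2_const by simp

lemma L2_lincomb:
  assumes "f \<in> L2_space L" "g \<in> L2_space L"
  shows "(\<lambda>x. r * f x + s * g x) \<in> L2_space L"
proof -
  have "(\<lambda>x. (r * f x + s * g x)\<^sup>2) = (\<lambda>x. r\<^sup>2 * (f x)\<^sup>2 + s\<^sup>2 * (g x)\<^sup>2 + (2 * r * s) * (f x * g x))"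
    by (simp add: fun_eq_iff power2_eq_square algebra_simps)
  moreover have "integrable (intv L) (\<lambda>x. r\<^sup>2 * (f x)\<^sup>2 + s\<^sup>2 * (g x)\<^sup>2 + (2 * r * s) * (f x * g x))"
    using assms by (intro Bochner_Integration.integrable_add integrable_mult_right L2_integrable_square L2_mult_integrable)
  moreover have "(\<lambda>x. r * f x + s * g x) \<in> borel_measurable (intv L)"
    using L2_measurable[OF assms(1)] L2_measurable[OF assms(2)] by measurable
  ultimately show ?thesis by (simp add: L2_space_def)
qed

lemma L2_add: "f \<in> L2_space L \<Longrightarrow> g \<in> L2_space L \<Longrightarrow> (\<lambda>x. f x + g x) \<in> L2_space L"
  using L2_lincomb[of f L g 1 1] by simp

lemma L2_diff: "f \<in> L2_space L \<Longrightarrow> g \<in> L2_space L \<Longrightarrow> (\<lambda>x. f x - g x) \<in> L2_space L"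
  using L2_lincomb[of f L g 1 "-1"] by simp

lemma L2_scale: "f \<in> L2_space L \<Longrightarrow> (\<lambda>x. r * f x) \<in> L2_space L"
  using L2_lincomb[of f L f r 0] by simp

lemma L2_uminus: "f \<in> L2_space L \<Longrightarrow> (\<lambda>x. - f x) \<in> L2_space L"
  using L2_scale[of f L "-1"] by simp

lemma L2_inner_cong_AE:
  assumes "f \<in> L2_space L" "g \<in> L2_space L" "f' \<in> L2_space L" "g' \<in> L2_space L"
    "AE x in intv L. f x = f' x" "AE x in intv L. g x = g' x"
  shows "L2_inner L f g = L2_inner L f' g'"
  unfolding L2_inner_def
proof (rule integral_cong_AE)
  show "AE x in intv L. f x * g x = f' x * g' x" using assms(5,6) by eventually_elim simp
qed (intro borel_measurable_times L2_measurable assms)+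

lemma L2_inner_commute: "L2_inner L f g = L2_inner L g f"
  by (simp add: L2_inner_def mult.commute)

lemma L2_inner_lincomb:
  assumes "f \<in> L2_space L" "g \<in> L2_space L" "h \<in> L2_space L"
  shows "L2_inner L (\<lambda>x. r * f x + s * g x) h = r * L2_inner L f h + s * L2_inner L g h"
proof -
  have "L2_inner L (\<lambda>x. r * f x + s * g x) h = (LINT x|intv L. r * (f x * h x) + s * (g x * h x))"
    by (simp add: L2_inner_def algebra_simps)
  also have "\<dots> = r * L2_inner L f h + s * L2_inner L g h"
    using assms by (simp add: L2_inner_def L2_mult_integrable)
  finally show ?thesis .
qed

lemma L2_inner_nonneg: "L2_inner L f f \<ge> 0"
  by (simp add: L2_inner_def)

lemma L2_inner_eq_0_iff:
  assumes "f \<in> L2_space L"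
  shows "L2_inner L f f = 0 \<longleftrightarrow> (AE x in intv L. f x = 0)"
proof -
  have "L2_inner L f f = 0 \<longleftrightarrow> (AE x in intv L. f x * f x = 0)"
    unfolding L2_inner_def
    by (rule integral_nonneg_eq_0_iff_AE) (use L2_mult_integrable[OF assms assms] in auto)
  then show ?thesis by simp
qed

definition l2rel :: "(real \<Rightarrow> real) \<Rightarrow> (real \<Rightarrow> real) \<Rightarrow> bool" where
  "l2rel f g \<longleftrightarrow> f \<in> L2_space 1 \<and> g \<in> L2_space 1 \<and> (AE x in intv 1. f x = g x)"

\<comment> \<open>Classes over the fixed interval (0,1), from which every (0,L) is reached by
  scaling. The quotient is partial because a function that is not square integrable has no
  class.\<close>
quotient_type l2 = "real \<Rightarrow> real" / partial: l2rel
  morphisms rep_l2 abs_l2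
proof (rule part_equivpI)
  show "\<exists>x. l2rel x x" by (intro exI[of _ "\<lambda>x. 0"]) (simp add: l2rel_def L2_const)
  show "symp l2rel" by (auto simp: symp_def l2rel_def elim: eventually_mono)
  show "transp l2rel"
  proof (rule transpI)
    fix f g h assume a: "l2rel f g" "l2rel g h"
    then have "AE x in intv 1. f x = g x" "AE x in intv 1. g x = h x" by (auto simp: l2rel_def)
    then have "AE x in intv 1. f x = h x" by eventually_elim simp
    then show "l2rel f h" using a by (simp add: l2rel_def)
  qed
qed

lemma rep_l2: "rep_l2 p \<in> L2_space 1"
  using Quotient3_rel_rep[OF Quotient3_l2, of p p] by (simp add: l2rel_def)

lemma abs_rep_l2: "abs_l2 (rep_l2 p) = p"
  by (rule Quotient3_abs_rep[OF Quotient3_l2])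

instantiation l2 :: real_inner
begin

lift_definition zero_l2 :: l2 is "\<lambda>x. 0" by (simp add: l2rel_def L2_const)

lift_definition plus_l2 :: "l2 \<Rightarrow> l2 \<Rightarrow> l2" is "\<lambda>f g x. f x + g x"
proof -
  fix f f' g g' assume a: "l2rel f f'" "l2rel g g'"
  then have "AE x in intv 1. f x = f' x" "AE x in intv 1. g x = g' x" by (auto simp: l2rel_def)
  then have "AE x in intv 1. f x + g x = f' x + g' x" by eventually_elim simp
  then show "l2rel (\<lambda>x. f x + g x) (\<lambda>x. f' x + g' x)" using a by (simp add: l2rel_def L2_add)
qed

lift_definition uminus_l2 :: "l2 \<Rightarrow> l2" is "\<lambda>f x. - f x"
  by (auto simp: l2rel_def L2_uminus elim: eventually_mono)

lift_definition minus_l2 :: "l2 \<Rightarrow> l2 \<Rightarrow> l2" is "\<lambda>f g x. f x - g x"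
proof -
  fix f f' g g' assume a: "l2rel f f'" "l2rel g g'"
  then have "AE x in intv 1. f x = f' x" "AE x in intv 1. g x = g' x" by (auto simp: l2rel_def)
  then have "AE x in intv 1. f x - g x = f' x - g' x" by eventually_elim simp
  then show "l2rel (\<lambda>x. f x - g x) (\<lambda>x. f' x - g' x)" using a by (simp add: l2rel_def L2_diff)
qed

lift_definition scaleR_l2 :: "real \<Rightarrow> l2 \<Rightarrow> l2" is "\<lambda>r f x. r * f x"
  by (auto simp: l2rel_def L2_scale elim: eventually_mono)

lift_definition inner_l2 :: "l2 \<Rightarrow> l2 \<Rightarrow> real" is "L2_inner 1"
  unfolding l2rel_def by (intro L2_inner_cong_AE) auto

definition norm_l2 :: "l2 \<Rightarrow> real" where "norm_l2 p = sqrt (inner p p)"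
definition dist_l2 :: "l2 \<Rightarrow> l2 \<Rightarrow> real" where "dist_l2 p q = norm (p - q)"
definition sgn_l2 :: "l2 \<Rightarrow> l2" where "sgn_l2 p = inverse (norm p) *\<^sub>R p"
definition uniformity_l2 :: "(l2 \<times> l2) filter" where
  "uniformity_l2 = (INF e\<in>{0<..}. principal {(x, y). dist x y < e})"
definition open_l2 :: "l2 set \<Rightarrow> bool" where
  "open_l2 U \<longleftrightarrow> (\<forall>x\<in>U. \<forall>\<^sub>F (x', y) in uniformity. x' = x \<longrightarrow> y \<in> U)"

instance
proof
  fix p q s :: l2 and r t :: real
  have L: "l2rel f g" if "f \<in> L2_space 1" "f = g" for f g using that by (simp add: l2rel_def)
  show "dist p q = norm (p - q)" by (rule dist_l2_def)
  show "sgn p = inverse (norm p) *\<^sub>R p" by (rule sgn_l2_def)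
  show "(uniformity :: (l2 \<times> l2) filter) = (INF e\<in>{0<..}. principal {(x, y). dist x y < e})"
    by (rule uniformity_l2_def)
  show "open U \<longleftrightarrow> (\<forall>x\<in>U. \<forall>\<^sub>F (x', y) in uniformity. x' = x \<longrightarrow> y \<in> U)" for U :: "l2 set"
    by (rule open_l2_def)
  show "norm p = sqrt (inner p p)" by (rule norm_l2_def)
  show "p + q + s = p + (q + s)"
    by transfer (auto intro!: L L2_add simp: l2rel_def algebra_simps)
  show "p + q = q + p" by transfer (auto intro!: L L2_add simp: l2rel_def algebra_simps)
  show "0 + p = p" by transfer (auto intro!: L L2_add simp: l2rel_def algebra_simps)
  show "- p + p = 0" by transfer (auto simp: l2rel_def L2_const)
  show "p - q = p + - q" by transfer (auto intro!: L L2_diff simp: l2rel_def algebra_simps)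
  show "r *\<^sub>R (p + q) = r *\<^sub>R p + r *\<^sub>R q"
    by transfer (auto intro!: L L2_scale L2_add simp: l2rel_def algebra_simps)
  show "(r + t) *\<^sub>R p = r *\<^sub>R p + t *\<^sub>R p"
    by transfer (auto intro!: L L2_scale L2_add simp: l2rel_def algebra_simps)
  show "r *\<^sub>R t *\<^sub>R p = (r * t) *\<^sub>R p"
    by transfer (auto intro!: L L2_scale simp: l2rel_def algebra_simps)
  show "1 *\<^sub>R p = p" by transfer (simp add: l2rel_def)
  show "inner p q = inner q p" by transfer (rule L2_inner_commute)
  show "inner (p + q) s = inner p s + inner q s"
  proof transfer
    fix f g h :: "real \<Rightarrow> real" assume "l2rel f f" "l2rel g g" "l2rel h h"
    then show "L2_inner 1 (\<lambda>x. f x + g x) h = L2_inner 1 f h + L2_inner 1 g h"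
      using L2_inner_lincomb[of f 1 g h 1 1] by (simp add: l2rel_def)
  qed
  show "inner (r *\<^sub>R p) q = r * inner p q"
  proof transfer
    fix r and f h :: "real \<Rightarrow> real" assume "l2rel f f" "l2rel h h"
    then show "L2_inner 1 (\<lambda>x. r * f x) h = r * L2_inner 1 f h"
      using L2_inner_lincomb[of f 1 f h r 0] by (simp add: l2rel_def)
  qed
  show "0 \<le> inner p p" by transfer (rule L2_inner_nonneg)
  show "inner p p = 0 \<longleftrightarrow> p = 0"
    by transfer (simp add: l2rel_def L2_inner_eq_0_iff L2_const)
qed

end

lemma inner_abs_l2: "f \<in> L2_space 1 \<Longrightarrow> g \<in> L2_space 1 \<Longrightarrow> inner (abs_l2 f) (abs_l2 g) = L2_inner 1 f g"
  by (rule inner_l2.abs_eq) (auto simp: l2rel_def)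

lemma lincomb_abs_l2:
  assumes "f \<in> L2_space 1" "g \<in> L2_space 1"
  shows "abs_l2 (\<lambda>x. r * f x + s * g x) = r *\<^sub>R abs_l2 f + s *\<^sub>R abs_l2 g"
proof -
  have "abs_l2 (\<lambda>x. r * f x) = r *\<^sub>R abs_l2 f" "abs_l2 (\<lambda>x. s * g x) = s *\<^sub>R abs_l2 g"
    using assms by (auto intro!: scaleR_l2.abs_eq[symmetric] simp: l2rel_def)
  moreover have "abs_l2 (\<lambda>x. r * f x + s * g x) = abs_l2 (\<lambda>x. r * f x) + abs_l2 (\<lambda>x. s * g x)"
    using assms by (intro plus_l2.abs_eq[symmetric]) (auto simp: l2rel_def L2_scale)
  ultimately show ?thesis by simp
qed

lemma LINT_square_eq_norm: "(LINT x|intv 1. (rep_l2 p x - rep_l2 q x)\<^sup>2) = (norm (p - q))\<^sup>2"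
proof -
  have "abs_l2 (\<lambda>x. rep_l2 p x - rep_l2 q x) = p - q"
    using lincomb_abs_l2[OF rep_l2 rep_l2, of 1 p "-1" q] by (simp add: abs_rep_l2)
  then have "(norm (p - q))\<^sup>2 = L2_inner 1 (\<lambda>x. rep_l2 p x - rep_l2 q x) (\<lambda>x. rep_l2 p x - rep_l2 q x)"
    using inner_abs_l2[OF L2_diff[OF rep_l2 rep_l2] L2_diff[OF rep_l2 rep_l2], of p q p q]
    by (simp add: power2_norm_eq_inner)
  then show ?thesis by (simp add: L2_inner_def power2_eq_square)
qed

text \<open>Riesz-Fischer for rapidly converging sequences: the increments are summable in L^1,
  which gives a pointwise limit almost everywhere, and Fatou's lemma shows that it is square
  integrable and approached at the same rate.\<close>

lemma L2_complete:
  fixes X :: "nat \<Rightarrow> l2"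
  assumes X: "\<And>n m. n \<le> m \<Longrightarrow> norm (X n - X m) \<le> (1 / 4) ^ n"
  shows "\<exists>p. X \<longlonglongrightarrow> p"
proof -
  define f where "f n = rep_l2 (X n)" for n
  have f2: "f n \<in> L2_space 1" for n by (simp add: f_def rep_l2)
  have sq: "(LINT x|intv 1. (f n x - f m x)\<^sup>2) \<le> ((1 / 4) ^ n)\<^sup>2" if "n \<le> m" for n m
    unfolding f_def LINT_square_eq_norm using X[OF that] by (intro power_mono) auto
  have int1: "integrable (intv 1) (\<lambda>x. (f n x - f m x)\<^sup>2)" for n m
    by (intro L2_integrable_square L2_diff f2)
  have nn: "(\<integral>\<^sup>+x. ennreal \<bar>f (Suc n) x - f n x\<bar> \<partial>intv 1) \<le> ennreal (2 * (1 / 4) ^ n)" for n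
  proof -
    define d where "d = (1 / 4 :: real) ^ n"
    have d: "d > 0" by (simp add: d_def)
    have i: "integrable (intv 1) (\<lambda>x. \<bar>f (Suc n) x - f n x\<bar>)"
      by (intro Bochner_Integration.integrable_abs L2_integrable L2_diff f2)
    have i2: "integrable (intv 1) (\<lambda>x. d + (f n x - f (Suc n) x)\<^sup>2 / d)"
      using int1 finite_measure.integrable_const[OF finite_measure_intv] by (intro Bochner_Integration.integrable_add) auto
    have "(LINT x|intv 1. \<bar>f (Suc n) x - f n x\<bar>) \<le> (LINT x|intv 1. d + (f n x - f (Suc n) x)\<^sup>2 / d)"
    proof (rule integral_mono[OF i i2])
      show "\<bar>f (Suc n) x - f n x\<bar> \<le> d + (f n x - f (Suc n) x)\<^sup>2 / d" for x
        using abs_le_add_square_div[OF d, of "f n x - f (Suc n) x"] by (simp add: abs_minus_commute)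
    qed
    also have "\<dots> = d + (LINT x|intv 1. (f n x - f (Suc n) x)\<^sup>2) / d"
      using int1 finite_measure.integrable_const[OF finite_measure_intv]
      by (subst Bochner_Integration.integral_add) (auto simp: measure_restrict_space)
    also have "\<dots> \<le> d + d\<^sup>2 / d" using sq[of n "Suc n"] d by (intro add_left_mono divide_right_mono) (auto simp: d_def)
    also have "\<dots> = 2 * d" using d by (simp add: power2_eq_square)
    finally show ?thesis by (simp add: nn_integral_eq_integral[OF i] d_def ennreal_leI)
  qed
  have "AE x in intv 1. summable (\<lambda>n. \<bar>f (Suc n) x - f n x\<bar>)"
  proof (rule AE_summable_if_summable_nn_integral[OF _ _ nn])
    show "(\<lambda>x. \<bar>f (Suc n) x - f n x\<bar>) \<in> borel_measurable (intv 1)" for n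
      by (intro borel_measurable_abs L2_measurable L2_diff f2)
  qed (auto intro!: summable_mult summable_geometric)
  then have conv: "AE x in intv 1. (\<lambda>n. f n x) \<longlonglongrightarrow> lim (\<lambda>n. f n x)"
  proof eventually_elim
    case (elim x)
    then have "summable (\<lambda>n. f (Suc n) x - f n x)" by (rule summable_rabs_cancel)
    then have "convergent (\<lambda>n. \<Sum>i<n. f (Suc i) x - f i x)" by (simp add: summable_iff_convergent)
    then have "convergent (\<lambda>n. f n x - f 0 x)" using sum_lessThan_telescope[of "\<lambda>n. f n x"] by simp
    then have "convergent (\<lambda>n. (f n x - f 0 x) + f 0 x)" by (intro convergent_add convergent_const)
    then show ?case by (simp add: convergent_LIMSEQ_iff)
  qed
  define g where "g x = lim (\<lambda>n. f n x)" for x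
  have gm: "g \<in> borel_measurable (intv 1)"
    unfolding g_def by (intro borel_measurable_lim_metric L2_measurable f2)
  have lim2: "integrable (intv 1) (\<lambda>x. (f n x - g x)\<^sup>2) \<and> (LINT x|intv 1. (f n x - g x)\<^sup>2) \<le> ((1 / 4) ^ n)\<^sup>2" for n
  proof -
    have lim: "AE x in intv 1. (\<lambda>m. (f n x - f (n + m) x)\<^sup>2) \<longlonglongrightarrow> (f n x - g x)\<^sup>2"
      using conv
    proof eventually_elim
      case (elim x)
      then have "(\<lambda>m. f (m + n) x) \<longlonglongrightarrow> g x" unfolding g_def by (rule LIMSEQ_ignore_initial_segment)
      then show ?case by (intro tendsto_intros) (simp add: add.commute)
    qed
    have m: "(\<lambda>x. (f n x - f (n + m) x)\<^sup>2) \<in> borel_measurable (intv 1)" for m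
      using int1 by blast
    have b: "(\<integral>\<^sup>+x. ennreal ((f n x - f (n + m) x)\<^sup>2) \<partial>intv 1) \<le> ennreal (((1 / 4) ^ n)\<^sup>2)" for m
      unfolding nn_integral_eq_integral[OF int1 AE_I2[OF zero_le_power2]] by (intro ennreal_leI sq) simp
    show ?thesis
      using integrable_limit_lebesgue_on[OF _ m lim _ _ b] by simp
  qed
  have "(\<lambda>x. f 0 x - g x) \<in> L2_space 1"
    using lim2[of 0] borel_measurable_diff[OF L2_measurable[OF f2] gm] by (simp add: L2_space_def)
  from L2_diff[OF f2[of 0] this] have "(\<lambda>x. f 0 x - (f 0 x - g x)) \<in> L2_space 1" .
  then have g2: "g \<in> L2_space 1" by simp
  have "norm (X n - abs_l2 g) \<le> (1 / 4) ^ n" for n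
  proof (rule power2_le_imp_le)
    have "abs_l2 (\<lambda>x. f n x - g x) = X n - abs_l2 g"
      using lincomb_abs_l2[OF f2 g2, of 1 n "-1"] by (simp add: f_def abs_rep_l2)
    then have "(norm (X n - abs_l2 g))\<^sup>2 = L2_inner 1 (\<lambda>x. f n x - g x) (\<lambda>x. f n x - g x)"
      using inner_abs_l2[OF L2_diff[OF f2 g2] L2_diff[OF f2 g2], of n n] by (simp add: power2_norm_eq_inner)
    then show "(norm (X n - abs_l2 g))\<^sup>2 \<le> ((1 / 4) ^ n)\<^sup>2"
      using lim2[of n] by (simp add: L2_inner_def power2_eq_square)
  qed simp
  then have "\<forall>n. norm (X n - abs_l2 g) \<le> (1 / 4) ^ n" by blast
  moreover have "(\<lambda>n. (1 / 4 :: real) ^ n) \<longlonglongrightarrow> 0" by (rule LIMSEQ_realpow_zero) auto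
  ultimately have "(\<lambda>n. X n - abs_l2 g) \<longlonglongrightarrow> 0" by (rule Lim_null_comparison[OF always_eventually])
  then have "X \<longlonglongrightarrow> abs_l2 g" by (rule LIM_zero_cancel)
  then show ?thesis by blast
qed

instance l2 :: banach
proof
  fix X :: "nat \<Rightarrow> l2" assume C: "Cauchy X"
  have "\<exists>N. \<forall>m\<ge>N. \<forall>n\<ge>N. norm (X m - X n) < (1 / 4) ^ k" for k :: nat
    using CauchyD[OF C, of "(1 / 4) ^ k"] by simp
  then obtain N where N: "\<And>k m n. m \<ge> N k \<Longrightarrow> n \<ge> N k \<Longrightarrow> norm (X m - X n) < (1 / 4) ^ k" by metis
  \<comment> \<open>The summand k makes r strictly increasing, and the sum makes it dominate every N
    k.\<close>
  define r where "r k = k + (\<Sum>i\<le>k. N i)" for k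
  have mono: "strict_mono r" by (rule strict_monoI_Suc) (simp add: r_def)
  have rN: "N k \<le> r k" for k using member_le_sum[of k "{..k}" N] by (simp add: r_def)
  have "norm ((X \<circ> r) n - (X \<circ> r) m) \<le> (1 / 4) ^ n" if "n \<le> m" for n m
    using N[of n "r n" "r m"] rN[of n] strict_mono_leD[OF mono that] by (simp add: less_imp_le)
  then obtain p where "(X \<circ> r) \<longlonglongrightarrow> p" using L2_complete by blast
  then have "X \<longlonglongrightarrow> p" using C mono Cauchy_converges_subseq by blast
  then show "convergent X" by (auto simp: convergent_def)
qed

section \<open>Integration and multiplication operators on an interval\<close>

text \<open>The gauge integral gives direct access to the fundamental theorem of calculus;
  \<open>L2_integrable_on\<close> identifies it with the Lebesgue integral.\<close>

definition prm :: "(real \<Rightarrow> real) \<Rightarrow> real \<Rightarrow> real" where "prm f x = integral {0..x} f"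

lemma L2_integrable_on:
  assumes f: "f \<in> L2_space L" and x: "x \<le> L"
  shows "f integrable_on {0..x}" "f absolutely_integrable_on {0..x}" "(LINT s|intv x. f s) = prm f x"
proof -
  have "integrable (intv L) f" using f by (rule L2_integrable)
  then have i: "integrable (intv x) f" by (rule integrable_subset_lebesgue_on) (use x in auto)
  then have "f absolutely_integrable_on {0<..<x}" by (simp add: set_integrable_def integrable_restrict_space)
  then show a: "f absolutely_integrable_on {0..x}"
    by (simp add: absolutely_integrable_on_Icc_iff_Ioo)
  then show "f integrable_on {0..x}" by (rule set_lebesgue_integral_eq_integral(1))
  have "(LINT s|intv x. f s) = integral {0<..<x} f" by (rule lebesgue_integral_eq_integral[OF i]) simp
  then show "(LINT s|intv x. f s) = prm f x" by (simp add: prm_def integral_open_interval_real)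
qed

lemma indicator_L2: "A \<in> sets lebesgue \<Longrightarrow> (\<lambda>s. indicator A s) \<in> L2_space K"
  by (rule L2_bounded[of _ _ 1]) (auto simp: indicator_def intro: measurable_restrict_space1)

lemma prm_0: "prm f 0 = 0"
  by (simp add: prm_def)

lemma prm_continuous: "f \<in> L2_space L \<Longrightarrow> continuous_on {0..L} (prm f)"
  unfolding prm_def[abs_def] using L2_integrable_on(1)[of f L] by (intro indefinite_integral_continuous_1) simp

lemma continuous_L2:
  assumes "continuous_on {0..L} f"
  shows "f \<in> L2_space L"
proof -
  have "bounded (f ` {0..L})" using assms compact_Icc compact_continuous_image compact_imp_bounded by blast
  then obtain B where B: "\<forall>x\<in>{0..L}. \<bar>f x\<bar> \<le> B" by (auto simp: bounded_iff)
  have "f \<in> borel_measurable (intv L)"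
    by (rule continuous_imp_measurable_on_sets_lebesgue[OF continuous_on_subset[OF assms]]) auto
  then show ?thesis using B by (intro L2_bounded[of _ _ B]) auto
qed

lemma prm_L2: "f \<in> L2_space L \<Longrightarrow> prm f \<in> L2_space L"
  using continuous_L2 prm_continuous by blast

text \<open>The factor \<open>sqrt L\<close> compensates the change of variables, so that the
  embedding is isometric.\<close>

definition emb :: "real \<Rightarrow> (real \<Rightarrow> real) \<Rightarrow> l2" where
  "emb L f = abs_l2 (\<lambda>y. sqrt L * f (L * y))"

definition rep :: "real \<Rightarrow> l2 \<Rightarrow> real \<Rightarrow> real" where
  "rep L p = (\<lambda>x. rep_l2 p (x / L) / sqrt L)"

lemma intv_rescale:
  fixes f :: "real \<Rightarrow> real"
  assumes L: "L > 0"
  shows "f \<in> borel_measurable (intv L) \<Longrightarrow> (\<lambda>y. f (L * y)) \<in> borel_measurable (intv 1)"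
    and "integrable (intv L) f \<longleftrightarrow> integrable (intv 1) (\<lambda>y. f (L * y))"
    and "(LINT x|intv L. f x) = L * (LINT y|intv 1. f (L * y))"
proof -
  have ind: "indicator {0<..<L} (0 + L * y) = (indicator {0<..<1} y :: real)" for y
    using L by (auto simp: indicator_def mult_less_cancel_left1 zero_less_mult_iff)
  have T: "(\<lambda>y. L * y) \<in> lebesgue \<rightarrow>\<^sub>M lebesgue"
    using lebesgue_affine_measurable[where c = "\<lambda>x::real. L" and t = 0] L by simp
  show "(\<lambda>y. f (L * y)) \<in> borel_measurable (intv 1)" if "f \<in> borel_measurable (intv L)"
  proof -
    have "(\<lambda>x. indicator {0<..<L} x *\<^sub>R f x) \<in> borel_measurable lebesgue"
      using that by (subst (asm) borel_measurable_restrict_space_iff) auto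
    from measurable_compose[OF T this]
    have "(\<lambda>y. indicator {0<..<1} y *\<^sub>R f (L * y)) \<in> borel_measurable lebesgue"
      using ind by simp
    then show ?thesis by (subst borel_measurable_restrict_space_iff) auto
  qed
  show "integrable (intv L) f \<longleftrightarrow> integrable (intv 1) (\<lambda>y. f (L * y))"
    using lebesgue_integrable_real_affine_iff[of L "\<lambda>x. indicator {0<..<L} x *\<^sub>R f x" 0] L ind
    by (simp add: integrable_restrict_space)
  show "(LINT x|intv L. f x) = L * (LINT y|intv 1. f (L * y))"
    using lebesgue_integral_real_affine[of L "\<lambda>x. indicator {0<..<L} x *\<^sub>R f x" 0] L ind
    by (simp add: integral_restrict_space)
qed

context
  fixes L :: real assumes L: "L > 0"
begin

lemma L2_rescale: "f \<in> L2_space L \<Longrightarrow> (\<lambda>y. sqrt L * f (L * y)) \<in> L2_space 1"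
  using intv_rescale[OF L] by (intro L2_scale) (auto simp: L2_space_def)

lemma rep_L2: "rep L p \<in> L2_space L"
proof -
  have m: "rep L p \<in> borel_measurable (intv L)"
  proof -
    have ind: "indicator {0<..<1} (0 + (1 / L) * y) = (indicator {0<..<L} y :: real)" for y
      using L by (auto simp: indicator_def field_simps)
    have T: "(\<lambda>y. (1 / L) * y) \<in> lebesgue \<rightarrow>\<^sub>M lebesgue"
      using lebesgue_affine_measurable[where c = "\<lambda>x::real. 1 / L" and t = 0] L by simp
    have "(\<lambda>x. indicator {0<..<1} x *\<^sub>R rep_l2 p x) \<in> borel_measurable lebesgue"
      using L2_measurable[OF rep_l2] by (subst (asm) borel_measurable_restrict_space_iff) auto
    from measurable_compose[OF T this]
    have "(\<lambda>y. indicator {0<..<L} y *\<^sub>R rep_l2 p (y / L)) \<in> borel_measurable lebesgue"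
      using ind by simp
    then have "(\<lambda>y. rep_l2 p (y / L)) \<in> borel_measurable (intv L)"
      by (subst borel_measurable_restrict_space_iff) auto
    then show ?thesis unfolding rep_def by measurable
  qed
  moreover have "integrable (intv L) (\<lambda>x. (rep L p x)\<^sup>2)"
    unfolding intv_rescale(2)[OF L] using L L2_integrable_square[OF rep_l2, of p]
    by (simp add: rep_def power_divide)
  ultimately show ?thesis by (simp add: L2_space_def)
qed

lemma emb_rep: "emb L (rep L p) = p"
  using L by (simp add: emb_def rep_def abs_rep_l2)

lemma inner_emb: "f \<in> L2_space L \<Longrightarrow> g \<in> L2_space L \<Longrightarrow> inner (emb L f) (emb L g) = L2_inner L f g"
proof -
  assume "f \<in> L2_space L" "g \<in> L2_space L"
  then have "inner (emb L f) (emb L g) = L2_inner 1 (\<lambda>y. sqrt L * f (L * y)) (\<lambda>y. sqrt L * g (L * y))"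
    unfolding emb_def by (intro inner_abs_l2 L2_rescale)
  also have "\<dots> = (LINT y|intv 1. L * (f (L * y) * g (L * y)))"
    using L unfolding L2_inner_def by (intro arg_cong[where f = "integral\<^sup>L _"]) (simp add: fun_eq_iff mult.assoc mult.left_commute real_sqrt_mult_self)
  also have "\<dots> = L2_inner L f g"
    unfolding L2_inner_def by (simp add: intv_rescale(3)[OF L])
  finally show ?thesis .
qed

lemma emb_lincomb: "f \<in> L2_space L \<Longrightarrow> g \<in> L2_space L \<Longrightarrow>
    emb L (\<lambda>x. r * f x + s * g x) = r *\<^sub>R emb L f + s *\<^sub>R emb L g"
  unfolding emb_def using lincomb_abs_l2[OF L2_rescale L2_rescale, of f g r s]
  by (simp add: algebra_simps)

lemma emb_diff: "f \<in> L2_space L \<Longrightarrow> g \<in> L2_space L \<Longrightarrow> emb L (\<lambda>x. f x - g x) = emb L f - emb L g"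
  using emb_lincomb[of f g 1 "-1"] by simp

lemma emb_add: "f \<in> L2_space L \<Longrightarrow> g \<in> L2_space L \<Longrightarrow> emb L (\<lambda>x. f x + g x) = emb L f + emb L g"
  using emb_lincomb[of f g 1 1] by simp

lemma emb_scale: "f \<in> L2_space L \<Longrightarrow> emb L (\<lambda>x. r * f x) = r *\<^sub>R emb L f"
  using emb_lincomb[of f f r 0] by simp

lemma norm_emb: "f \<in> L2_space L \<Longrightarrow> norm (emb L f) = L2_norm L f"
  by (simp add: norm_eq_sqrt_inner inner_emb L2_norm_def)

lemma emb_eq_iff: "f \<in> L2_space L \<Longrightarrow> g \<in> L2_space L \<Longrightarrow> emb L f = emb L g \<longleftrightarrow> (AE x in intv L. f x = g x)"
proof -
  assume fg: "f \<in> L2_space L" "g \<in> L2_space L"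
  have "emb L f = emb L g \<longleftrightarrow> inner (emb L f - emb L g) (emb L f - emb L g) = 0" by simp
  also have "\<dots> \<longleftrightarrow> L2_inner L (\<lambda>x. f x - g x) (\<lambda>x. f x - g x) = 0"
    using fg by (simp add: emb_diff[symmetric] inner_emb L2_diff)
  also have "\<dots> \<longleftrightarrow> (AE x in intv L. f x = g x)" using fg by (simp add: L2_inner_eq_0_iff L2_diff)
  finally show ?thesis .
qed

lemma rep_emb: "f \<in> L2_space L \<Longrightarrow> AE x in intv L. rep L (emb L f) x = f x"
  using emb_eq_iff[OF rep_L2, of f "emb L f"] by (simp add: emb_rep)

text \<open>With integration up to x written as an inner product, linearity, boundedness and
  independence of the representative become facts about inner products.\<close>

lemma prm_eq_inner:
  assumes f: "f \<in> L2_space L" and x: "x \<le> L"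
  shows "prm f x = inner (emb L f) (emb L (indicator {0<..<x}))"
proof -
  have "inner (emb L f) (emb L (indicator {0<..<x})) = L2_inner L f (indicator {0<..<x})"
    using f by (intro inner_emb indicator_L2) auto
  also have "\<dots> = (LINT s|lebesgue. indicator {0<..<L} s * (f s * indicator {0<..<x} s))"
    by (simp add: L2_inner_def integral_restrict_space)
  also have "\<dots> = (LINT s|lebesgue. indicator {0<..<x} s * f s)"
    using x by (intro arg_cong[where f = "integral\<^sup>L _"]) (auto simp: fun_eq_iff indicator_def)
  also have "\<dots> = (LINT s|intv x. f s)" by (simp add: integral_restrict_space)
  also have "\<dots> = prm f x" by (rule L2_integrable_on(3)[OF f x])
  finally show ?thesis by simp
qed

lemma norm_emb_le:
  assumes "f \<in> L2_space L" "\<And>x. x \<in> {0<..<L} \<Longrightarrow> \<bar>f x\<bar> \<le> B" "B \<ge> 0"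
  shows "norm (emb L f) \<le> sqrt L * B"
proof (rule power2_le_imp_le)
  have "(norm (emb L f))\<^sup>2 = (LINT x|intv L. (f x)\<^sup>2)"
    unfolding power2_norm_eq_inner inner_emb[OF assms(1) assms(1)] L2_inner_def by (simp add: power2_eq_square)
  also have "\<dots> \<le> (LINT x|intv L. B\<^sup>2)"
    using assms
    by (intro integral_mono L2_integrable_square) (auto simp: space_restrict_space L2_const intro: power2_le_if_abs_le)
  also have "\<dots> = (sqrt L * B)\<^sup>2" using L by (simp add: measure_restrict_space power_mult_distrib)
  finally show "(norm (emb L f))\<^sup>2 \<le> (sqrt L * B)\<^sup>2" .
qed (use L assms in auto)

lemma prm_bound:
  assumes f: "f \<in> L2_space L" and x: "x \<le> L"
  shows "\<bar>prm f x\<bar> \<le> sqrt L * norm (emb L f)"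
proof -
  have "norm (emb L (indicator {0<..<x})) \<le> sqrt L * 1"
    by (rule norm_emb_le[OF indicator_L2]) (auto simp: indicator_def)
  then have "norm (emb L f) * norm (emb L (indicator {0<..<x})) \<le> norm (emb L f) * sqrt L"
    by (intro mult_left_mono) auto
  then show ?thesis
    unfolding prm_eq_inner[OF assms] using Cauchy_Schwarz_ineq2[of "emb L f" "emb L (indicator {0<..<x})"]
    by (simp add: mult.commute)
qed

lemma prm_cong: "f \<in> L2_space L \<Longrightarrow> g \<in> L2_space L \<Longrightarrow> emb L f = emb L g \<Longrightarrow> x \<le> L \<Longrightarrow> prm f x = prm g x"
  by (simp add: prm_eq_inner)

lemma prm_lincomb: "f \<in> L2_space L \<Longrightarrow> g \<in> L2_space L \<Longrightarrow> x \<le> L \<Longrightarrow>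
    prm (\<lambda>x. r * f x + s * g x) x = r * prm f x + s * prm g x"
  by (simp add: prm_eq_inner L2_lincomb emb_lincomb inner_add_left)

lemma inner_emb_one: "f \<in> L2_space L \<Longrightarrow> inner (emb L f) (emb L (\<lambda>x. 1)) = prm f L"
  by (simp add: inner_emb L2_const L2_inner_def L2_integrable_on(3))

lemma emb_eq_on: "(\<And>x. x \<in> {0<..<L} \<Longrightarrow> f x = g x) \<Longrightarrow> f \<in> L2_space L \<Longrightarrow> g \<in> L2_space L \<Longrightarrow> emb L f = emb L g"
  by (subst emb_eq_iff) (auto intro!: AE_I2 simp: space_restrict_space)

text \<open>The positive and negative parts p and n of a Borel version of f are densities of finite
  measures that agree on all half-lines, hence are equal; so the densities agree almost
  everywhere.\<close>

lemma prm_zero_imp_zero: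
  assumes f: "f \<in> L2_space L" and z: "\<And>x. x \<in> {0..L} \<Longrightarrow> prm f x = 0"
  shows "emb L f = 0"
proof -
  define F where "F x = indicator {0<..<L} x * f x" for x
  have Fi: "integrable lebesgue F"
    using L2_integrable[OF f] unfolding F_def by (simp add: integrable_restrict_space)
  obtain h where h: "h \<in> borel_measurable lborel" and Fh: "AE x in lborel. F x = h x"
    using completion_ex_borel_measurable_real[of F lborel] Fi by auto
  have Fh': "AE x in lebesgue. F x = h x" using Fh by (rule AE_completion)
  have hi': "integrable lebesgue h"
    by (rule integrable_cong_AE_imp[OF Fi _ Fh']) (use h in \<open>auto intro: measurable_completion\<close>)
  then have hi: "integrable lborel h" using h by (simp add: integrable_completion)
  have tail: "(LINT t|lborel. h t * indicator {x<..} t) = 0" for x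
  proof -
    \<comment> \<open>The point x moved into [0,L]: the integral of F beyond x is
      \<open>prm f L - prm f y\<close>.\<close>
    define y where "y = max 0 (min L x)"
    have y: "y \<in> {0..L}" "y \<le> L" using L by (auto simp: y_def)
    have i2: "integrable (intv L) (\<lambda>t. f t * indicator {0<..<y} t)"
      by (intro L2_mult_integrable f indicator_L2) auto
    have "(LINT t|lborel. h t * indicator {x<..} t) = (LINT t|lebesgue. h t * indicator {x<..} t)"
      using h by (intro integral_completion[symmetric]) auto
    also have "\<dots> = (LINT t|lebesgue. F t * indicator {x<..} t)"
    proof (rule integral_cong_AE)
      show "AE t in lebesgue. h t * indicator {x<..} t = F t * indicator {x<..} t"
        using Fh' by eventually_elim simp
    qed (intro borel_measurable_times borel_measurable_integrable[OF hi'] borel_measurable_integrable[OF Fi]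
        borel_measurable_indicator; auto)+
    also have "\<dots> = (LINT t|intv L. f t * indicator {x<..} t)"
      by (simp add: integral_restrict_space F_def mult.assoc)
    also have "\<dots> = (LINT t|intv L. f t - f t * indicator {0<..<y} t)"
    proof (rule integral_cong_AE)
      have "AE t in lebesgue. t \<noteq> x" using AE_lborel_singleton[of x] by (rule AE_completion)
      then have "AE t in intv L. t \<noteq> x" by (auto simp: AE_restrict_space_iff elim!: eventually_mono)
      then show "AE t in intv L. f t * indicator {x<..} t = f t - f t * indicator {0<..<y} t"
        using AE_space by eventually_elim (auto simp: space_restrict_space y_def indicator_def)
      show "(\<lambda>t. f t * indicator {x<..} t) \<in> borel_measurable (intv L)"
        by (intro borel_measurable_times L2_measurable f indicator_L2) auto
      show "(\<lambda>t. f t - f t * indicator {0<..<y} t) \<in> borel_measurable (intv L)"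
        by (intro borel_measurable_diff borel_measurable_times L2_measurable f indicator_L2) auto
    qed
    also have "\<dots> = (LINT t|intv L. f t) - L2_inner L f (indicator {0<..<y})"
      unfolding L2_inner_def by (rule Bochner_Integration.integral_diff[OF L2_integrable[OF f] i2])
    also have "\<dots> = prm f L - prm f y"
      using f y by (simp add: L2_integrable_on(3) prm_eq_inner inner_emb indicator_L2)
    also have "\<dots> = 0" using z y L by simp
    finally show ?thesis .
  qed
  define p n where "p t = max (h t) 0" and "n t = max (- h t) 0" for t
  have pn: "integrable lborel p" "integrable lborel n" "\<And>t. p t \<ge> 0" "\<And>t. n t \<ge> 0" "\<And>t. h t = p t - n t"
    using hi by (auto simp: p_def[abs_def] n_def[abs_def] intro!: Bochner_Integration.integrable_max)
  have em: "emeasure (density lborel (\<lambda>t. ennreal (q t))) {x<..} = ennreal (LINT t|lborel. q t * indicator {x<..} t)"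
    if q: "integrable lborel q" "\<And>t. q t \<ge> 0" for q :: "real \<Rightarrow> real" and x
  proof -
    have "emeasure (density lborel (\<lambda>t. ennreal (q t))) {x<..} = (\<integral>\<^sup>+t. ennreal (q t) * indicator {x<..} t \<partial>lborel)"
      using q by (intro emeasure_density) auto
    also have "\<dots> = (\<integral>\<^sup>+t. ennreal (q t * indicator {x<..} t) \<partial>lborel)"
      by (intro nn_integral_cong) (simp add: indicator_def)
    also have "\<dots> = ennreal (LINT t|lborel. q t * indicator {x<..} t)"
      using q integrable_mult_indicator[of "{x<..}" lborel q] by (intro nn_integral_eq_integral) (auto simp: mult.commute)
    finally show ?thesis .
  qed
  have "density lborel (\<lambda>t. ennreal (p t)) = density lborel (\<lambda>t. ennreal (n t))"
  proof (rule measure_eqI_lessThan)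
    fix x
    have ip: "integrable lborel (\<lambda>t. p t * indicator {x<..} t)" "integrable lborel (\<lambda>t. n t * indicator {x<..} t)"
      using integrable_mult_indicator[of "{x<..}" lborel p] integrable_mult_indicator[of "{x<..}" lborel n] pn
      by (simp_all add: mult.commute)
    have "(LINT t|lborel. p t * indicator {x<..} t) - (LINT t|lborel. n t * indicator {x<..} t)
      = (LINT t|lborel. h t * indicator {x<..} t)"
      unfolding Bochner_Integration.integral_diff[OF ip, symmetric] by (simp add: pn(5) algebra_simps)
    then show "emeasure (density lborel (\<lambda>t. ennreal (p t))) {x<..} = emeasure (density lborel (\<lambda>t. ennreal (n t))) {x<..}"
      using pn tail[of x] by (simp add: em)
    show "emeasure (density lborel (\<lambda>t. ennreal (p t))) {x<..} < \<infinity>" using pn by (simp add: em)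
  qed auto
  then have "AE t in lborel. ennreal (p t) = ennreal (n t)"
    using pn by (intro sigma_finite_measure.density_unique[OF sigma_finite_lborel]) auto
  then have "AE t in lborel. h t = 0"
    by eventually_elim (use pn in \<open>metis diff_self ennreal_inj\<close>)
  then have "AE t in lebesgue. h t = 0" by (rule AE_completion)
  then have "AE t in lebesgue. F t = 0" using Fh' by eventually_elim simp
  then have "AE t in intv L. f t = 0"
    by (auto simp: AE_restrict_space_iff F_def indicator_def elim!: eventually_mono)
  then have "emb L f = emb L (\<lambda>x. 0)" using f by (simp add: emb_eq_iff L2_const)
  also have "\<dots> = 0" using emb_scale[OF f, of 0] by simp
  finally show ?thesis .
qed

end

section \<open>Test functions\<close>

definition smooth :: "(real \<Rightarrow> real) \<Rightarrow> bool" where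
  "smooth \<phi> \<longleftrightarrow> (\<forall>n x. ((deriv ^^ n) \<phi>) differentiable (at x))"

lemma deriv_funpow_eq:
  fixes F :: "nat \<Rightarrow> real \<Rightarrow> real"
  assumes "\<And>n x. (F n has_real_derivative F (Suc n) x) (at x)"
  shows "(deriv ^^ n) (F 0) = F n"
proof (induction n)
  case (Suc n)
  have "deriv (F n) = F (Suc n)" using assms DERIV_imp_deriv by blast
  then show ?case using Suc by simp
qed simp

lemma smooth_iff: "smooth \<phi> \<longleftrightarrow> (\<exists>F. F 0 = \<phi> \<and> (\<forall>n x. (F n has_real_derivative F (Suc n) x) (at x)))"
proof
  assume s: "smooth \<phi>"
  show "\<exists>F. F 0 = \<phi> \<and> (\<forall>n x. (F n has_real_derivative F (Suc n) x) (at x))"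
    using s unfolding smooth_def
    by (intro exI[of _ "\<lambda>n. (deriv ^^ n) \<phi>"]) (auto simp: DERIV_deriv_iff_real_differentiable)
next
  assume "\<exists>F. F 0 = \<phi> \<and> (\<forall>n x. (F n has_real_derivative F (Suc n) x) (at x))"
  then obtain F where F: "F 0 = \<phi>" "\<And>n x. (F n has_real_derivative F (Suc n) x) (at x)" by blast
  have "(deriv ^^ n) \<phi> = F n" for n using deriv_funpow_eq[of F n] F by simp
  then show "smooth \<phi>" using F(2) by (auto simp: smooth_def real_differentiable_def)
qed

lemma smooth_DERIV: "smooth \<phi> \<Longrightarrow> ((deriv ^^ n) \<phi> has_real_derivative (deriv ^^ Suc n) \<phi> x) (at x)"
  by (simp add: smooth_def DERIV_deriv_iff_real_differentiable)

text \<open>A choice of derivative inside C is iterated. To prove smoothness it thus suffices to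
  exhibit a class closed under differentiation.\<close>

lemma smooth_if_closed:
  assumes C: "\<And>f. f \<in> C \<Longrightarrow> \<exists>f'\<in>C. \<forall>x. (f has_real_derivative f' x) (at x)" and "\<phi> \<in> C"
  shows "smooth \<phi>"
proof -
  obtain D where D: "\<And>f. f \<in> C \<Longrightarrow> D f \<in> C \<and> (\<forall>x. (f has_real_derivative D f x) (at x))"
    using C by metis
  have "(D ^^ n) \<phi> \<in> C" for n by (induction n) (use D \<open>\<phi> \<in> C\<close> in auto)
  then show ?thesis unfolding smooth_iff using D by (intro exI[of _ "\<lambda>n. (D ^^ n) \<phi>"]) auto
qed

lemma smooth_lincomb:
  assumes "smooth \<phi>" "smooth \<psi>"
  shows "smooth (\<lambda>x. r * \<phi> x + s * \<psi> x)"
  unfolding smooth_iff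
  by (rule exI[of _ "\<lambda>n x. r * (deriv ^^ n) \<phi> x + s * (deriv ^^ n) \<psi> x"])
     (auto intro!: derivative_eq_intros smooth_DERIV[OF assms(1)] smooth_DERIV[OF assms(2)] simp del: funpow.simps simp: funpow_0)

lemma deriv_lincomb:
  assumes "smooth \<phi>" "smooth \<psi>"
  shows "(deriv ^^ n) (\<lambda>x. r * \<phi> x + s * \<psi> x) = (\<lambda>x. r * (deriv ^^ n) \<phi> x + s * (deriv ^^ n) \<psi> x)"
proof -
  have "((\<lambda>x. r * (deriv ^^ n) \<phi> x + s * (deriv ^^ n) \<psi> x) has_real_derivative
      r * (deriv ^^ Suc n) \<phi> x + s * (deriv ^^ Suc n) \<psi> x) (at x)" for n x
    by (auto intro!: derivative_eq_intros smooth_DERIV[OF assms(1)] smooth_DERIV[OF assms(2)] simp del: funpow.simps)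
  from deriv_funpow_eq[of "\<lambda>n x. r * (deriv ^^ n) \<phi> x + s * (deriv ^^ n) \<psi> x" n, OF this]
  show ?thesis by simp
qed

subsection \<open>Bump functions\<close>

text \<open>The polynomial factor is there because exp(-1/x) alone is not reproduced by
  differentiation, whereas this family is.\<close>

definition flat :: "real poly \<Rightarrow> real \<Rightarrow> real" where
  "flat p x = (if x > 0 then poly p (1 / x) * exp (- (1 / x)) else 0)"

lemma poly_times_exp_tendsto_0: "((\<lambda>y. poly p y * exp (- y)) \<longlongrightarrow> 0) at_top" for p :: "real poly"
proof -
  have "((\<lambda>y. \<Sum>i\<le>degree p. coeff p i * (y ^ i / exp y)) \<longlongrightarrow> (\<Sum>i\<le>degree p. coeff p i * 0)) at_top"
    by (intro tendsto_sum tendsto_mult tendsto_const tendsto_power_div_exp_0)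
  then show ?thesis
    by (simp add: poly_altdef exp_minus field_simps sum_distrib_left sum_divide_distrib)
qed

lemma flat_tendsto_0: "(flat p \<longlongrightarrow> 0) (at_right 0)"
proof -
  have "((\<lambda>x. poly p (1 / x) * exp (- (1 / x))) \<longlongrightarrow> 0) (at_right 0)"
    using filterlim_compose[OF poly_times_exp_tendsto_0 filterlim_inverse_at_top_right]
    by (simp add: inverse_eq_divide)
  then show ?thesis
    by (rule Lim_transform_eventually) (auto simp: flat_def eventually_at_filter)
qed

text \<open>For x > 0 the new polynomial is y^2 (p(y) - p'(y)) at y = 1/x. At 0 the right difference
  quotient is itself in the family, for the polynomial y p(y), and therefore tends to 0.\<close>

lemma flat_DERIV: "(flat p has_real_derivative flat ([:0, 0, 1:] * (p - pderiv p)) x) (at x)"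
proof (cases x "0 :: real" rule: linorder_cases)
  case less
  have "(flat p has_real_derivative 0) (at x)"
    by (rule DERIV_cong_ev[THEN iffD1, OF refl _ refl, of "\<lambda>x. 0"])
       (use less eventually_nhds_in_open[of "{..<0}" x] in \<open>auto simp: flat_def elim!: eventually_mono\<close>)
  then show ?thesis using less by (simp add: flat_def)
next
  case greater
  have "((\<lambda>x. poly p (1 / x) * exp (- (1 / x))) has_real_derivative flat ([:0, 0, 1:] * (p - pderiv p)) x) (at x)"
  proof -
    have i: "((\<lambda>x. 1 / x) has_real_derivative - (1 / x\<^sup>2)) (at x)"
      using greater by (auto intro!: derivative_eq_intros simp: power2_eq_square)
    have 1: "((\<lambda>x. poly p (1 / x)) has_real_derivative poly (pderiv p) (1 / x) * (- (1 / x\<^sup>2))) (at x)"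
      by (rule DERIV_chain2[OF poly_DERIV i])
    have 2: "((\<lambda>x. exp (- (1 / x))) has_real_derivative exp (- (1 / x)) * (1 / x\<^sup>2)) (at x)"
      using DERIV_chain2[OF DERIV_exp DERIV_minus[OF i]] by simp
    show ?thesis
      by (rule DERIV_cong[OF DERIV_mult[OF 1 2]])
         (use greater in \<open>simp add: flat_def power2_eq_square algebra_simps\<close>)
  qed
  then show ?thesis
    by (rule DERIV_cong_ev[THEN iffD1, OF refl _ refl, rotated])
       (use greater eventually_nhds_in_open[of "{0<..}" x] in \<open>auto simp: flat_def elim!: eventually_mono\<close>)
next
  case equal
  have "((\<lambda>h. (flat p h - flat p 0) / h) \<longlongrightarrow> 0) (at_right 0)"
    by (rule Lim_transform_eventually[OF flat_tendsto_0[of "[:0, 1:] * p"]])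
       (auto simp: flat_def eventually_at_filter)
  moreover have "((\<lambda>h. (flat p h - flat p 0) / h) \<longlongrightarrow> 0) (at_left 0)"
    by (rule tendsto_eventually) (auto simp: flat_def eventually_at_filter)
  ultimately have "((\<lambda>h. (flat p h - flat p 0) / h) \<longlongrightarrow> 0) (at 0)" by (rule filterlim_split_at[rotated])
  then show ?thesis using equal by (simp add: has_field_derivative_iff flat_def)
qed

text \<open>Closed under differentiation by the chain, sum and product rules, and large enough to
  contain products of two opposite cut-offs.\<close>

inductive_set bumps :: "(real \<Rightarrow> real) set" where
  flat: "(\<lambda>x. flat p (m * x + c)) \<in> bumps"
| add: "f \<in> bumps \<Longrightarrow> g \<in> bumps \<Longrightarrow> (\<lambda>x. f x + g x) \<in> bumps"
| mult: "f \<in> bumps \<Longrightarrow> g \<in> bumps \<Longrightarrow> (\<lambda>x. f x * g x) \<in> bumps"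

lemma bumps_smooth:
  assumes "\<phi> \<in> bumps"
  shows "smooth \<phi>"
proof (rule smooth_if_closed[OF _ assms])
  fix f assume "f \<in> bumps"
  then show "\<exists>f'\<in>bumps. \<forall>x. (f has_real_derivative f' x) (at x)"
  proof induction
    case (flat p m c)
    define q where "q = [:0, 0, 1:] * (p - pderiv p)"
    have "((\<lambda>x. flat p (m * x + c)) has_real_derivative flat (smult m q) (m * x + c)) (at x)" for x
    proof -
      have "((\<lambda>x. flat p (m * x + c)) has_real_derivative flat q (m * x + c) * m) (at x)"
      proof -
        have "((\<lambda>x. m * x + c) has_real_derivative m) (at x)" by (auto intro!: derivative_eq_intros)
        from DERIV_chain2[OF flat_DERIV this, of p] show ?thesis by (simp only: q_def)
      qed
      then show ?thesis by (simp add: flat_def mult_ac split: if_splits)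
    qed
    then show ?case by (intro bexI[of _ "\<lambda>x. flat (smult m q) (m * x + c)"]) (auto intro: bumps.flat)
  next
    case (add f g)
    then obtain f' g' where "f' \<in> bumps" "g' \<in> bumps" "\<And>x. (f has_real_derivative f' x) (at x)"
      "\<And>x. (g has_real_derivative g' x) (at x)" by blast
    then show ?case by (intro bexI[of _ "\<lambda>x. f' x + g' x"]) (auto intro: bumps.add DERIV_add)
  next
    case (mult f g)
    then obtain f' g' where "f' \<in> bumps" "g' \<in> bumps" "\<And>x. (f has_real_derivative f' x) (at x)"
      "\<And>x. (g has_real_derivative g' x) (at x)" by blast
    then show ?case using mult
      by (intro bexI[of _ "\<lambda>x. f' x * g x + g' x * f x"]) (auto intro: bumps.add bumps.mult DERIV_mult)
  qed
qed

text \<open>A smooth function supported in [c,d] with values in [0,1]; as n grows it tends to the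
  indicator of the open interval. The affine arguments are written so as to match
  \<open>bumps.flat\<close>.\<close>

definition bump :: "real \<Rightarrow> real \<Rightarrow> nat \<Rightarrow> real \<Rightarrow> real" where
  "bump c d n x = flat 1 ((real n + 1) * x + (- (real n + 1) * c)) * flat 1 (- (real n + 1) * x + (real n + 1) * d)"

lemma flat_1_bounds: "0 \<le> flat 1 x" "flat 1 x \<le> 1"
  by (auto simp: flat_def)

lemma flat_1_tendsto:
  assumes "x > 0"
  shows "(\<lambda>n. flat 1 ((real n + 1) * x)) \<longlonglongrightarrow> 1"
proof -
  have "(\<lambda>n. exp (- (inverse (real (Suc n)) * (1 / x)))) \<longlonglongrightarrow> exp (- (0 * (1 / x)))"
    by (intro tendsto_intros LIMSEQ_inverse_real_of_nat)
  moreover have "flat 1 ((real n + 1) * x) = exp (- (inverse (real (Suc n)) * (1 / x)))" for n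
    using assms by (simp add: flat_def field_simps add_pos_nonneg)
  ultimately show ?thesis by simp
qed

lemma bump_eq: "bump c d n x = flat 1 ((real n + 1) * (x - c)) * flat 1 ((real n + 1) * (d - x))"
  by (simp add: bump_def algebra_simps)

lemma bump_bounds: "0 \<le> bump c d n x" "bump c d n x \<le> 1"
  using flat_1_bounds mult_mono[of "flat 1 x" 1 "flat 1 y" 1 for x y] by (auto simp: bump_def)

lemma bump_tendsto: "(\<lambda>n. bump c d n x) \<longlonglongrightarrow> indicator {c<..<d} x"
proof (cases "c < x \<and> x < d")
  case True
  then have "(\<lambda>n. bump c d n x) \<longlonglongrightarrow> 1 * 1"
    unfolding bump_eq by (intro tendsto_mult flat_1_tendsto) auto
  then show ?thesis using True by simp
next
  case False
  then have "bump c d n x = 0" for n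
    by (auto simp: bump_eq flat_def zero_less_mult_iff add_nonneg_pos)
  then show ?thesis using False by auto
qed

lemma test_function_bump:
  assumes "0 < c" "d < L"
  shows "test_function L (bump c d n)"
proof -
  have "bump c d n \<in> bumps" unfolding bump_def[abs_def] by (intro bumps.mult bumps.flat)
  then have "smooth (bump c d n)" by (rule bumps_smooth)
  moreover have "bump c d n x = 0" if "x \<notin> {c..d}" for x
    using that by (auto simp: bump_eq flat_def zero_less_mult_iff add_nonneg_pos)
  ultimately show ?thesis
    using assms unfolding test_function_def smooth_def by (auto intro!: exI[of _ "{c..d}"])
qed

subsection \<open>Operations on test functions\<close>

lemma test_function_smooth: "test_function L \<phi> \<Longrightarrow> smooth \<phi>"
  by (simp add: test_function_def smooth_def)

lemma test_function_support:
  assumes "test_function L \<phi>" "L > 0"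
  obtains c d where "0 < c" "c \<le> d" "d < L" "\<And>x. x \<notin> {c..d} \<Longrightarrow> \<phi> x = 0"
proof -
  from assms obtain K where K: "compact K" "K \<subseteq> {0<..<L}" "\<And>x. x \<notin> K \<Longrightarrow> \<phi> x = 0"
    by (auto simp: test_function_def)
  show ?thesis
  proof (cases "K = {}")
    case True then show ?thesis using that[of "L / 2" "L / 2"] K assms by auto
  next
    case False
    obtain c where c: "c \<in> K" "\<And>x. x \<in> K \<Longrightarrow> c \<le> x" using compact_attains_inf[OF K(1) False] by blast
    obtain d where d: "d \<in> K" "\<And>x. x \<in> K \<Longrightarrow> x \<le> d" using compact_attains_sup[OF K(1) False] by blast
    show ?thesis
      by (rule that[of c d]) (use c d K in \<open>auto simp: subset_iff\<close>)
  qed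
qed

lemma test_functionI:
  assumes "smooth \<phi>" "0 < c" "d < L" "\<And>x. x \<notin> {c..d} \<Longrightarrow> \<phi> x = 0"
  shows "test_function L \<phi>"
  using assms unfolding test_function_def smooth_def by (auto intro!: exI[of _ "{c..d}"])

context
  fixes L :: real assumes L: "L > 0"
begin

lemma test_function_boundary: "test_function L \<phi> \<Longrightarrow> \<phi> 0 = 0" "test_function L \<phi> \<Longrightarrow> \<phi> L = 0"
  using L by (auto elim!: test_function_support)

lemma test_function_lincomb:
  assumes "test_function L \<phi>" "test_function L \<psi>"
  shows "test_function L (\<lambda>x. r * \<phi> x + s * \<psi> x)"
proof -
  obtain c d where 1: "0 < c" "c \<le> d" "d < L" "\<And>x. x \<notin> {c..d} \<Longrightarrow> \<phi> x = 0"
    using test_function_support[OF assms(1) L] by metis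
  obtain c' d' where 2: "0 < c'" "c' \<le> d'" "d' < L" "\<And>x. x \<notin> {c'..d'} \<Longrightarrow> \<psi> x = 0"
    using test_function_support[OF assms(2) L] by metis
  show ?thesis
  proof (rule test_functionI[of _ "min c c'" "max d d'"])
    show "smooth (\<lambda>x. r * \<phi> x + s * \<psi> x)"
      by (intro smooth_lincomb test_function_smooth[OF assms(1)] test_function_smooth[OF assms(2)])
    fix x assume "x \<notin> {min c c'..max d d'}"
    then have "x \<notin> {c..d}" "x \<notin> {c'..d'}" by auto
    then show "r * \<phi> x + s * \<psi> x = 0" using 1(4) 2(4) by simp
  qed (use 1 2 in auto)
qed

lemma test_function_deriv:
  assumes "test_function L \<phi>"
  shows "test_function L (deriv \<phi>)"
proof -
  obtain c d where 1: "0 < c" "c \<le> d" "d < L" "\<And>x. x \<notin> {c..d} \<Longrightarrow> \<phi> x = 0"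
    using test_function_support[OF assms L] by metis
  have s: "smooth (deriv \<phi>)"
    using test_function_smooth[OF assms] unfolding smooth_def by (metis funpow_Suc_right o_apply)
  have "deriv \<phi> x = 0" if "x \<notin> {c..d}" for x
  proof (rule DERIV_imp_deriv)
    have "open (- {c..d})" by (intro open_Compl) simp
    then have "\<forall>\<^sub>F y in nhds x. y \<in> - {c..d}" using that by (intro eventually_nhds_in_open) auto
    then have "\<forall>\<^sub>F y in nhds x. 0 = \<phi> y" by eventually_elim (simp add: 1(4))
    then show "(\<phi> has_real_derivative 0) (at x)"
      by (rule DERIV_cong_ev[THEN iffD1, OF refl _ refl]) simp
  qed
  then show ?thesis using s 1 by (intro test_functionI[of _ c d])
qed

lemma test_function_funpow_deriv: "test_function L \<phi> \<Longrightarrow> test_function L ((deriv ^^ n) \<phi>)"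
  by (induction n) (auto intro: test_function_deriv)

lemma test_function_DERIV: "test_function L \<phi> \<Longrightarrow> (\<phi> has_real_derivative deriv \<phi> x) (at x)"
  using smooth_DERIV[OF test_function_smooth, of L \<phi> 0 x] by simp

lemma test_function_continuous: "test_function L \<phi> \<Longrightarrow> continuous_on S \<phi>"
  using test_function_DERIV DERIV_isCont continuous_at_imp_continuous_on by metis

lemma test_function_L2: "test_function L \<phi> \<Longrightarrow> \<phi> \<in> L2_space L"
  by (intro continuous_L2 test_function_continuous)

lemma prm_deriv_test:
  assumes "test_function L \<phi>" "0 \<le> x"
  shows "prm (deriv \<phi>) x = \<phi> x"
proof -
  have "(deriv \<phi> has_integral (\<phi> x - \<phi> 0)) {0..x}"
  proof (rule fundamental_theorem_of_calculus[OF assms(2)])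
    show "(\<phi> has_vector_derivative deriv \<phi> y) (at y within {0..x})" for y
      using has_field_derivative_at_within[OF test_function_DERIV[OF assms(1)]]
      by (simp add: has_real_derivative_iff_has_vector_derivative)
  qed
  then show ?thesis using test_function_boundary[OF assms(1)] by (simp add: prm_def integral_unique)
qed

text \<open>The primitive from 0 vanishes to the left of the support and is constant to the right of
  it, where mean zero makes the constant 0.\<close>

lemma test_function_primitive:
  assumes t: "test_function L \<psi>" and z: "prm \<psi> L = 0"
  shows "\<exists>\<phi>. test_function L \<phi> \<and> deriv \<phi> = \<psi>"
proof -
  obtain c d where 1: "0 < c" "c \<le> d" "d < L" "\<And>x. x \<notin> {c..d} \<Longrightarrow> \<psi> x = 0"
    using test_function_support[OF t L] by metis
  have low: "prm \<psi> x = 0" if "x < c" for x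
    using Henstock_Kurzweil_Integration.integral_cong[of "{0..x}" \<psi> "\<lambda>x. 0"] that 1(4) by (simp add: prm_def)
  have int: "\<psi> integrable_on {x..y}" for x y
    by (intro integrable_continuous_real test_function_continuous t)
  have high: "prm \<psi> x = 0" if "d < x" for x
  proof -
    \<comment> \<open>Used at x and at L: beyond d the primitive keeps its value at d, and at L this
      value is 0.\<close>
    have *: "prm \<psi> x = prm \<psi> d" if "d < x" for x
    proof -
      have "integral {0..d} \<psi> + integral {d..x} \<psi> = integral {0..x} \<psi>"
        using 1 that by (intro Henstock_Kurzweil_Integration.integral_combine int) auto
      moreover have "integral {d..x} \<psi> = integral {d..x} (\<lambda>x. 0)"
        by (rule integral_spike[of "{d}"]) (use 1(4) in auto)
      ultimately show ?thesis by (simp add: prm_def)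
    qed
    show ?thesis using *[OF that] *[OF 1(3)] z by simp
  qed
  have D: "(prm \<psi> has_real_derivative \<psi> x) (at x)" for x
  proof (cases "x < c")
    case True
    have "\<forall>\<^sub>F y in nhds x. y \<in> {..<c}" using True by (intro eventually_nhds_in_open) auto
    then have "\<forall>\<^sub>F y in nhds x. 0 = prm \<psi> y" by eventually_elim (simp add: low)
    then have "(prm \<psi> has_real_derivative 0) (at x)"
      by (rule DERIV_cong_ev[THEN iffD1, OF refl _ refl]) simp
    then show ?thesis using 1(4)[of x] True by simp
  next
    case False
    then have "(prm \<psi> has_real_derivative \<psi> x) (at x within {0..x + 1})"
      unfolding prm_def[abs_def] using 1 by (intro integral_has_real_derivative test_function_continuous t) auto
    moreover have "at x within {0..x + 1} = at x" using False 1 by (intro at_within_interior) auto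
    ultimately show ?thesis by simp
  qed
  have "smooth (prm \<psi>)"
    unfolding smooth_iff
  proof (intro exI[of _ "\<lambda>n. case n of 0 \<Rightarrow> prm \<psi> | Suc k \<Rightarrow> (deriv ^^ k) \<psi>"] conjI allI)
    fix n x
    show "((case n of 0 \<Rightarrow> prm \<psi> | Suc k \<Rightarrow> (deriv ^^ k) \<psi>) has_real_derivative
        (case Suc n of 0 \<Rightarrow> prm \<psi> | Suc k \<Rightarrow> (deriv ^^ k) \<psi>) x) (at x)"
      using D smooth_DERIV[OF test_function_smooth[OF t]] by (cases n) auto
  qed simp
  then have "test_function L (prm \<psi>)"
    using 1 low high by (intro test_functionI[of _ c d]) (auto simp: not_le)
  moreover have "deriv (prm \<psi>) = \<psi>" using D DERIV_imp_deriv by blast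
  ultimately show ?thesis by blast
qed

section \<open>Density of the test functions\<close>

definition tests :: "l2 set" where "tests = emb L ` Collect (test_function L)"

lemma tests_subspace: "subspace tests"
proof (rule subspaceI)
  have lin: "r *\<^sub>R p + s *\<^sub>R q \<in> tests" if pq: "p \<in> tests" "q \<in> tests" for p q r s
  proof -
    from pq obtain \<phi> \<psi> where t: "test_function L \<phi>" "p = emb L \<phi>" "test_function L \<psi>" "q = emb L \<psi>"
      by (auto simp: tests_def)
    have "r *\<^sub>R p + s *\<^sub>R q = emb L (\<lambda>x. r * \<phi> x + s * \<psi> x)"
      using t by (simp add: emb_lincomb[OF L] test_function_L2)
    then show ?thesis using test_function_lincomb[OF t(1,3), of r s] by (auto simp: tests_def)
  qed
  have ne: "emb L (bump (L / 3) (L / 2) 0) \<in> tests"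
    unfolding tests_def using L by (intro imageI CollectI test_function_bump) auto
  show "0 \<in> tests" using lin[OF ne ne, of 0 0] by simp
  show "p + q \<in> tests" if "p \<in> tests" "q \<in> tests" for p q using lin[OF that, of 1 1] by simp
  show "r *\<^sub>R p \<in> tests" if "p \<in> tests" for p r using lin[OF that that, of r 0] by simp
qed

text \<open>By dominated convergence bump functions yield indicators of intervals, so the primitive
  of such a p is constant inside (0,L); by continuity it equals its value 0 at the left end.\<close>

lemma orthogonal_tests_imp_zero:
  assumes orth: "\<And>\<phi>. test_function L \<phi> \<Longrightarrow> inner p (emb L \<phi>) = 0"
  shows "p = 0"
proof -
  define f where "f = rep L p"
  have f: "f \<in> L2_space L" "emb L f = p" by (simp_all add: f_def rep_L2[OF L] emb_rep[OF L])
  have eq: "inner p (emb L (indicator {c<..<d})) = 0" if cd: "0 < c" "d < L" for c d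
  proof -
    have "(\<lambda>n. LINT x|intv L. f x * bump c d n x) \<longlonglongrightarrow> (LINT x|intv L. f x * indicator {c<..<d} x)"
    proof (rule integral_dominated_convergence[where w = "\<lambda>x. \<bar>f x\<bar>"])
      show "integrable (intv L) (\<lambda>x. \<bar>f x\<bar>)" by (intro Bochner_Integration.integrable_abs L2_integrable f)
      show "AE x in intv L. (\<lambda>n. f x * bump c d n x) \<longlonglongrightarrow> f x * indicator {c<..<d} x"
        by (intro AE_I2 tendsto_mult tendsto_const bump_tendsto)
      show "AE x in intv L. norm (f x * bump c d n x) \<le> \<bar>f x\<bar>" for n
        using bump_bounds by (intro AE_I2) (auto simp: abs_mult mult_left_le)
      show "(\<lambda>x. f x * bump c d n x) \<in> borel_measurable (intv L)" for n
        using cd by (intro borel_measurable_times L2_measurable f test_function_L2 test_function_bump)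
      show "(\<lambda>x. f x * indicator {c<..<d} x) \<in> borel_measurable (intv L)"
        by (intro borel_measurable_times L2_measurable f indicator_L2) auto
    qed
    moreover have "(LINT x|intv L. f x * bump c d n x) = 0" for n
      using orth[OF test_function_bump[OF cd]] inner_emb[OF L f(1) test_function_L2[OF test_function_bump[OF cd]]]
      by (simp add: f(2) L2_inner_def)
    ultimately have "(LINT x|intv L. f x * indicator {c<..<d} x) = 0" by (simp add: LIMSEQ_const_iff)
    then show ?thesis using inner_emb[OF L f(1) indicator_L2, of "{c<..<d}"] by (simp add: f(2) L2_inner_def)
  qed
  have diff: "prm f d = prm f c" if cd: "0 < c" "c \<le> d" "d < L" for c d
  proof -
    have "emb L (indicator {0<..<d}) = emb L (\<lambda>x. indicator {0<..<c} x + indicator {c<..<d} x)"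
    proof (subst emb_eq_iff[OF L])
      have "AE t in lebesgue. t \<noteq> c" using AE_lborel_singleton[of c] by (rule AE_completion)
      then have "AE t in intv L. t \<noteq> c" by (auto simp: AE_restrict_space_iff elim!: eventually_mono)
      then show "AE x in intv L. indicator {0<..<d} x = indicator {0<..<c} x + (indicator {c<..<d} x :: real)"
        by eventually_elim (use cd in \<open>auto simp: indicator_def\<close>)
    qed (auto intro!: L2_add indicator_L2)
    also have "\<dots> = emb L (indicator {0<..<c}) + emb L (indicator {c<..<d})"
      by (intro emb_add[OF L] indicator_L2) auto
    finally show ?thesis
      using cd eq[of c d] f by (simp add: prm_eq_inner[OF L] inner_add_right)
  qed
  have const: "prm f x = prm f (L / 2)" if "x \<in> {0<..<L}" for x
    using diff[of x "L / 2"] diff[of "L / 2" x] that L by (cases "x \<le> L / 2") auto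
  have cl: "closure {0<..<L} = {0..L}" using L by simp
  have const': "prm f x = prm f (L / 2)" if "x \<in> {0..L}" for x
  proof (rule continuous_constant_on_closure[of "{0<..<L}" "prm f"])
    show "continuous_on (closure {0<..<L}) (prm f)" unfolding cl by (rule prm_continuous[OF f(1)])
    show "x \<in> closure {0<..<L}" unfolding cl by (rule that)
  qed (rule const)
  have "prm f x = 0" if "x \<in> {0..L}" for x
    using const'[of 0] const'[OF that] L by (simp add: prm_0)
  then show ?thesis using prm_zero_imp_zero[OF L f(1)] f(2) by simp
qed

lemma tests_dense: "closure tests = UNIV"
  by (rule dense_if_orthogonal_trivial[OF tests_subspace]) (auto intro!: orthogonal_tests_imp_zero simp: tests_def)

end

section \<open>The interval as an instance of the abstract setting\<close>

definition Vop :: "real \<Rightarrow> l2 \<Rightarrow> l2" where "Vop L p = emb L (prm (rep L p))"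
definition Xop :: "real \<Rightarrow> l2 \<Rightarrow> l2" where "Xop L p = emb L (\<lambda>x. x * rep L p x)"
definition one :: "real \<Rightarrow> l2" where "one L = emb L (\<lambda>x. 1)"

lemma prm_FTC:
  assumes "\<And>y. y \<in> {0..L} \<Longrightarrow> (H has_real_derivative h y) (at y within {0..L})" "H 0 = 0" "x \<in> {0..L}"
  shows "prm h x = H x"
proof -
  have "(h has_integral (H x - H 0)) {0..x}"
  proof (rule fundamental_theorem_of_calculus)
    fix y assume y: "y \<in> {0..x}"
    then have "(H has_real_derivative h y) (at y within {0..x})"
      using assms(3) by (intro DERIV_subset[OF assms(1)]) auto
    then show "(H has_vector_derivative h y) (at y within {0..x})"
      by (simp add: has_real_derivative_iff_has_vector_derivative)
  qed (use assms in auto)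
  then show ?thesis using assms by (simp add: prm_def integral_unique)
qed

lemma prm_DERIV:
  assumes "continuous_on {0..L} f" "x \<in> {0..L}"
  shows "(prm f has_real_derivative f x) (at x within {0..L})"
  unfolding prm_def[abs_def] by (rule integral_has_real_derivative[OF assms])

context
  fixes L :: real assumes L: "L > 0"
begin

lemma mult_id_L2: "f \<in> L2_space L \<Longrightarrow> (\<lambda>x. x * f x) \<in> L2_space L"
proof -
  assume f: "f \<in> L2_space L"
  have m: "(\<lambda>x. x * f x) \<in> borel_measurable (intv L)"
  proof (rule borel_measurable_times[OF _ L2_measurable[OF f]])
    show "(\<lambda>x. x) \<in> borel_measurable (intv L)" by (rule L2_measurable[OF continuous_L2]) simp
  qed
  have "integrable (intv L) (\<lambda>x. (x * f x)\<^sup>2)"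
  proof (rule Bochner_Integration.integrable_bound)
    show "integrable (intv L) (\<lambda>x. L\<^sup>2 * (f x)\<^sup>2)" using L2_integrable_square[OF f] by simp
    show "(\<lambda>x. (x * f x)\<^sup>2) \<in> borel_measurable (intv L)" using m by simp
    show "AE x in intv L. norm ((x * f x)\<^sup>2) \<le> norm (L\<^sup>2 * (f x)\<^sup>2)"
      by (intro AE_I2) (auto simp: space_restrict_space power_mult_distrib intro!: mult_right_mono power_mono)
  qed
  with m show ?thesis by (simp add: L2_space_def)
qed

lemma Vop_emb: "f \<in> L2_space L \<Longrightarrow> Vop L (emb L f) = emb L (prm f)"
proof -
  assume f: "f \<in> L2_space L"
  have "prm (rep L (emb L f)) x = prm f x" if "x \<in> {0<..<L}" for x
    using that by (intro prm_cong[OF L rep_L2[OF L] f]) (auto simp: emb_rep[OF L])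
  then show ?thesis unfolding Vop_def by (intro emb_eq_on[OF L] prm_L2 rep_L2[OF L] f)
qed

lemma Xop_emb: "f \<in> L2_space L \<Longrightarrow> Xop L (emb L f) = emb L (\<lambda>x. x * f x)"
proof -
  assume f: "f \<in> L2_space L"
  have "AE x in intv L. x * rep L (emb L f) x = x * f x"
    using rep_emb[OF L f] by eventually_elim simp
  then show ?thesis unfolding Xop_def
    using f by (subst emb_eq_iff[OF L]) (auto intro: mult_id_L2 rep_L2[OF L])
qed

lemma lincomb_rep: "r *\<^sub>R p + s *\<^sub>R q = emb L (\<lambda>x. r * rep L p x + s * rep L q x)"
  by (simp add: emb_lincomb[OF L] rep_L2[OF L] emb_rep[OF L])

lemma bounded_linear_lincombI:
  fixes F :: "l2 \<Rightarrow> l2"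
  assumes "\<And>r s p q. F (r *\<^sub>R p + s *\<^sub>R q) = r *\<^sub>R F p + s *\<^sub>R F q" "\<And>p. norm (F p) \<le> norm p * K"
  shows "bounded_linear F"
proof (rule bounded_linear_intro[where K = K])
  show "F (x + y) = F x + F y" for x y using assms(1)[of 1 x 1 y] by simp
  show "F (r *\<^sub>R x) = r *\<^sub>R F x" for r x using assms(1)[of r x 0 x] by simp
qed (rule assms(2))

lemma Vop_bounded_linear: "bounded_linear (Vop L)"
proof (rule bounded_linear_lincombI[where K = L])
  note R = rep_L2[OF L]
  fix r s p q
  have "Vop L (r *\<^sub>R p + s *\<^sub>R q) = emb L (prm (\<lambda>x. r * rep L p x + s * rep L q x))"
    unfolding lincomb_rep by (intro Vop_emb L2_lincomb R)
  also have "\<dots> = emb L (\<lambda>x. r * prm (rep L p) x + s * prm (rep L q) x)"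
    by (intro emb_eq_on[OF L] prm_L2 L2_lincomb R prm_lincomb[OF L]) auto
  also have "\<dots> = r *\<^sub>R Vop L p + s *\<^sub>R Vop L q"
    unfolding Vop_def by (intro emb_lincomb[OF L] prm_L2 R)
  finally show "Vop L (r *\<^sub>R p + s *\<^sub>R q) = r *\<^sub>R Vop L p + s *\<^sub>R Vop L q" .
next
  fix p
  have "norm (Vop L p) \<le> sqrt L * (sqrt L * norm p)"
    unfolding Vop_def
  proof (rule norm_emb_le[OF L])
    show "\<bar>prm (rep L p) x\<bar> \<le> sqrt L * norm p" if "x \<in> {0<..<L}" for x
      using prm_bound[OF L rep_L2[OF L], of x p] that by (simp add: emb_rep[OF L])
  qed (use L in \<open>auto intro: prm_L2 rep_L2\<close>)
  also have "\<dots> = norm p * L" using L by (simp add: mult.assoc[symmetric] mult.commute)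
  finally show "norm (Vop L p) \<le> norm p * L" .
qed

lemma Xop_bounded_linear: "bounded_linear (Xop L)"
proof (rule bounded_linear_lincombI[where K = L])
  note R = rep_L2[OF L]
  fix r s p q
  have "Xop L (r *\<^sub>R p + s *\<^sub>R q) = emb L (\<lambda>x. x * (r * rep L p x + s * rep L q x))"
    unfolding lincomb_rep by (intro Xop_emb L2_lincomb R)
  also have "\<dots> = emb L (\<lambda>x. r * (x * rep L p x) + s * (x * rep L q x))" by (simp add: algebra_simps)
  also have "\<dots> = r *\<^sub>R Xop L p + s *\<^sub>R Xop L q"
    unfolding Xop_def by (intro emb_lincomb[OF L] mult_id_L2 R)
  finally show "Xop L (r *\<^sub>R p + s *\<^sub>R q) = r *\<^sub>R Xop L p + s *\<^sub>R Xop L q" .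
next
  fix p
  define f where "f = rep L p"
  have f: "f \<in> L2_space L" "emb L f = p" by (simp_all add: f_def rep_L2[OF L] emb_rep[OF L])
  show "norm (Xop L p) \<le> norm p * L"
  proof (rule power2_le_imp_le)
    have "(norm (Xop L p))\<^sup>2 = (LINT x|intv L. (x * f x)\<^sup>2)"
      unfolding f(2)[symmetric] Xop_emb[OF f(1)] power2_norm_eq_inner inner_emb[OF L mult_id_L2[OF f(1)] mult_id_L2[OF f(1)]]
      by (simp add: L2_inner_def power2_eq_square)
    also have "\<dots> \<le> (LINT x|intv L. L\<^sup>2 * (f x)\<^sup>2)"
    proof (rule integral_mono)
      show "integrable (intv L) (\<lambda>x. (x * f x)\<^sup>2)" by (intro L2_integrable_square mult_id_L2 f)
      show "integrable (intv L) (\<lambda>x. L\<^sup>2 * (f x)\<^sup>2)" using L2_integrable_square[OF f(1)] by simp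
    qed (auto simp: space_restrict_space power_mult_distrib intro!: mult_right_mono power_mono)
    also have "\<dots> = (norm p * L)\<^sup>2"
      unfolding f(2)[symmetric] power_mult_distrib power2_norm_eq_inner inner_emb[OF L f(1) f(1)]
      by (simp add: L2_inner_def power2_eq_square)
    finally show "(norm (Xop L p))\<^sup>2 \<le> (norm p * L)\<^sup>2" .
  qed (use L in auto)
qed

text \<open>The identities for V and X are between bounded maps, so they are verified on test
  functions, where the fundamental theorem of calculus applies, and extended by density.\<close>

lemma eq_if_eq_on_tests:
  fixes F G :: "l2 \<Rightarrow> 'b::real_normed_vector"
  assumes "bounded_linear F" "bounded_linear G" "\<And>\<phi>. test_function L \<phi> \<Longrightarrow> F (emb L \<phi>) = G (emb L \<phi>)"
  shows "F p = G p"
proof -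
  have "F p - G p = 0"
  proof (rule continuous_constant_on_closure[of "tests L" "\<lambda>p. F p - G p"])
    show "continuous_on (closure (tests L)) (\<lambda>p. F p - G p)"
      using assms(1,2) by (intro continuous_on_diff linear_continuous_on)
    show "p \<in> closure (tests L)" by (simp add: tests_dense[OF L])
  qed (use assms(3) in \<open>auto simp: tests_def[OF L]\<close>)
  then show ?thesis by simp
qed

lemma Vop_ibp_tests:
  assumes "test_function L \<phi>" "test_function L \<psi>"
  shows "inner (Vop L (emb L \<phi>)) (emb L \<psi>) + inner (emb L \<phi>) (Vop L (emb L \<psi>)) = inner (emb L \<phi>) (one L) * inner (emb L \<psi>) (one L)"
proof -
  note l2 = test_function_L2[OF L assms(1)] test_function_L2[OF L assms(2)]
  have c: "continuous_on {0..L} \<phi>" "continuous_on {0..L} \<psi>" using test_function_continuous[OF L] assms by auto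
  note pc = prm_continuous[OF l2(1)] prm_continuous[OF l2(2)]
  have h1: "(\<lambda>x. prm \<phi> x * \<psi> x) \<in> L2_space L" "(\<lambda>x. \<phi> x * prm \<psi> x) \<in> L2_space L"
    by (intro continuous_L2 continuous_on_mult c pc)+
  have "inner (Vop L (emb L \<phi>)) (emb L \<psi>) + inner (emb L \<phi>) (Vop L (emb L \<psi>))
    = L2_inner L (prm \<phi>) \<psi> + L2_inner L \<phi> (prm \<psi>)"
    by (simp add: Vop_emb l2 inner_emb[OF L] prm_L2)
  also have "\<dots> = prm (\<lambda>x. prm \<phi> x * \<psi> x) L + prm (\<lambda>x. \<phi> x * prm \<psi> x) L"
    unfolding L2_inner_def using h1 by (simp add: L2_integrable_on(3))
  also have "\<dots> = prm (\<lambda>x. 1 * (prm \<phi> x * \<psi> x) + 1 * (\<phi> x * prm \<psi> x)) L"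
    using prm_lincomb[OF L h1, of L 1 1] by simp
  \<comment> \<open>The integrand is the derivative of the product of the two primitives.\<close>
  also have "\<dots> = prm \<phi> L * prm \<psi> L"
    by (rule prm_FTC[of L]) (use L in \<open>auto intro!: derivative_eq_intros prm_DERIV c simp: prm_0\<close>)
  also have "\<dots> = inner (emb L \<phi>) (one L) * inner (emb L \<psi>) (one L)"
    by (simp add: one_def inner_emb_one[OF L] l2)
  finally show ?thesis .
qed

lemma Vop_ibp: "inner (Vop L p) q + inner p (Vop L q) = inner p (one L) * inner q (one L)"
proof -
  have 1: "inner (Vop L p) (emb L \<psi>) + inner p (Vop L (emb L \<psi>)) = inner p (one L) * inner (emb L \<psi>) (one L)"
    if "test_function L \<psi>" for p \<psi>
  proof (rule eq_if_eq_on_tests[of "\<lambda>p. inner (Vop L p) (emb L \<psi>) + inner p (Vop L (emb L \<psi>))"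
        "\<lambda>p. inner p (one L) * inner (emb L \<psi>) (one L)"])
    show "bounded_linear (\<lambda>p. inner (Vop L p) (emb L \<psi>) + inner p (Vop L (emb L \<psi>)))"
      by (intro bounded_linear_add bounded_linear_inner_left_comp Vop_bounded_linear bounded_linear_ident)
    show "bounded_linear (\<lambda>p. inner p (one L) * inner (emb L \<psi>) (one L))"
      by (intro bounded_linear_mult_const bounded_linear_inner_left)
  qed (use Vop_ibp_tests that in blast)
  show ?thesis
  proof (rule eq_if_eq_on_tests[of "\<lambda>q. inner (Vop L p) q + inner p (Vop L q)" "\<lambda>q. inner p (one L) * inner q (one L)"])
    show "bounded_linear (\<lambda>q. inner (Vop L p) q + inner p (Vop L q))"
      by (intro bounded_linear_add bounded_linear_inner_right_comp Vop_bounded_linear bounded_linear_ident)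
    show "bounded_linear (\<lambda>q. inner p (one L) * inner q (one L))"
      by (intro bounded_linear_const_mult bounded_linear_inner_left)
  qed (use 1 in blast)
qed

text \<open>For a test function, x times its primitive minus the iterated primitive has the
  derivative x \<phi> and vanishes at 0.\<close>

lemma Vop_Xop: "Vop L (Xop L p) = Xop L (Vop L p) - Vop L (Vop L p)"
proof (rule eq_if_eq_on_tests[of "\<lambda>p. Vop L (Xop L p)" "\<lambda>p. Xop L (Vop L p) - Vop L (Vop L p)"])
  show "bounded_linear (\<lambda>p. Vop L (Xop L p))"
    by (intro bounded_linear_compose[OF Vop_bounded_linear] Xop_bounded_linear)
  show "bounded_linear (\<lambda>p. Xop L (Vop L p) - Vop L (Vop L p))"
    by (intro bounded_linear_sub bounded_linear_compose[OF Vop_bounded_linear]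
        bounded_linear_compose[OF Xop_bounded_linear] Vop_bounded_linear)
  fix \<phi> assume t: "test_function L \<phi>"
  note l2 = test_function_L2[OF L t]
  have c: "continuous_on {0..L} \<phi>" using test_function_continuous[OF L t] .
  have h: "(\<lambda>x. x * prm \<phi> x) \<in> L2_space L" "prm (prm \<phi>) \<in> L2_space L" "(\<lambda>x. x * \<phi> x) \<in> L2_space L"
    by (intro mult_id_L2 prm_L2 l2)+
  have "Vop L (Xop L (emb L \<phi>)) = emb L (prm (\<lambda>x. x * \<phi> x))" by (simp add: Xop_emb Vop_emb l2 mult_id_L2)
  also have "\<dots> = emb L (\<lambda>x. x * prm \<phi> x - prm (prm \<phi>) x)"
  proof (rule emb_eq_on[OF L])
    fix x assume x: "x \<in> {0<..<L}"
    show "prm (\<lambda>x. x * \<phi> x) x = x * prm \<phi> x - prm (prm \<phi>) x"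
      by (rule prm_FTC[of L])
        (use x in \<open>auto intro!: derivative_eq_intros prm_DERIV c prm_continuous l2 simp: prm_0\<close>)
  qed (intro prm_L2 L2_diff h)+
  also have "\<dots> = Xop L (Vop L (emb L \<phi>)) - Vop L (Vop L (emb L \<phi>))"
    using h by (simp add: emb_diff[OF L] Xop_emb Vop_emb l2 prm_L2)
  finally show "Vop L (Xop L (emb L \<phi>)) = Xop L (Vop L (emb L \<phi>)) - Vop L (Vop L (emb L \<phi>))" .
qed

text \<open>The square of the difference is continuous and nonnegative with integral 0, so it
  vanishes on the closed interval. Including the end points, this makes boundary values depend on
  the class alone.\<close>

lemma continuous_eq_if_emb_eq:
  assumes f: "continuous_on {0..L} f" and g: "continuous_on {0..L} g" and eq: "emb L f = emb L g" and x: "x \<in> {0..L}"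
  shows "f x = g x"
proof -
  define h where "h x = (f x - g x) * (f x - g x)" for x
  have hc: "continuous_on {0..L} h" unfolding h_def by (intro continuous_intros f g)
  have d: "(\<lambda>x. f x - g x) \<in> L2_space L" by (intro continuous_L2 continuous_intros f g)
  have "emb L (\<lambda>x. f x - g x) = 0" using eq by (simp add: emb_diff[OF L] continuous_L2 f g)
  then have "L2_inner L (\<lambda>x. f x - g x) (\<lambda>x. f x - g x) = 0" using inner_emb[OF L d d] by simp
  then have "prm h L = 0"
    using L2_integrable_on(3)[OF continuous_L2[OF hc], of L] by (simp add: L2_inner_def h_def[abs_def])
  then have "h x = 0"
    using integral_eq_0_iff[OF hc] L x by (simp add: prm_def h_def)
  then show ?thesis by (simp add: h_def)
qed

lemma Vop_inj:
  assumes "l *\<^sub>R one L + Vop L p = 0"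
  shows "l = 0 \<and> p = 0"
proof -
  define f where "f = rep L p"
  have f: "f \<in> L2_space L" "emb L f = p" by (simp_all add: f_def rep_L2[OF L] emb_rep[OF L])
  have c: "continuous_on {0..L} (\<lambda>x. l * 1 + 1 * prm f x)" by (intro continuous_intros prm_continuous f)
  have "emb L (\<lambda>x. l * 1 + 1 * prm f x) = l *\<^sub>R one L + 1 *\<^sub>R Vop L p"
    unfolding one_def Vop_def f_def[symmetric] by (intro emb_lincomb[OF L] L2_const prm_L2 f)
  also have "\<dots> = emb L (\<lambda>x. 0)" using assms emb_scale[OF L L2_const[of 1], of 0] by simp
  finally have *: "l * 1 + 1 * prm f x = 0" if "x \<in> {0..L}" for x
    using continuous_eq_if_emb_eq[OF c continuous_on_const _ that] by blast
  from *[of 0] have "l = 0" using L by (simp add: prm_0)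
  moreover have "p = 0" using prm_zero_imp_zero[OF L f(1)] * \<open>l = 0\<close> f(2) by simp
  ultimately show ?thesis by simp
qed

lemma interval_space_L2: "interval_space (Vop L) (Xop L) (one L) L"
proof (rule interval_space.intro)
  show "inner (Xop L p) q = inner p (Xop L q)" for p q
  proof -
    have "inner (emb L (\<lambda>x. x * rep L p x)) (emb L (rep L q)) = inner (emb L (rep L p)) (emb L (\<lambda>x. x * rep L q x))"
      by (simp add: inner_emb[OF L] mult_id_L2 rep_L2[OF L] L2_inner_def mult_ac)
    then show ?thesis by (simp add: Xop_def emb_rep[OF L])
  qed
  show "Xop L (one L) = Vop L (one L)"
  proof -
    have "Xop L (one L) = emb L (\<lambda>x. x * 1)" unfolding one_def by (rule Xop_emb[OF L2_const])
    also have "\<dots> = emb L (prm (\<lambda>x. 1))"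
    proof (rule emb_eq_on[OF L])
      show "x * 1 = prm (\<lambda>x. 1) x" if "x \<in> {0<..<L}" for x using that by (simp add: prm_def)
    qed (intro mult_id_L2 prm_L2 L2_const)+
    also have "\<dots> = Vop L (one L)" unfolding one_def by (rule Vop_emb[OF L2_const, symmetric])
    finally show ?thesis .
  qed
  show "inner (one L) (one L) = L"
    unfolding one_def inner_emb_one[OF L L2_const] using L by (simp add: prm_def)
qed (use L Vop_bounded_linear Xop_bounded_linear Vop_ibp Vop_Xop Vop_inj in auto)

end

section \<open>Weak derivatives and boundary values\<close>

locale kawahara_interval =
  fixes L a b \<alpha>\<^sub>1 \<alpha>\<^sub>2 :: real
  assumes L: "L > 0" and ab_pos: "a > 0" "b > 0" and \<alpha>_pos: "\<alpha>\<^sub>1 > 0" "\<alpha>\<^sub>2 > 0"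
begin

sublocale boundary_problem "Vop L" "Xop L" "one L" L a b \<alpha>\<^sub>1 \<alpha>\<^sub>2
  by (intro boundary_problem.intro interval_space_L2 boundary_problem_axioms.intro L ab_pos \<alpha>_pos)

text \<open>The weak derivative as a relation between classes; there it is single-valued, and the
  arbitrary representative chosen by \<open>weak_deriv\<close> plays no part.\<close>

definition wd :: "nat \<Rightarrow> l2 \<Rightarrow> l2 \<Rightarrow> bool" where
  "wd k f g \<longleftrightarrow> (\<forall>\<phi>. test_function L \<phi> \<longrightarrow> inner f (emb L ((deriv ^^ k) \<phi>)) = (- 1) ^ k * inner g (emb L \<phi>))"

lemma has_weak_deriv_iff:
  assumes "f \<in> L2_space L" "g \<in> L2_space L"
  shows "has_weak_deriv L k f g \<longleftrightarrow> wd k (emb L f) (emb L g)"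
proof -
  have "(LINT x|intv L. f x * (deriv ^^ k) \<phi> x) = inner (emb L f) (emb L ((deriv ^^ k) \<phi>))"
    "(LINT x|intv L. g x * \<phi> x) = inner (emb L g) (emb L \<phi>)" if "test_function L \<phi>" for \<phi>
    using that assms
    by (simp_all add: inner_emb[OF L] test_function_L2[OF L] test_function_funpow_deriv[OF L] L2_inner_def)
  then show ?thesis unfolding has_weak_deriv_def wd_def by simp
qed

lemma wd_0: "wd 0 f g \<longleftrightarrow> f = g"
proof
  assume "wd 0 f g"
  then have "inner (f - g) (emb L \<phi>) = 0" if "test_function L \<phi>" for \<phi>
    using that by (simp add: wd_def inner_diff_left)
  then have "f - g = 0" by (rule orthogonal_tests_imp_zero[OF L])
  then show "f = g" by simp
qed (simp add: wd_def)

lemma wd_diff: "wd k f g \<Longrightarrow> wd k f' g' \<Longrightarrow> wd k (f - f') (g - g')"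
  by (simp add: wd_def inner_diff_left algebra_simps)

lemma wd_unique: "wd k f g \<Longrightarrow> wd k f g' \<Longrightarrow> g = g'"
  using wd_diff[of k f g f g'] wd_0[of 0 "g - g'"] by (simp add: wd_def)

lemma test_prim: "test_function L \<phi> \<Longrightarrow> prim (emb L \<phi>) (emb L (deriv \<phi>)) 0 0"
proof -
  assume t: "test_function L \<phi>"
  note t' = test_function_deriv[OF L t]
  have "Vop L (emb L (deriv \<phi>)) = emb L (prm (deriv \<phi>))" by (intro Vop_emb[OF L] test_function_L2[OF L] t')
  also have "\<dots> = emb L \<phi>"
    by (intro emb_eq_on[OF L] prm_deriv_test[OF L t] prm_L2 test_function_L2[OF L] t t') auto
  finally have "Vop L (emb L (deriv \<phi>)) = emb L \<phi>" .
  moreover have "inner (emb L (deriv \<phi>)) (one L) = 0"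
    using L prm_deriv_test[OF L t, of L] test_function_boundary[OF L t]
    by (simp add: one_def inner_emb_one[OF L] test_function_L2[OF L] t')
  ultimately show ?thesis by (simp add: prim_def)
qed

text \<open>One derivative moves to the test function; the boundary terms vanish there, whatever l
  and r are.\<close>

lemma wd_prim:
  assumes "prim f g l r" "wd k g h"
  shows "wd (Suc k) f h"
  unfolding wd_def
proof (intro allI impI)
  fix \<phi> assume t: "test_function L \<phi>"
  have "inner f (emb L ((deriv ^^ Suc k) \<phi>)) = - inner g (emb L ((deriv ^^ k) \<phi>))"
    using prim_ibp[OF assms(1) test_prim[OF test_function_funpow_deriv[OF L t, of k]]] by simp
  also have "\<dots> = (- 1) ^ Suc k * inner h (emb L \<phi>)" using assms(2) t by (simp add: wd_def)
  finally show "inner f (emb L ((deriv ^^ Suc k) \<phi>)) = (- 1) ^ Suc k * inner h (emb L \<phi>)" .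
qed

lemma wd_test:
  assumes t: "test_function L \<phi>"
  shows "wd k (emb L \<phi>) (emb L ((deriv ^^ k) \<phi>))"
  using t
proof (induction k arbitrary: \<phi>)
  case (Suc k)
  have "wd (Suc k) (emb L \<phi>) (emb L ((deriv ^^ k) (deriv \<phi>)))"
    by (rule wd_prim[OF test_prim[OF Suc.prems] Suc.IH[OF test_function_deriv[OF L Suc.prems]]])
  then show ?case by (simp add: funpow_swap1)
qed (simp add: wd_0)

lemma unit_mass_test: "\<exists>\<psi>. test_function L \<psi> \<and> prm \<psi> L = 1"
proof -
  obtain \<psi> where \<psi>: "test_function L \<psi>" "inner (one L) (emb L \<psi>) \<noteq> 0"
    using orthogonal_tests_imp_zero[OF L, of "one L"] e_ne0 by blast
  define c where "c = prm \<psi> L"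
  have c: "c \<noteq> 0"
    using \<psi> inner_emb_one[OF L test_function_L2[OF L \<psi>(1)]] by (simp add: c_def one_def inner_commute)
  have "test_function L (\<lambda>x. (1 / c) * \<psi> x + 0 * \<psi> x)" by (rule test_function_lincomb[OF L \<psi>(1) \<psi>(1)])
  moreover have "prm (\<lambda>x. (1 / c) * \<psi> x + 0 * \<psi> x) L = 1"
    using prm_lincomb[OF L test_function_L2[OF L \<psi>(1)] test_function_L2[OF L \<psi>(1)], of L "1 / c" 0] c
    by (simp add: c_def)
  ultimately show ?thesis by blast
qed

text \<open>The lemma of du Bois-Reymond: every test function is, up to a multiple of one fixed test
  function, the derivative of a test function.\<close>

lemma wd_Suc_imp:
  assumes "wd (Suc k) f h"
  shows "\<exists>g l r. wd k f g \<and> prim g h l r"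
proof -
  obtain \<psi>\<^sub>0 where \<psi>\<^sub>0: "test_function L \<psi>\<^sub>0" "prm \<psi>\<^sub>0 L = 1" using unit_mass_test by blast
  define C where "C = (- 1) ^ k * inner f (emb L ((deriv ^^ k) \<psi>\<^sub>0)) - inner (Vop L h) (emb L \<psi>\<^sub>0)"
  define g where "g = C *\<^sub>R one L + Vop L h"
  have "wd k f g"
    unfolding wd_def
  proof (intro allI impI)
    fix \<psi> assume t: "test_function L \<psi>"
    define m where "m = prm \<psi> L"
    note l2 = test_function_L2[OF L t] test_function_L2[OF L \<psi>\<^sub>0(1)]
    have m: "inner (one L) (emb L \<psi>) = m"
      by (simp add: m_def one_def inner_emb_one[OF L l2(1)] inner_commute)
    have t': "test_function L (\<lambda>x. 1 * \<psi> x + (- m) * \<psi>\<^sub>0 x)" by (rule test_function_lincomb[OF L t \<psi>\<^sub>0(1)])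
    have "prm (\<lambda>x. 1 * \<psi> x + (- m) * \<psi>\<^sub>0 x) L = 0"
      using prm_lincomb[OF L l2, of L 1 "- m"] \<psi>\<^sub>0(2) by (simp add: m_def)
    then obtain \<phi> where \<phi>: "test_function L \<phi>" "deriv \<phi> = (\<lambda>x. 1 * \<psi> x + (- m) * \<psi>\<^sub>0 x)"
      using test_function_primitive[OF L t'] by blast
    have dk: "emb L ((deriv ^^ k) (deriv \<phi>)) = emb L ((deriv ^^ k) \<psi>) - m *\<^sub>R emb L ((deriv ^^ k) \<psi>\<^sub>0)" for k
      unfolding \<phi>(2) deriv_lincomb[OF test_function_smooth[OF t] test_function_smooth[OF \<psi>\<^sub>0(1)]]
      using emb_lincomb[OF L test_function_L2[OF L test_function_funpow_deriv[OF L t, of k]]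
          test_function_L2[OF L test_function_funpow_deriv[OF L \<psi>\<^sub>0(1), of k]], of 1 "- m"] by simp
    have "inner f (emb L ((deriv ^^ k) \<psi>)) - m * inner f (emb L ((deriv ^^ k) \<psi>\<^sub>0)) = inner f (emb L ((deriv ^^ Suc k) \<phi>))"
      using dk[of k] by (simp add: funpow_swap1 inner_diff_right)
    also have "\<dots> = - ((- 1) ^ k * inner h (emb L \<phi>))" using assms \<phi>(1) by (simp add: wd_def)
    also have "inner h (emb L \<phi>) = - inner (Vop L h) (emb L (deriv \<phi>))"
      using prim_ibp[OF test_prim[OF \<phi>(1)], of "Vop L h" h 0 "inner h (one L)"]
      by (simp add: prim_def inner_commute)
    also have "inner (Vop L h) (emb L (deriv \<phi>)) = inner (Vop L h) (emb L \<psi>) - m * inner (Vop L h) (emb L \<psi>\<^sub>0)"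
      using dk[of 0] by (simp add: inner_diff_right)
    finally have "inner f (emb L ((deriv ^^ k) \<psi>)) = (- 1) ^ k * (inner (Vop L h) (emb L \<psi>) - m * inner (Vop L h) (emb L \<psi>\<^sub>0))
        + m * inner f (emb L ((deriv ^^ k) \<psi>\<^sub>0))" by (simp add: algebra_simps)
    also have "\<dots> = (- 1) ^ k * inner g (emb L \<psi>)"
    proof -
      have "(- 1 :: real) ^ k * (- 1) ^ k = 1" by (simp add: power_mult_distrib[symmetric])
      then have "m * inner f (emb L ((deriv ^^ k) \<psi>\<^sub>0)) = (- 1) ^ k * (m * ((- 1) ^ k * inner f (emb L ((deriv ^^ k) \<psi>\<^sub>0))))"
        by (simp add: mult.left_commute mult.assoc[symmetric])
      then show ?thesis by (simp add: g_def C_def inner_add_left m algebra_simps)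
    qed
    finally show "inner f (emb L ((deriv ^^ k) \<psi>)) = (- 1) ^ k * inner g (emb L \<psi>)" .
  qed
  moreover have "prim g h C (C + inner h (one L))" by (simp add: prim_def g_def)
  ultimately show ?thesis by blast
qed

section \<open>Sobolev spaces, clamped functions and traces in terms of classes\<close>

lemma weak_deriv_emb:
  assumes f: "f \<in> L2_space L" and g: "wd k (emb L f) g"
  shows "weak_deriv L k f \<in> L2_space L" "emb L (weak_deriv L k f) = g"
proof -
  have "\<exists>h. h \<in> L2_space L \<and> has_weak_deriv L k f h"
    using g by (intro exI[of _ "rep L g"]) (simp add: rep_L2[OF L] has_weak_deriv_iff[OF f] emb_rep[OF L])
  then have "weak_deriv L k f \<in> L2_space L \<and> has_weak_deriv L k f (weak_deriv L k f)"
    unfolding weak_deriv_def by (rule someI_ex)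
  then show "weak_deriv L k f \<in> L2_space L" "emb L (weak_deriv L k f) = g"
    using has_weak_deriv_iff[OF f] wd_unique g by auto
qed

lemma sobolev_space_iff: "f \<in> sobolev_space m L \<longleftrightarrow> f \<in> L2_space L \<and> (\<forall>k\<le>m. \<exists>g. wd k (emb L f) g)"
proof
  assume "f \<in> sobolev_space m L"
  then show "f \<in> L2_space L \<and> (\<forall>k\<le>m. \<exists>g. wd k (emb L f) g)"
    using has_weak_deriv_iff unfolding sobolev_space_def by blast
next
  assume a: "f \<in> L2_space L \<and> (\<forall>k\<le>m. \<exists>g. wd k (emb L f) g)"
  have "\<exists>g\<in>L2_space L. has_weak_deriv L k f g" if "k \<le> m" for k
  proof -
    from a that obtain g where "wd k (emb L f) g" by blast
    then show ?thesis using a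
      by (intro bexI[of _ "rep L g"]) (simp_all add: has_weak_deriv_iff rep_L2[OF L] emb_rep[OF L])
  qed
  then show "f \<in> sobolev_space m L" using a by (simp add: sobolev_space_def)
qed

lemma sobolev_norm_2:
  assumes f: "f \<in> L2_space L" and "wd 1 (emb L f) g" "wd 2 (emb L f) h"
  shows "(sobolev_norm 2 L f)\<^sup>2 = (norm (emb L f))\<^sup>2 + (norm g)\<^sup>2 + (norm h)\<^sup>2"
proof -
  have 0: "wd 0 (emb L f) (emb L f)" by (simp add: wd_0)
  have "(L2_norm L (weak_deriv L k f))\<^sup>2 = (norm q)\<^sup>2" if "wd k (emb L f) q" for k q
    using weak_deriv_emb[OF f that] by (simp add: norm_emb[OF L, symmetric])
  from this[OF 0] this[OF assms(2)] this[OF assms(3)]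
  have s: "(\<Sum>k\<le>2. (L2_norm L (weak_deriv L k f))\<^sup>2) = (norm (emb L f))\<^sup>2 + (norm g)\<^sup>2 + (norm h)\<^sup>2"
    by (simp add: numeral_2_eq_2)
  show ?thesis unfolding sobolev_norm_def s by (rule real_sqrt_pow2) simp
qed

text \<open>The difference of w and its projection y onto the closed span of these second
  derivatives is affine, while both w and y are orthogonal to the affine functions; so w =
  y.\<close>

lemma orthogonal_complement_second_derivs:
  assumes w: "inner w (one L) = 0" "inner w (Vop L (one L)) = 0" and "\<delta> > 0"
  shows "\<exists>\<phi>. test_function L \<phi> \<and> norm (w - emb L ((deriv ^^ 2) \<phi>)) < \<delta>"
proof -
  define D where "D = (\<lambda>\<phi>. emb L ((deriv ^^ 2) \<phi>)) ` Collect (test_function L)"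
  have lin: "r *\<^sub>R p + s *\<^sub>R q \<in> D" if "p \<in> D" "q \<in> D" for p q r s
  proof -
    from that obtain \<phi> \<psi> where t: "test_function L \<phi>" "p = emb L ((deriv ^^ 2) \<phi>)" "test_function L \<psi>" "q = emb L ((deriv ^^ 2) \<psi>)"
      by (auto simp: D_def)
    have "emb L ((deriv ^^ 2) (\<lambda>x. r * \<phi> x + s * \<psi> x)) = r *\<^sub>R p + s *\<^sub>R q"
      unfolding deriv_lincomb[OF test_function_smooth[OF t(1)] test_function_smooth[OF t(3)]] t(2,4)
      by (intro emb_lincomb[OF L] test_function_L2[OF L] test_function_funpow_deriv[OF L] t)
    then have "r *\<^sub>R p + s *\<^sub>R q = emb L ((deriv ^^ 2) (\<lambda>x. r * \<phi> x + s * \<psi> x))" by simp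
    then show ?thesis unfolding D_def
      by (intro image_eqI[where x = "\<lambda>x. r * \<phi> x + s * \<psi> x"]) (simp_all add: test_function_lincomb[OF L t(1,3)])
  qed
  have sub: "subspace D"
  proof (rule subspaceI)
    obtain \<psi> where "test_function L \<psi>" using unit_mass_test by blast
    then have "emb L ((deriv ^^ 2) \<psi>) \<in> D" by (auto simp: D_def)
    from lin[OF this this, of 0 0] show "0 \<in> D" by simp
    show "p + q \<in> D" if "p \<in> D" "q \<in> D" for p q using lin[OF that, of 1 1] by simp
    show "r *\<^sub>R p \<in> D" if "p \<in> D" for p r using lin[OF that that, of r 0] by simp
  qed
  have perp: "inner y (one L) = 0 \<and> inner y (Vop L (one L)) = 0" if "y \<in> closure D" for y
  proof -
    have "inner p (one L) = 0 \<and> inner p (Vop L (one L)) = 0" if "p \<in> D" for p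
    proof -
      from that obtain \<phi> where t: "test_function L \<phi>" "p = emb L (deriv (deriv \<phi>))"
        by (auto simp: D_def numeral_2_eq_2)
      note p1 = test_prim[OF test_function_deriv[OF L t(1)]] and p0 = test_prim[OF t(1)]
      have "inner p (one L) = 0" "inner (emb L (deriv \<phi>)) (one L) = 0"
        "Vop L p = emb L (deriv \<phi>)" using p1 p0 by (auto simp: prim_def t(2))
      then show ?thesis using V_ibp[of p "one L"] by simp
    qed
    then have "D \<subseteq> {p. inner p (one L) = 0} \<inter> {p. inner p (Vop L (one L)) = 0}" by blast
    moreover have "closed ({p. inner p (one L) = 0} \<inter> {p. inner p (Vop L (one L)) = 0})"
      by (intro closed_Int closed_Collect_eq continuous_intros)
    ultimately have "closure D \<subseteq> {p. inner p (one L) = 0} \<inter> {p. inner p (Vop L (one L)) = 0}"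
      by (rule closure_minimal)
    then show ?thesis using that by blast
  qed
  obtain y where y: "y \<in> closure D" "\<forall>s\<in>closure D. inner (w - y) s = 0"
    using orthogonal_projection_exists[OF subspace_closure_normed[OF sub] closed_closure, of w] by blast
  \<comment> \<open>Orthogonality to all second derivatives of test functions says that the weak
    second derivative is 0; two uses of \<open>wd_Suc_imp\<close> then make w - y affine.\<close>
  have "wd (Suc 1) (w - y) 0"
    unfolding wd_def
  proof (intro allI impI)
    fix \<phi> assume "test_function L \<phi>"
    then have "emb L ((deriv ^^ 2) \<phi>) \<in> D" by (auto simp: D_def)
    then have "emb L ((deriv ^^ 2) \<phi>) \<in> closure D" by (rule subsetD[OF closure_subset])
    then show "inner (w - y) (emb L ((deriv ^^ Suc 1) \<phi>)) = (- 1) ^ Suc 1 * inner 0 (emb L \<phi>)"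
      using y(2) by (simp add: numeral_2_eq_2)
  qed
  then obtain g l r where g: "wd 1 (w - y) g" "prim g 0 l r" using wd_Suc_imp by blast
  then obtain g' l' r' where g': "wd 0 (w - y) g'" "prim g' g l' r'" using wd_Suc_imp[of 0] by (metis One_nat_def)
  have "w - y = l' *\<^sub>R one L + Vop L (l *\<^sub>R one L)" using g g' by (simp add: wd_0 prim_def V.zero)
  then have "inner (w - y) (w - y) = inner (w - y) (l' *\<^sub>R one L + l *\<^sub>R Vop L (one L))" by (simp add: V.scale)
  also have "\<dots> = 0" using w perp[OF y(1)] by (simp add: inner_simps)
  finally have "w = y" by simp
  then obtain p where "p \<in> D" "dist p w < \<delta>" using y(1) \<open>\<delta> > 0\<close> closure_approachable by blast
  then show ?thesis by (auto simp: D_def dist_norm norm_minus_commute)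
qed

text \<open>Limits of test functions stay clamped because \<open>prim\<close> with zero boundary
  values is a closed relation. Conversely it is enough to approximate the second derivative by those
  of test functions, since V recovers the lower derivatives continuously.\<close>

lemma sobolev_space_0_iff:
  assumes f: "f \<in> L2_space L"
  shows "f \<in> sobolev_space_0 2 L \<longleftrightarrow> (\<exists>u\<^sub>1 w. prim (emb L f) u\<^sub>1 0 0 \<and> prim u\<^sub>1 w 0 0)"
proof
  assume s: "f \<in> sobolev_space_0 2 L"
  then have ex: "\<exists>g. wd k (emb L f) g" if "k \<le> 2" for k
    using that by (simp add: sobolev_space_0_def sobolev_space_iff)
  obtain g\<^sub>1 g\<^sub>2 where g: "wd 1 (emb L f) g\<^sub>1" "wd 2 (emb L f) g\<^sub>2"
    using ex[of 1] ex[of 2] by auto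
  have "\<forall>n. \<exists>\<phi>. test_function L \<phi> \<and> sobolev_norm 2 L (\<lambda>x. f x - \<phi> x) < 1 / (real n + 1)"
    using s by (auto simp: sobolev_space_0_def)
  then obtain \<phi> where t: "\<And>n. test_function L (\<phi> n)" and close: "\<And>n. sobolev_norm 2 L (\<lambda>x. f x - \<phi> n x) < 1 / (real n + 1)"
    by metis
  have norms: "norm (emb L f - emb L (\<phi> n)) \<le> 1 / (real n + 1)" "norm (g\<^sub>1 - emb L (deriv (\<phi> n))) \<le> 1 / (real n + 1)"
    "norm (g\<^sub>2 - emb L (deriv (deriv (\<phi> n)))) \<le> 1 / (real n + 1)" for n
  proof -
    have d: "emb L (\<lambda>x. f x - \<phi> n x) = emb L f - emb L (\<phi> n)" by (intro emb_diff[OF L] f test_function_L2[OF L] t)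
    have "(\<lambda>x. f x - \<phi> n x) \<in> L2_space L" by (intro L2_diff f test_function_L2[OF L] t)
    then have "(sobolev_norm 2 L (\<lambda>x. f x - \<phi> n x))\<^sup>2 = (norm (emb L f - emb L (\<phi> n)))\<^sup>2
        + (norm (g\<^sub>1 - emb L (deriv (\<phi> n))))\<^sup>2 + (norm (g\<^sub>2 - emb L (deriv (deriv (\<phi> n)))))\<^sup>2"
      using wd_diff[OF g(1) wd_test[OF t, of 1 n]] wd_diff[OF g(2) wd_test[OF t, of 2 n]]
      by (subst sobolev_norm_2) (auto simp: d numeral_2_eq_2)
    moreover have "(sobolev_norm 2 L (\<lambda>x. f x - \<phi> n x))\<^sup>2 \<le> (1 / (real n + 1))\<^sup>2"
      using close[of n] by (intro power_mono) (auto simp: sobolev_norm_def sum_nonneg)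
    ultimately have "(norm (emb L f - emb L (\<phi> n)))\<^sup>2 \<le> (1 / (real n + 1))\<^sup>2"
      "(norm (g\<^sub>1 - emb L (deriv (\<phi> n))))\<^sup>2 \<le> (1 / (real n + 1))\<^sup>2"
      "(norm (g\<^sub>2 - emb L (deriv (deriv (\<phi> n)))))\<^sup>2 \<le> (1 / (real n + 1))\<^sup>2"
      using zero_le_power2[of "norm (emb L f - emb L (\<phi> n))"] zero_le_power2[of "norm (g\<^sub>1 - emb L (deriv (\<phi> n)))"]
        zero_le_power2[of "norm (g\<^sub>2 - emb L (deriv (deriv (\<phi> n))))"] by linarith+
    then show "norm (emb L f - emb L (\<phi> n)) \<le> 1 / (real n + 1)" "norm (g\<^sub>1 - emb L (deriv (\<phi> n))) \<le> 1 / (real n + 1)"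
      "norm (g\<^sub>2 - emb L (deriv (deriv (\<phi> n)))) \<le> 1 / (real n + 1)"
      by (auto elim!: power2_le_imp_le)
  qed
  have lim: "h \<longlonglongrightarrow> p" if "\<And>n. norm (p - h n) \<le> 1 / (real n + 1)" for h and p :: l2
  proof (rule LIM_zero_cancel, rule Lim_null_comparison[OF always_eventually])
    show "\<forall>n. norm (h n - p) \<le> 1 / (real n + 1)" using that by (simp add: norm_minus_commute)
    show "(\<lambda>n. 1 / (real n + 1)) \<longlonglongrightarrow> 0" using eps_tendsto by (simp add: eps_def[abs_def])
  qed
  have l0: "(\<lambda>n. emb L (\<phi> n)) \<longlonglongrightarrow> emb L f" and l1: "(\<lambda>n. emb L (deriv (\<phi> n))) \<longlonglongrightarrow> g\<^sub>1"
    and l2: "(\<lambda>n. emb L (deriv (deriv (\<phi> n)))) \<longlonglongrightarrow> g\<^sub>2"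
    using norms by (auto intro!: lim)
  have closed: "prim p q 0 0" if "P \<longlonglongrightarrow> p" "Q \<longlonglongrightarrow> q" "\<And>n. prim (P n) (Q n) 0 0" for P Q and p q :: l2
  proof -
    have "(\<lambda>n. Vop L (Q n)) \<longlonglongrightarrow> Vop L q" by (rule V.tendsto[OF that(2)])
    moreover have "Vop L (Q n) = P n" for n using that(3) by (simp add: prim_def)
    ultimately have "p = Vop L q" using that(1) LIMSEQ_unique by auto
    moreover have "(\<lambda>n. inner (Q n) (one L)) \<longlonglongrightarrow> inner q (one L)" by (intro tendsto_intros that(2))
    then have "inner q (one L) = 0" using that(3) by (simp add: prim_def LIMSEQ_const_iff)
    ultimately show ?thesis by (simp add: prim_def)
  qed
  have "prim (emb L f) g\<^sub>1 0 0" by (rule closed[OF l0 l1]) (intro test_prim t)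
  moreover have "prim g\<^sub>1 g\<^sub>2 0 0" by (rule closed[OF l1 l2]) (intro test_prim test_function_deriv[OF L] t)
  ultimately show "\<exists>u\<^sub>1 w. prim (emb L f) u\<^sub>1 0 0 \<and> prim u\<^sub>1 w 0 0" by blast
next
  assume "\<exists>u\<^sub>1 w. prim (emb L f) u\<^sub>1 0 0 \<and> prim u\<^sub>1 w 0 0"
  then obtain u\<^sub>1 w where p: "prim (emb L f) u\<^sub>1 0 0" "prim u\<^sub>1 w 0 0" by blast
  have wd1: "wd 1 (emb L f) u\<^sub>1" using wd_prim[OF p(1), of 0 u\<^sub>1] by (simp add: wd_0)
  have wd2: "wd 2 (emb L f) w" using wd_prim[OF p(1) wd_prim[OF p(2), of 0 w]] by (simp add: wd_0 numeral_2_eq_2)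
  have "\<exists>g. wd k (emb L f) g" if "k \<le> 2" for k
  proof -
    have "k = 0 \<or> k = 1 \<or> k = 2" using that by auto
    then show ?thesis using wd1 wd2 wd_0 by metis
  qed
  then have H2: "f \<in> sobolev_space 2 L" using f by (simp add: sobolev_space_iff)
  have w: "inner w (one L) = 0" "inner w (Vop L (one L)) = 0"
    using p V_ibp[of w "one L"] by (auto simp: prim_def)
  obtain K where K: "K > 0" "\<And>x. norm (Vop L x) \<le> norm x * K" using V.pos_bounded by blast
  \<comment> \<open>With x the error in the second derivative, the errors in the function and its
    first derivative are V V x and V x; M bounds the squared H^2 error by the squared norm of
    x.\<close>
  define M where "M = (K * K)\<^sup>2 + K\<^sup>2 + 1"
  have M: "M > 0" using K by (simp add: M_def add_nonneg_pos)
  have "\<exists>\<phi>. test_function L \<phi> \<and> sobolev_norm 2 L (\<lambda>x. f x - \<phi> x) < \<epsilon>" if "\<epsilon> > 0" for \<epsilon>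
  proof -
    define \<delta> where "\<delta> = \<epsilon> / sqrt M"
    have \<delta>: "\<delta> > 0" using that M by (simp add: \<delta>_def)
    obtain \<phi> where t: "test_function L \<phi>" and close: "norm (w - emb L ((deriv ^^ 2) \<phi>)) < \<delta>"
      using orthogonal_complement_second_derivs[OF w \<delta>] by blast
    define x where "x = w - emb L ((deriv ^^ 2) \<phi>)"
    have e1: "u\<^sub>1 - emb L (deriv \<phi>) = Vop L x"
      using p test_prim[OF test_function_deriv[OF L t]] by (simp add: x_def prim_def V.diff numeral_2_eq_2)
    have e0: "emb L f - emb L \<phi> = Vop L (Vop L x)"
      unfolding e1[symmetric] using p test_prim[OF t] by (simp add: prim_def V.diff)
    have d: "emb L (\<lambda>x. f x - \<phi> x) = emb L f - emb L \<phi>" by (intro emb_diff[OF L] f test_function_L2[OF L] t)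
    have "(\<lambda>x. f x - \<phi> x) \<in> L2_space L" by (intro L2_diff f test_function_L2[OF L] t)
    then have "(sobolev_norm 2 L (\<lambda>x. f x - \<phi> x))\<^sup>2 = (norm (Vop L (Vop L x)))\<^sup>2 + (norm (Vop L x))\<^sup>2 + (norm x)\<^sup>2"
      using wd_diff[OF wd1 wd_test[OF t, of 1]] wd_diff[OF wd2 wd_test[OF t, of 2]]
      by (subst sobolev_norm_2) (auto simp: d e0 e1 x_def[symmetric])
    also have "\<dots> \<le> (norm x * (K * K))\<^sup>2 + (norm x * K)\<^sup>2 + (norm x)\<^sup>2"
    proof -
      have "norm (Vop L (Vop L x)) \<le> norm (Vop L x) * K" by (rule K)
      also have "\<dots> \<le> norm x * K * K" using K by (intro mult_right_mono) auto
      finally show ?thesis using K(2)[of x] by (intro add_mono power_mono) (auto simp: mult.assoc)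
    qed
    also have "\<dots> = M * (norm x)\<^sup>2" by (simp add: M_def power_mult_distrib algebra_simps)
    also have "\<dots> < M * \<delta>\<^sup>2" using close M by (intro mult_strict_left_mono power_strict_mono) (auto simp: x_def)
    also have "\<dots> = \<epsilon>\<^sup>2" using M by (simp add: \<delta>_def power_divide)
    finally have "sobolev_norm 2 L (\<lambda>x. f x - \<phi> x) < \<epsilon>" using that by (auto intro: power_less_imp_less_base)
    then show ?thesis using t by blast
  qed
  then show "f \<in> sobolev_space_0 2 L" using H2 by (simp add: sobolev_space_0_def)
qed

text \<open>The constant l plus the integral of g is a continuous representative, so the choice in
  \<open>trace\<close> succeeds, and any other continuous representative agrees with it on the
  closed interval.\<close>

lemma trace_prim:
  assumes f: "f \<in> L2_space L" and p: "prim (emb L f) g l r"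
  shows "trace L f 0 = l" "trace L f L = r"
proof -
  define G where "G x = l * 1 + 1 * prm (rep L g) x" for x
  have G: "continuous_on {0..L} G" unfolding G_def by (intro continuous_intros prm_continuous[OF rep_L2[OF L]])
  have "emb L G = l *\<^sub>R one L + 1 *\<^sub>R Vop L g"
    unfolding G_def one_def Vop_def by (intro emb_lincomb[OF L] L2_const prm_L2 rep_L2[OF L])
  then have eG: "emb L f = emb L G" using p by (simp add: prim_def)
  then have "continuous_on {0..L} G \<and> (AE x in intv L. f x = G x)"
    using G emb_eq_iff[OF L f continuous_L2[OF G]] by simp
  then have "\<exists>g. continuous_on {0..L} g \<and> (AE x in intv L. f x = g x)" by blast
  then have "continuous_on {0..L} (trace L f) \<and> (AE x in intv L. f x = trace L f x)"
    unfolding trace_def by (rule someI_ex)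
  then have tr: "continuous_on {0..L} (trace L f)" "AE x in intv L. f x = trace L f x" by blast+
  from tr have "continuous_on {0..L} (trace L f)" "emb L (trace L f) = emb L G"
    using emb_eq_iff[OF L f continuous_L2[OF tr(1)]] eG by (blast, metis)
  from continuous_eq_if_emb_eq[OF L this(1) G this(2)]
  have "trace L f x = G x" if "x \<in> {0..L}" for x using that by blast
  then have "trace L f 0 = G 0" "trace L f L = G L" using L by auto
  moreover have "prm (rep L g) L = inner g (one L)"
    using inner_emb_one[OF L rep_L2[OF L], of g] by (simp add: emb_rep[OF L] one_def)
  ultimately show "trace L f 0 = l" "trace L f L = r" using p by (auto simp: G_def prm_0 prim_def)
qed

section \<open>Translation between the concrete operator and the Hilbert space form\<close>

definition kdv_op :: "(real \<Rightarrow> real) \<Rightarrow> real \<Rightarrow> real" where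
  "kdv_op u = (\<lambda>x. - weak_deriv L 1 u x + a * weak_deriv L 3 u x - b * weak_deriv L 5 u x)"

lemma jet_sobolev:
  assumes u: "u \<in> L2_space L" and j: "jet (emb L u) w f l r"
  shows "u \<in> sobolev_space 5 L \<inter> sobolev_space_0 2 L" "kdv_op u \<in> L2_space L" "emb L (kdv_op u) = f"
    "trace L (weak_deriv L 2 u) 0 = l" "trace L (weak_deriv L 2 u) L = r"
proof -
  from j obtain u\<^sub>1 u\<^sub>3 u\<^sub>4 u\<^sub>5 p p' q q' where 1: "prim (emb L u) u\<^sub>1 0 0" "prim u\<^sub>1 w 0 0" "prim w u\<^sub>3 l r"
     "prim u\<^sub>3 u\<^sub>4 p q" "prim u\<^sub>4 u\<^sub>5 p' q'" "f = - u\<^sub>1 + a *\<^sub>R u\<^sub>3 - b *\<^sub>R u\<^sub>5" unfolding jet_def by blast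
  have w0: "wd 0 g g" for g by (simp add: wd_0)
  have d1: "wd 1 (emb L u) u\<^sub>1" using wd_prim[OF 1(1) w0] by simp
  have d2: "wd 2 (emb L u) w" using wd_prim[OF 1(1) wd_prim[OF 1(2) w0]] by (simp add: numeral_2_eq_2)
  have d3: "wd 3 (emb L u) u\<^sub>3" using wd_prim[OF 1(1) wd_prim[OF 1(2) wd_prim[OF 1(3) w0]]] by (simp add: numeral_3_eq_3)
  have d4: "wd 4 (emb L u) u\<^sub>4"
    using wd_prim[OF 1(1) wd_prim[OF 1(2) wd_prim[OF 1(3) wd_prim[OF 1(4) w0]]]] by (simp add: eval_nat_numeral)
  have d5: "wd 5 (emb L u) u\<^sub>5"
    using wd_prim[OF 1(1) wd_prim[OF 1(2) wd_prim[OF 1(3) wd_prim[OF 1(4) wd_prim[OF 1(5) w0]]]]] by (simp add: eval_nat_numeral)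
  have "\<exists>g. wd k (emb L u) g" if "k \<le> 5" for k
  proof -
    have "k = 0 \<or> k = 1 \<or> k = 2 \<or> k = 3 \<or> k = 4 \<or> k = 5" using that by auto
    then show ?thesis using w0 d1 d2 d3 d4 d5 by metis
  qed
  then show "u \<in> sobolev_space 5 L \<inter> sobolev_space_0 2 L"
    using u 1(1,2) sobolev_space_iff sobolev_space_0_iff[OF u] by blast
  note wd' = weak_deriv_emb[OF u d1] weak_deriv_emb[OF u d3] weak_deriv_emb[OF u d5]
  have e: "kdv_op u = (\<lambda>x. (-1) * weak_deriv L 1 u x + 1 * (a * weak_deriv L 3 u x + (- b) * weak_deriv L 5 u x))"
    by (simp add: kdv_op_def fun_eq_iff)
  show "kdv_op u \<in> L2_space L" unfolding e by (intro L2_lincomb wd')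
  have "emb L (kdv_op u) = (-1) *\<^sub>R u\<^sub>1 + 1 *\<^sub>R (a *\<^sub>R u\<^sub>3 + (- b) *\<^sub>R u\<^sub>5)"
    unfolding e using wd' by (simp only: emb_lincomb[OF L] L2_lincomb)
  then show "emb L (kdv_op u) = f" by (simp add: 1(6))
  show "trace L (weak_deriv L 2 u) 0 = l" "trace L (weak_deriv L 2 u) L = r"
    using trace_prim[OF weak_deriv_emb(1)[OF u d2], of u\<^sub>3 l r] 1(3) weak_deriv_emb(2)[OF u d2] by auto
qed

text \<open>Descending from the fifth weak derivative, \<open>wd_Suc_imp\<close> supplies the upper
  derivatives with their boundary values. The clamped chain from below comes from
  \<open>sobolev_space_0_iff\<close>, and uniqueness of the second weak derivative joins the
  two.\<close>

lemma sobolev_jet: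
  assumes "u \<in> sobolev_space 5 L \<inter> sobolev_space_0 2 L"
  shows "\<exists>w f l r. jet (emb L u) w f l r"
proof -
  have u: "u \<in> L2_space L" using assms by (simp add: sobolev_space_iff)
  obtain g\<^sub>5 where d5: "wd 5 (emb L u) g\<^sub>5" using assms sobolev_space_iff[of u 5] by blast
  obtain g\<^sub>4 m\<^sub>4 n\<^sub>4 where 4: "wd 4 (emb L u) g\<^sub>4" "prim g\<^sub>4 g\<^sub>5 m\<^sub>4 n\<^sub>4"
    using wd_Suc_imp[of 4 "emb L u" g\<^sub>5] d5 by (simp add: eval_nat_numeral) blast
  obtain g\<^sub>3 m\<^sub>3 n\<^sub>3 where 3: "wd 3 (emb L u) g\<^sub>3" "prim g\<^sub>3 g\<^sub>4 m\<^sub>3 n\<^sub>3"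
    using wd_Suc_imp[of 3 "emb L u" g\<^sub>4] 4(1) by (simp add: eval_nat_numeral) blast
  obtain g\<^sub>2 m\<^sub>2 n\<^sub>2 where 2: "wd 2 (emb L u) g\<^sub>2" "prim g\<^sub>2 g\<^sub>3 m\<^sub>2 n\<^sub>2"
    using wd_Suc_imp[of 2 "emb L u" g\<^sub>3] 3(1) by (simp add: eval_nat_numeral) blast
  obtain u\<^sub>1 w where h: "prim (emb L u) u\<^sub>1 0 0" "prim u\<^sub>1 w 0 0"
    using assms sobolev_space_0_iff[OF u] by blast
  have "wd 2 (emb L u) w" using wd_prim[OF h(1) wd_prim[OF h(2), of 0 w]] by (simp add: wd_0 numeral_2_eq_2)
  then have "w = g\<^sub>2" using 2(1) wd_unique by blast
  then show ?thesis using h 2(2) 3(2) 4(2) unfolding jet_def by blast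
qed

definition embp :: "state \<Rightarrow> l2 \<times> l2" where "embp z = (emb L (fst z), emb L (snd z))"
definition repp :: "l2 \<times> l2 \<Rightarrow> state" where "repp p = (rep L (fst p), rep L (snd p))"

lemma embp_repp: "embp (repp p) = p" and repp_X0: "repp p \<in> X0 L"
  by (auto simp: embp_def repp_def emb_rep[OF L] X0_def rep_L2[OF L])

lemma X0_eq_iff: "z \<in> X0 L \<Longrightarrow> w \<in> X0 L \<Longrightarrow> X0_eq L z w \<longleftrightarrow> embp z = embp w"
  by (auto simp: X0_eq_def X0_def embp_def emb_eq_iff[OF L])

lemma X0_norm_eq: "z \<in> X0 L \<Longrightarrow> X0_norm L z = norm (embp z)"
  by (auto simp: X0_norm_def X0_inner_def X0_def embp_def norm_eq_sqrt_inner inner_emb[OF L])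

lemma lincomb_X0: "z \<in> X0 L \<Longrightarrow> w \<in> X0 L \<Longrightarrow> lincomb r z s w \<in> X0 L"
  and embp_lincomb: "z \<in> X0 L \<Longrightarrow> w \<in> X0 L \<Longrightarrow> embp (lincomb r z s w) = r *\<^sub>R embp z + s *\<^sub>R embp w"
  by (auto simp: X0_def lincomb_def embp_def L2_lincomb emb_lincomb[OF L])

text \<open>Regularity, boundary conditions and operator together become one equation between
  classes, so the abstract theory applies to the concrete generator.\<close>

lemma generator_iff:
  assumes z: "z \<in> X0 L" and y: "y \<in> X0 L"
  shows "z \<in> dom_A \<alpha>\<^sub>1 \<alpha>\<^sub>2 L \<and> X0_eq L y (op_A a b L z) \<longleftrightarrow> embp z = Binv (embp y)"
proof -
  obtain \<eta> u where zz: "z = (\<eta>, u)" by fastforce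
  have l2: "\<eta> \<in> L2_space L" "u \<in> L2_space L" using z by (auto simp: zz X0_def)
  have A: "op_A a b L z = (kdv_op u, kdv_op \<eta>)" by (simp add: op_A_def zz kdv_op_def)
  have "z \<in> dom_A \<alpha>\<^sub>1 \<alpha>\<^sub>2 L \<and> X0_eq L y (op_A a b L z) \<longleftrightarrow> (\<exists>v. graph (embp z) v (embp y))"
  proof
    assume d: "z \<in> dom_A \<alpha>\<^sub>1 \<alpha>\<^sub>2 L \<and> X0_eq L y (op_A a b L z)"
    then obtain w f l r where j: "jet (emb L u) w f l r" using sobolev_jet[of u] by (auto simp: dom_A_def zz)
    from d obtain w' f' l' r' where j': "jet (emb L \<eta>) w' f' l' r'" using sobolev_jet[of \<eta>] by (auto simp: dom_A_def zz)
    note s = jet_sobolev[OF l2(2) j] and s' = jet_sobolev[OF l2(1) j']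
    have "op_A a b L z \<in> X0 L" using s s' by (simp add: A X0_def)
    then have "embp y = (f, f')" using d X0_eq_iff[OF y] s s' by (simp add: A embp_def)
    moreover have "l + \<alpha>\<^sub>1 * l' = 0" "r - \<alpha>\<^sub>2 * r' = 0" using d s s' by (auto simp: dom_A_def zz)
    ultimately show "\<exists>v. graph (embp z) v (embp y)"
      using j j' unfolding graph_def by (intro exI[of _ "(w', w)"]) (auto simp: embp_def zz)
  next
    assume "\<exists>v. graph (embp z) v (embp y)"
    then obtain w w' l r l' r' where g: "jet (emb L u) w (fst (embp y)) l r" "jet (emb L \<eta>) w' (snd (embp y)) l' r'"
      "l + \<alpha>\<^sub>1 * l' = 0" "r - \<alpha>\<^sub>2 * r' = 0" by (auto simp: graph_def embp_def zz)
    note s = jet_sobolev[OF l2(2) g(1)] and s' = jet_sobolev[OF l2(1) g(2)]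
    have "op_A a b L z \<in> X0 L" using s s' by (simp add: A X0_def)
    then have "X0_eq L y (op_A a b L z)" using X0_eq_iff[OF y] s s' by (simp add: A embp_def)
    moreover have "z \<in> dom_A \<alpha>\<^sub>1 \<alpha>\<^sub>2 L" using s s' g by (simp add: dom_A_def zz)
    ultimately show "z \<in> dom_A \<alpha>\<^sub>1 \<alpha>\<^sub>2 L \<and> X0_eq L y (op_A a b L z)" by blast
  qed
  then show ?thesis by (simp only: graph_iff)
qed

end

section \<open>Well-posedness and decay\<close>

context kawahara_interval
begin

text \<open>S acts on functions and T on classes. Only positive h enter the limit, so the two need
  to correspond only there.\<close>

lemma generated_transfer:
  assumes csg: "\<And>h z. h > 0 \<Longrightarrow> z \<in> X0 L \<Longrightarrow> S h z \<in> X0 L"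
    and T: "\<And>h z. h > 0 \<Longrightarrow> z \<in> X0 L \<Longrightarrow> embp (S h z) = T h (embp z)"
  shows "is_generator L (dom_A \<alpha>\<^sub>1 \<alpha>\<^sub>2 L) (op_A a b L) S \<longleftrightarrow> generated_by_inverse Binv T"
proof -
  have lim: "((\<lambda>h. X0_norm L (state_diff (lincomb (1 / h) (S h z) (- (1 / h)) z) y)) \<longlongrightarrow> 0) (at_right 0)
      \<longleftrightarrow> ((\<lambda>h. (1 / h) *\<^sub>R (T h (embp z) - embp z)) \<longlongrightarrow> embp y) (at_right 0)"
    if zy: "z \<in> X0 L" "y \<in> X0 L" for z y
  proof -
    have "\<forall>\<^sub>F h in at_right 0. X0_norm L (state_diff (lincomb (1 / h) (S h z) (- (1 / h)) z) y)
      = norm ((1 / h) *\<^sub>R (T h (embp z) - embp z) - embp y)"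
      using eventually_at_right_less[of "0::real"]
    proof eventually_elim
      case (elim h)
      have "lincomb (1 / h) (S h z) (- (1 / h)) z \<in> X0 L" by (intro lincomb_X0 csg elim zy)
      then show ?case using zy elim csg[of h z]
        by (simp add: X0_norm_eq lincomb_X0 embp_lincomb T scaleR_diff_right)
    qed
    then have "((\<lambda>h. X0_norm L (state_diff (lincomb (1 / h) (S h z) (- (1 / h)) z) y)) \<longlongrightarrow> 0) (at_right 0)
      \<longleftrightarrow> ((\<lambda>h. norm ((1 / h) *\<^sub>R (T h (embp z) - embp z) - embp y)) \<longlongrightarrow> 0) (at_right 0)"
      by (rule tendsto_cong)
    then show ?thesis by (simp add: tendsto_norm_zero_iff LIM_zero_iff)
  qed
  have "is_generator L (dom_A \<alpha>\<^sub>1 \<alpha>\<^sub>2 L) (op_A a b L) S \<longleftrightarrow>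
    (\<forall>z\<in>X0 L. \<forall>y\<in>X0 L. ((\<lambda>h. (1 / h) *\<^sub>R (T h (embp z) - embp z)) \<longlongrightarrow> embp y) (at_right 0) \<longleftrightarrow> embp z = Binv (embp y))"
    unfolding is_generator_def by (simp add: lim generator_iff)
  also have "\<dots> \<longleftrightarrow> generated_by_inverse Binv T"
    unfolding generated_by_inverse_def
  proof (rule iffI)
    assume A: "\<forall>z\<in>X0 L. \<forall>y\<in>X0 L. ((\<lambda>h. (1 / h) *\<^sub>R (T h (embp z) - embp z)) \<longlongrightarrow> embp y) (at_right 0) \<longleftrightarrow> embp z = Binv (embp y)"
    show "\<forall>p q. ((\<lambda>h. (1 / h) *\<^sub>R (T h p - p)) \<longlongrightarrow> q) (at_right 0) \<longleftrightarrow> p = Binv q"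
    proof (intro allI)
      fix p q
      from A[rule_format, OF repp_X0[of p] repp_X0[of q]]
      show "((\<lambda>h. (1 / h) *\<^sub>R (T h p - p)) \<longlongrightarrow> q) (at_right 0) \<longleftrightarrow> p = Binv q" by (simp only: embp_repp)
    qed
  next
    assume "\<forall>x y. ((\<lambda>h. (1 / h) *\<^sub>R (T h x - x)) \<longlongrightarrow> y) (at_right 0) \<longleftrightarrow> x = Binv y"
    then show "\<forall>z\<in>X0 L. \<forall>y\<in>X0 L. ((\<lambda>h. (1 / h) *\<^sub>R (T h (embp z) - embp z)) \<longlongrightarrow> embp y) (at_right 0) \<longleftrightarrow> embp z = Binv (embp y)" by blast
  qed
  finally show ?thesis .
qed

text \<open>The concrete laws hold almost everywhere and respect equality almost everywhere; hence
  the semigroup descends to classes through the representatives chosen by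
  \<open>repp\<close>.\<close>

lemma abs_semigroup:
  assumes "C0_contraction_semigroup L S"
  shows "contraction_semigroup (\<lambda>t p. embp (S t (repp p)))"
    and "t \<ge> 0 \<Longrightarrow> z \<in> X0 L \<Longrightarrow> embp (S t z) = embp (S t (repp (embp z)))"
    and "t \<ge> 0 \<Longrightarrow> z \<in> X0 L \<Longrightarrow> S t z \<in> X0 L"
proof -
  have X: "\<And>t z. t \<ge> 0 \<Longrightarrow> z \<in> X0 L \<Longrightarrow> S t z \<in> X0 L"
    and cong: "\<And>t z w. t \<ge> 0 \<Longrightarrow> z \<in> X0 L \<Longrightarrow> w \<in> X0 L \<Longrightarrow> X0_eq L z w \<Longrightarrow> X0_eq L (S t z) (S t w)"
    and lin: "\<And>t z w r s. t \<ge> 0 \<Longrightarrow> z \<in> X0 L \<Longrightarrow> w \<in> X0 L \<Longrightarrow> X0_eq L (S t (lincomb r z s w)) (lincomb r (S t z) s (S t w))"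
    and norm: "\<And>t z. t \<ge> 0 \<Longrightarrow> z \<in> X0 L \<Longrightarrow> X0_norm L (S t z) \<le> X0_norm L z"
    and zero: "\<And>z. z \<in> X0 L \<Longrightarrow> X0_eq L (S 0 z) z"
    and add: "\<And>s t z. s \<ge> 0 \<Longrightarrow> t \<ge> 0 \<Longrightarrow> z \<in> X0 L \<Longrightarrow> X0_eq L (S (s + t) z) (S s (S t z))"
    and cont: "\<And>z. z \<in> X0 L \<Longrightarrow> ((\<lambda>t. X0_norm L (state_diff (S t z) z)) \<longlongrightarrow> 0) (at_right 0)"
    using assms unfolding C0_contraction_semigroup_def by blast+
  have E: "embp (S t z) = embp (S t w)" if "t \<ge> 0" "z \<in> X0 L" "w \<in> X0 L" "embp z = embp w" for t z w
    using cong[OF that(1-3)] that X by (simp add: X0_eq_iff)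
  show E': "embp (S t z) = embp (S t (repp (embp z)))" if "t \<ge> 0" "z \<in> X0 L" for t z
    using that by (intro E) (simp_all add: repp_X0 embp_repp)
  show "S t z \<in> X0 L" if "t \<ge> 0" "z \<in> X0 L" for t z by (rule X[OF that])
  have linT: "embp (S t (repp (r *\<^sub>R p + s *\<^sub>R q))) = r *\<^sub>R embp (S t (repp p)) + s *\<^sub>R embp (S t (repp q))"
    if t: "t \<ge> 0" for t r s p q
  proof -
    have "embp (S t (repp (r *\<^sub>R p + s *\<^sub>R q))) = embp (S t (lincomb r (repp p) s (repp q)))"
      using t by (intro E) (simp_all add: repp_X0 embp_repp lincomb_X0 embp_lincomb)
    also have "\<dots> = embp (lincomb r (S t (repp p)) s (S t (repp q)))"
      using lin[OF t repp_X0 repp_X0, of r p s q] t by (simp add: X0_eq_iff X repp_X0 lincomb_X0)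
    finally show ?thesis using t by (simp add: embp_lincomb X repp_X0)
  qed
  show "contraction_semigroup (\<lambda>t p. embp (S t (repp p)))"
    unfolding contraction_semigroup_def
  proof (intro conjI allI impI)
    fix t :: real assume t: "t \<ge> 0"
    show "linear (\<lambda>p. embp (S t (repp p)))"
    proof (rule linearI)
      show "embp (S t (repp (x + y))) = embp (S t (repp x)) + embp (S t (repp y))" for x y
        using linT[OF t, of 1 x 1 y] by simp
      show "embp (S t (repp (r *\<^sub>R x))) = r *\<^sub>R embp (S t (repp x))" for r x
        using linT[OF t, of r x 0 x] by simp
    qed
    show "norm (embp (S t (repp p))) \<le> norm p" for p
      using norm[OF t repp_X0[of p]] t by (simp add: X0_norm_eq X repp_X0 embp_repp)
  next
    show "embp (S 0 (repp p)) = p" for p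
      using zero[OF repp_X0[of p]] by (simp add: X0_eq_iff X repp_X0 embp_repp)
  next
    fix s t :: real and p assume st: "s \<ge> 0" "t \<ge> 0"
    have "embp (S (s + t) (repp p)) = embp (S s (S t (repp p)))"
      using add[OF st repp_X0[of p]] st by (simp add: X0_eq_iff X repp_X0)
    then show "embp (S (s + t) (repp p)) = embp (S s (repp (embp (S t (repp p)))))"
      using E'[OF st(1) X[OF st(2) repp_X0[of p]]] by simp
  next
    fix p
    have "\<forall>\<^sub>F t in at_right 0. X0_norm L (state_diff (S t (repp p)) (repp p)) = norm (embp (S t (repp p)) - p)"
      using eventually_at_right_less[of "0::real"]
      by eventually_elim (simp add: X0_norm_eq lincomb_X0 embp_lincomb X repp_X0 embp_repp)
    then have "((\<lambda>t. norm (embp (S t (repp p)) - p)) \<longlongrightarrow> 0) (at_right 0)"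
      using cont[OF repp_X0[of p]] by (simp add: tendsto_cong)
    then show "((\<lambda>t. embp (S t (repp p))) \<longlongrightarrow> p) (at_right 0)"
      by (simp add: tendsto_norm_zero_iff LIM_zero_iff)
  qed
qed

text \<open>A mild solution may come from any semigroup with the prescribed generator. On classes
  all of these coincide with the constructed one, which is what makes the solution unique.\<close>

lemma mild_solution_unique:
  assumes "mild_solution a b \<alpha>\<^sub>1 \<alpha>\<^sub>2 L z\<^sub>0 w" "z\<^sub>0 \<in> X0 L" "t \<ge> 0"
  shows "w t \<in> X0 L" "embp (w t) = semigroup t (embp z\<^sub>0)"
proof -
  from assms obtain S where S: "C0_contraction_semigroup L S"
    "is_generator L (dom_A \<alpha>\<^sub>1 \<alpha>\<^sub>2 L) (op_A a b L) S" "w t \<in> X0 L" "X0_eq L (w t) (S t z\<^sub>0)"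
    unfolding mild_solution_def by blast
  note A = abs_semigroup[OF S(1)]
  have "generated_by_inverse Binv (\<lambda>t p. embp (S t (repp p)))"
    using S(2) A(2,3) by (subst (asm) generated_transfer) auto
  then have "inverse_generated_semigroup Binv (\<lambda>t p. embp (S t (repp p)))"
    using A(1) by (intro inverse_generated_semigroup.intro dissipative_inverse_axioms inverse_generated_semigroup_axioms.intro)
  moreover have "inverse_generated_semigroup Binv semigroup"
    by (intro inverse_generated_semigroup.intro dissipative_inverse_axioms inverse_generated_semigroup_axioms.intro
        contraction_semigroup_semigroup generated_semigroup)
  ultimately have "embp (S t (repp (embp z\<^sub>0))) = semigroup t (embp z\<^sub>0)"
    by (rule inverse_generated_semigroup_unique[OF _ _ assms(3)])
  then show "embp (w t) = semigroup t (embp z\<^sub>0)"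
    using S(3,4) A(2,3)[OF assms(3,2)] by (simp add: X0_eq_iff)
  show "w t \<in> X0 L" by (rule S(3))
qed

lemma mild_solution_exists: "z\<^sub>0 \<in> X0 L \<Longrightarrow> mild_solution a b \<alpha>\<^sub>1 \<alpha>\<^sub>2 L z\<^sub>0 (\<lambda>t. repp (semigroup t (embp z\<^sub>0)))"
proof -
  assume z0: "z\<^sub>0 \<in> X0 L"
  define S where "S t z = repp (semigroup t (embp z))" for t z
  have X: "S t z \<in> X0 L" and E: "embp (S t z) = semigroup t (embp z)" for t z
    by (simp_all add: S_def repp_X0 embp_repp)
  have "C0_contraction_semigroup L S"
    unfolding C0_contraction_semigroup_def
  proof (intro conjI allI ballI impI)
    fix t :: real and z w :: state and r s :: real assume t: "t \<ge> 0" and zw: "z \<in> X0 L" "w \<in> X0 L"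
    show "X0_eq L (S t (lincomb r z s w)) (lincomb r (S t z) s (S t w))"
      using zw by (simp add: X0_eq_iff X lincomb_X0 E embp_lincomb linear_add[OF semigroup_linear[OF t]] linear_scale[OF semigroup_linear[OF t]])
  next
    fix z assume z: "z \<in> X0 L"
    have "((\<lambda>t. norm (semigroup t (embp z) - embp z)) \<longlongrightarrow> 0) (at_right 0)"
      using semigroup_strongly_continuous[of "embp z"] by (simp add: tendsto_norm_zero_iff LIM_zero_iff)
    then show "((\<lambda>t. X0_norm L (state_diff (S t z) z)) \<longlongrightarrow> 0) (at_right 0)"
      using z by (simp add: X0_norm_eq X lincomb_X0 E embp_lincomb)
  qed (auto simp: X X0_eq_iff X0_norm_eq E semigroup_norm semigroup_0 semigroup_add)
  moreover have "is_generator L (dom_A \<alpha>\<^sub>1 \<alpha>\<^sub>2 L) (op_A a b L) S"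
    by (subst generated_transfer[of S semigroup]) (auto simp: X E generated_semigroup)
  ultimately show ?thesis
    unfolding mild_solution_def using z0 by (intro exI[of _ S]) (auto simp: S_def repp_X0 X0_eq_iff)
qed

sublocale boundary_semigroup "Vop L" "Xop L" "one L" L a b \<alpha>\<^sub>1 \<alpha>\<^sub>2 semigroup
  by (intro boundary_semigroup.intro boundary_problem_axioms boundary_semigroup_axioms.intro
      contraction_semigroup_semigroup generated_semigroup)

lemma continuous_solution: "continuous_in_X0 T L (\<lambda>t. repp (semigroup t p))"
  unfolding continuous_in_X0_def
proof (intro ballI conjI)
  fix t assume t: "t \<in> {0..T}"
  have "continuous_on {0..T} (\<lambda>t. semigroup t p)" by (rule continuous_on_subset[OF S_continuous]) auto
  then have "((\<lambda>s. semigroup s p) \<longlongrightarrow> semigroup t p) (at t within {0..T})" using t by (simp add: continuous_on_def)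
  then have "((\<lambda>s. norm (semigroup s p - semigroup t p)) \<longlongrightarrow> 0) (at t within {0..T})"
    by (simp add: tendsto_norm_zero_iff LIM_zero_iff)
  then show "((\<lambda>s. X0_norm L (state_diff (repp (semigroup s p)) (repp (semigroup t p)))) \<longlongrightarrow> 0) (at t within {0..T})"
    by (simp add: X0_norm_eq lincomb_X0 repp_X0 embp_lincomb embp_repp)
qed (rule repp_X0)

section \<open>The H^2 norm as a function of the second derivatives, and strong
  measurability\<close>

definition H2sq :: "l2 \<times> l2 \<Rightarrow> real" where
  "H2sq w = (norm (VV w))\<^sup>2 + ((norm (Vop L (fst w)))\<^sup>2 + (norm (Vop L (snd w)))\<^sup>2) + (norm w)\<^sup>2"

lemma H2_component:
  assumes f: "f \<in> L2_space L" and e: "emb L f = Vop L (Vop L w)"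
  shows "f \<in> sobolev_space 2 L" "(sobolev_norm 2 L f)\<^sup>2 = (norm (Vop L (Vop L w)))\<^sup>2 + (norm (Vop L w))\<^sup>2 + (norm w)\<^sup>2"
proof -
  have p: "prim (Vop L g) g 0 (inner g (one L))" for g by (simp add: prim_def)
  have 1: "wd 1 (emb L f) (Vop L w)" using wd_prim[OF p, of 0 "Vop L w" "Vop L w"] by (simp add: wd_0 e)
  have 2: "wd 2 (emb L f) w" using wd_prim[OF p wd_prim[OF p, of 0 w w]] by (simp add: wd_0 e numeral_2_eq_2)
  have "\<exists>g. wd k (emb L f) g" if "k \<le> 2" for k
  proof -
    have "k = 0 \<or> k = 1 \<or> k = 2" using that by auto
    then show ?thesis using 1 2 wd_0 by metis
  qed
  then show "f \<in> sobolev_space 2 L" using f by (simp add: sobolev_space_iff)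
  show "(sobolev_norm 2 L f)\<^sup>2 = (norm (Vop L (Vop L w)))\<^sup>2 + (norm (Vop L w))\<^sup>2 + (norm w)\<^sup>2"
    using sobolev_norm_2[OF f 1 2] by (simp add: e)
qed

text \<open>For states of the form \<open>VV w\<close> the H^2 norm depends continuously on w, so
  convergence in H^2 follows from convergence of the second derivatives alone.\<close>

lemma H2_pair:
  assumes z: "z \<in> X0 L" and e: "embp z = VV w"
  shows "z \<in> H2_pair L" "H2_pair_norm L z = sqrt (H2sq w)"
proof -
  have l2: "fst z \<in> L2_space L" "snd z \<in> L2_space L" using z by (auto simp: X0_def)
  have c: "emb L (fst z) = Vop L (Vop L (fst w))" "emb L (snd z) = Vop L (Vop L (snd w))"
    using e by (auto simp: embp_def VV_def)
  note h1 = H2_component[OF l2(1) c(1)] and h2 = H2_component[OF l2(2) c(2)]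
  show "z \<in> H2_pair L" using h1 h2 by (simp add: H2_pair_def mem_Times_iff)
  show "H2_pair_norm L z = sqrt (H2sq w)"
    unfolding H2_pair_norm_def h1(2) h2(2) H2sq_def norm_pair_square[of w] norm_pair_square[of "VV w"]
    by (simp add: VV_def)
qed

lemma H2sq_continuous: "continuous_on A H2sq"
  unfolding H2sq_def
  by (intro continuous_intros linear_continuous_on VV_bounded_linear
      bounded_linear_compose[OF V_bl] bounded_linear_fst bounded_linear_snd)

lemma H2sq_nonneg: "H2sq w \<ge> 0"
  by (simp add: H2sq_def)

lemma H2sq_bound: "\<exists>c\<ge>0. \<forall>w. H2sq w \<le> c * (norm w)\<^sup>2"
proof -
  obtain K where K: "K > 0" "\<And>x. norm (Vop L x) \<le> norm x * K" using V.pos_bounded by blast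
  obtain M where M: "M > 0" "\<And>w. norm (VV w) \<le> norm w * M" using bounded_linear.pos_bounded[OF VV_bounded_linear] by blast
  have "H2sq w \<le> (M\<^sup>2 + K\<^sup>2 + 1) * (norm w)\<^sup>2" for w
  proof -
    have "H2sq w \<le> (norm w * M)\<^sup>2 + ((norm (fst w) * K)\<^sup>2 + (norm (snd w) * K)\<^sup>2) + (norm w)\<^sup>2"
      unfolding H2sq_def by (intro add_mono power_mono K M) auto
    also have "\<dots> = (M\<^sup>2 + K\<^sup>2 + 1) * (norm w)\<^sup>2"
      by (simp add: power_mult_distrib norm_pair_square[of w] algebra_simps)
    finally show ?thesis .
  qed
  moreover have "0 \<le> M\<^sup>2 + K\<^sup>2 + 1" by (simp add: add_nonneg_nonneg)
  ultimately show ?thesis by blast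
qed

lemma simple_function_floor:
  fixes m :: real
  assumes "m > 0"
  shows "simple_function (lebesgue_on {0<..<T}) (\<lambda>t. \<lfloor>t * m\<rfloor>)"
  unfolding simple_function_def
proof (intro conjI ballI)
  have "(\<lambda>t. \<lfloor>t * m\<rfloor>) ` space (lebesgue_on {0<..<T}) \<subseteq> {\<lfloor>0 * m\<rfloor>..\<lfloor>T * m\<rfloor>}"
    using assms by (auto simp: space_restrict_space intro!: floor_mono mult_right_mono)
  then show "finite ((\<lambda>t. \<lfloor>t * m\<rfloor>) ` space (lebesgue_on {0<..<T}))" by (rule finite_subset) simp
  fix k
  have "(\<lambda>t. \<lfloor>t * m\<rfloor>) -` {k} \<inter> space (lebesgue_on {0<..<T}) = {0<..<T} \<inter> {real_of_int k / m..<(real_of_int k + 1) / m}"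
    using assms by (auto simp: space_restrict_space floor_eq_iff field_simps) linarith
  then show "(\<lambda>t. \<lfloor>t * m\<rfloor>) -` {k} \<inter> space (lebesgue_on {0<..<T}) \<in> sets (lebesgue_on {0<..<T})"
    by (auto simp: sets_restrict_space)
qed

text \<open>Uniform continuity, with the sample taken at the left end of the grid cell of t; for t
  inside (0,T) it therefore stays in [0,T].\<close>

lemma step_approximation:
  fixes f :: "real \<Rightarrow> 'x::metric_space"
  assumes "continuous_on {0..T} f" "\<epsilon> > 0"
  shows "\<exists>m>0. \<forall>t\<in>{0<..<T}. dist (f (real_of_int \<lfloor>t * m\<rfloor> / m)) (f t) < \<epsilon>"
proof -
  have "uniformly_continuous_on {0..T} f" using assms(1) by (rule compact_uniformly_continuous) simp
  then obtain \<delta> where \<delta>: "\<delta> > 0" "\<And>s t. s \<in> {0..T} \<Longrightarrow> t \<in> {0..T} \<Longrightarrow> dist s t < \<delta> \<Longrightarrow> dist (f s) (f t) < \<epsilon>"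
    using assms(2) unfolding uniformly_continuous_on_def by metis
  define m where "m = 2 / \<delta>"
  have m: "m > 0" "1 / m < \<delta>" using \<delta>(1) by (auto simp: m_def)
  have "dist (f (real_of_int \<lfloor>t * m\<rfloor> / m)) (f t) < \<epsilon>" if t: "t \<in> {0<..<T}" for t
  proof (rule \<delta>(2))
    define s where "s = real_of_int \<lfloor>t * m\<rfloor> / m"
    have le: "real_of_int \<lfloor>t * m\<rfloor> \<le> t * m" "t * m < real_of_int \<lfloor>t * m\<rfloor> + 1" by linarith+
    have s1: "s \<le> t" using le m by (simp add: s_def pos_divide_le_eq)
    have s2: "t < s + 1 / m" using le m by (simp add: s_def field_simps)
    have "0 \<le> \<lfloor>t * m\<rfloor>" using t m by simp
    then have "0 \<le> s" using m by (simp add: s_def)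
    then show "s \<in> {0..T}" using s1 t by simp
    show "dist s t < \<delta>" using s1 s2 m by (simp add: dist_real_def)
  qed (use t in auto)
  then show ?thesis using m by blast
qed

text \<open>The curves \<open>W (semigroup t (y n))\<close> are continuous in time, so they can be
  replaced by step functions with uniform error below 1 / (n + 1). These converge for almost every t
  to the second derivatives of the solution, hence \<open>VV\<close> of them converges to the
  solution in H^2.\<close>

lemma bochner_solution:
  assumes T: "T > 0"
  shows "bochner_L2_H2 T L (\<lambda>t. repp (semigroup t p))"
proof -
  let ?M = "lebesgue_on {0<..<T}"
  obtain c where c: "c \<ge> 0" "\<And>w. H2sq w \<le> c * (norm w)\<^sup>2" using H2sq_bound by blast
  obtain y w where yw: "AE t in ?M. (\<lambda>n. W (semigroup t (y n))) \<longlonglongrightarrow> w t \<and> VV (w t) = semigroup t p"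
    and int: "integrable ?M (\<lambda>t. H2sq (w t))"
    using smoothing[OF H2sq_continuous H2sq_nonneg c(2) c(1), where T = T and z = p] by blast
  have "\<forall>n. \<exists>m>0. \<forall>t\<in>{0<..<T}. dist (W (semigroup (real_of_int \<lfloor>t * m\<rfloor> / m) (y n))) (W (semigroup t (y n))) < 1 / (real n + 1)"
    by (intro allI step_approximation continuous_on_subset[OF W_continuous]) auto
  then obtain m where m: "\<And>n. m n > 0"
    "\<And>n t. t \<in> {0<..<T} \<Longrightarrow> dist (W (semigroup (real_of_int \<lfloor>t * m n\<rfloor> / m n) (y n))) (W (semigroup t (y n))) < 1 / (real n + 1)"
    by metis
  define v where "v n t = W (semigroup (real_of_int \<lfloor>t * m n\<rfloor> / m n) (y n))" for n t
  define s where "s n t = repp (VV (v n t))" for n t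
  have eq: "AE t in ?M. H2_pair_norm L (repp (semigroup t p)) = sqrt (H2sq (w t)) \<and> repp (semigroup t p) \<in> H2_pair L"
    using yw
  proof eventually_elim
    case (elim t)
    then show ?case using H2_pair[OF repp_X0, of "semigroup t p" "w t"] by (simp add: embp_repp)
  qed
  have simple: "simple_function ?M (s n)" for n
  proof -
    \<comment> \<open>Time enters only through an integer, and \<open>repp\<close> is one fixed
      choice of representatives; so only finitely many functions, not merely finitely many classes,
      occur as values.\<close>
    have "simple_function ?M ((\<lambda>k. repp (VV (W (semigroup (real_of_int k / m n) (y n))))) \<circ> (\<lambda>t. \<lfloor>t * m n\<rfloor>))"
      by (rule simple_function_compose[OF simple_function_floor[OF m(1)]])
    then show ?thesis by (simp add: s_def[abs_def] v_def o_def)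
  qed
  have sH2: "s n t \<in> H2_pair L" for n t
    unfolding s_def by (rule H2_pair(1)[OF repp_X0]) (simp add: embp_repp)
  have lim: "AE t in ?M. (\<lambda>n. H2_pair_norm L (state_diff (s n t) (repp (semigroup t p)))) \<longlonglongrightarrow> 0"
    using yw AE_space
  proof eventually_elim
    case (elim t)
    then have t: "t \<in> {0<..<T}" by (simp add: space_restrict_space)
    have "(\<lambda>n. v n t - W (semigroup t (y n))) \<longlonglongrightarrow> 0"
    proof (rule Lim_null_comparison[OF always_eventually])
      show "\<forall>n. norm (v n t - W (semigroup t (y n))) \<le> 1 / (real n + 1)"
        using m(2)[OF t] by (simp add: v_def dist_norm less_imp_le)
      show "(\<lambda>n. 1 / (real n + 1)) \<longlonglongrightarrow> 0" using eps_tendsto by (simp add: eps_def[abs_def])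
    qed
    moreover have "(\<lambda>n. W (semigroup t (y n)) - w t) \<longlonglongrightarrow> 0" using elim LIM_zero by blast
    ultimately have "(\<lambda>n. (v n t - W (semigroup t (y n))) + (W (semigroup t (y n)) - w t)) \<longlonglongrightarrow> 0 + 0"
      by (rule tendsto_add)
    then have "(\<lambda>n. v n t - w t) \<longlonglongrightarrow> 0" by simp
    moreover have "isCont H2sq 0"
      using H2sq_continuous[of UNIV] by (simp add: continuous_on_eq_continuous_at del: split_paired_All)
    ultimately have "(\<lambda>n. sqrt (H2sq (v n t - w t))) \<longlonglongrightarrow> sqrt (H2sq 0)"
      by (intro tendsto_real_sqrt isCont_tendsto_compose[of 0 H2sq])
    moreover have "H2sq 0 = 0" by (simp add: H2sq_def VV_def V.zero)
    moreover have "H2_pair_norm L (state_diff (s n t) (repp (semigroup t p))) = sqrt (H2sq (v n t - w t))" for n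
      using elim
      by (intro H2_pair(2) lincomb_X0)
         (auto simp: s_def repp_X0 embp_lincomb embp_repp linear_diff[OF bounded_linear.linear[OF VV_bounded_linear]])
    ultimately show ?case by simp
  qed
  have sq: "AE t in ?M. H2sq (w t) = (H2_pair_norm L (repp (semigroup t p)))\<^sup>2"
    using eq by eventually_elim (simp add: H2sq_nonneg)
  have "integrable ?M (\<lambda>t. (H2_pair_norm L (repp (semigroup t p)))\<^sup>2)"
    by (rule integrable_cong_AE_imp[OF int borel_measurable_lebesgue_on_cong_AE[OF _ borel_measurable_integrable[OF int] sq] sq]) simp
  moreover have "AE t in ?M. repp (semigroup t p) \<in> H2_pair L" using eq by eventually_elim simp
  ultimately show ?thesis
    unfolding bochner_L2_H2_def using simple sH2 lim by blast
qed

end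

theorem theorem1p2:
  fixes a b \<alpha>\<^sub>1 \<alpha>\<^sub>2 L :: real
  assumes "a > 0" and "b > 0" and "a \<noteq> b"
    and "\<alpha>\<^sub>1 > 0" and "\<alpha>\<^sub>2 > 0" and "L > 0"
  shows "\<exists>C\<^sub>0>0. \<exists>\<mu>\<^sub>0>0. \<forall>z\<^sub>0 \<in> X0 L. \<exists>z :: real \<Rightarrow> state.
           mild_solution a b \<alpha>\<^sub>1 \<alpha>\<^sub>2 L z\<^sub>0 z \<and>
           (\<forall>w. mild_solution a b \<alpha>\<^sub>1 \<alpha>\<^sub>2 L z\<^sub>0 w \<longrightarrow> (\<forall>t\<ge>0. X0_eq L (w t) (z t))) \<and>
           (\<forall>T>0. continuous_in_X0 T L z \<and> bochner_L2_H2 T L z) \<and>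
           (\<forall>t\<ge>0. X0_norm L (z t) \<le> C\<^sub>0 * exp (- \<mu>\<^sub>0 * t) * X0_norm L z\<^sub>0)"
proof -
  interpret kawahara_interval L a b \<alpha>\<^sub>1 \<alpha>\<^sub>2 by (rule kawahara_interval.intro) (use assms in auto)
  show ?thesis
  proof (rule exI[of _ 2], rule conjI, simp, rule exI[of _ "\<kappa> / 3"], rule conjI, use \<kappa>(1) in simp, rule ballI)
    fix z\<^sub>0 assume z0: "z\<^sub>0 \<in> X0 L"
    define z where "z t = repp (semigroup t (embp z\<^sub>0))" for t
    have "mild_solution a b \<alpha>\<^sub>1 \<alpha>\<^sub>2 L z\<^sub>0 z" using mild_solution_exists[OF z0] by (simp add: z_def[abs_def])
    moreover have "X0_eq L (w t) (z t)" if "mild_solution a b \<alpha>\<^sub>1 \<alpha>\<^sub>2 L z\<^sub>0 w" "t \<ge> 0" for w t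
      using mild_solution_unique[OF that(1) z0 that(2)] by (simp add: X0_eq_iff z_def repp_X0 embp_repp)
    moreover have "continuous_in_X0 T L z \<and> bochner_L2_H2 T L z" if "T > 0" for T
      using continuous_solution bochner_solution[OF that] by (simp add: z_def[abs_def])
    moreover have "X0_norm L (z t) \<le> 2 * exp (- (\<kappa> / 3) * t) * X0_norm L z\<^sub>0" if "t \<ge> 0" for t
      using exponential_decay[OF that, of "embp z\<^sub>0"] by (simp add: X0_norm_eq z0 z_def repp_X0 embp_repp)
    ultimately show "\<exists>z. mild_solution a b \<alpha>\<^sub>1 \<alpha>\<^sub>2 L z\<^sub>0 z \<and>
           (\<forall>w. mild_solution a b \<alpha>\<^sub>1 \<alpha>\<^sub>2 L z\<^sub>0 w \<longrightarrow> (\<forall>t\<ge>0. X0_eq L (w t) (z t))) \<and>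
           (\<forall>T>0. continuous_in_X0 T L z \<and> bochner_L2_H2 T L z) \<and>
           (\<forall>t\<ge>0. X0_norm L (z t) \<le> 2 * exp (- (\<kappa> / 3) * t) * X0_norm L z\<^sub>0)"
      by blast
  qed
qed

end
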